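(* Let $\theta\neq 2$ be a Pisot number, let $\mu_\theta$ be the Bernoulli convolution parameterized by $\theta$, and for $r>0$ put $\mathcal{F}_{\mu_\theta,r}=\{\widehat{\mu_\theta}(rn): n\in\mathbb{Z}\}\subset\mathbb{R}$. Then: (i) for any positive $r\in\mathbb{Q}(\theta)$, the derived set $\mathcal{F}_{\mu_\theta,r}'$ is countable (countably infinite); (ii) for Lebesgue almost every $r>0$, the derived set $\mathcal{F}_{\mu_\theta,r}'$ is a non-empty (non-degenerate, hence uncountable) interval.
   Context: A Pisot number is an algebraic integer greater than $1$ whose other conjugates are all less than $1$ in modulus (rational integers $\ge 2$ are included). For $\theta>1$, the Bernoulli convolution $\mu_\theta$ is the Borel probability measure on $\mathbb{R}$ given by the infinite convolution product over $k\ge 0$ of the measures $\frac12\delta_{-\theta^{-k}}+\frac12\delta_{\theta^{-k}}$, where $\delta_x$ is the Dirac measure at $x$. Its Fourier transform is $\widehat{\mu_\theta}(t)=\prod_{k=0}^\infty\cos(2\pi\theta^{-k}t)$, $t\in\mathbb{R}$. For $E\subset\mathbb{R}$, $E'$ denotes the derived set of $E$, i.e. the set of its limit (accumulation) points. *)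

theory Defs
  imports "HOL-Probability.Probability" "HOL-Computational_Algebra.Computational_Algebra"
begin

text \<open>
  The complex roots of the minimal polynomial of \<open>x\<close> over the rationals (\<open>x\<close> itself included);
  the set is empty if \<open>x\<close> is not algebraic.
\<close>
definition conjugates :: "real \<Rightarrow> complex set" where
  "conjugates x = {z. \<exists>p :: rat poly. irreducible p \<and> lead_coeff p = 1 \<and>
     poly (map_poly of_rat p) x = 0 \<and> poly (map_poly of_rat p) z = 0}"

definition pisot :: "real \<Rightarrow> bool" where
  "pisot \<theta> \<longleftrightarrow> algebraic_int \<theta> \<and> \<theta> > 1 \<and>
     (\<forall>z \<in> conjugates \<theta>. z \<noteq> complex_of_real \<theta> \<longrightarrow> norm z < 1)"

text \<open>The field $\mathbf{Q}(\theta)$, as the smallest subfield of the reals containing \<open>\<theta>\<close>.\<close>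
inductive_set rat_adjoin :: "real \<Rightarrow> real set" for \<theta> :: real where
  base: "\<theta> \<in> rat_adjoin \<theta>"
| rat: "of_rat q \<in> rat_adjoin \<theta>"
| diff: "x \<in> rat_adjoin \<theta> \<Longrightarrow> y \<in> rat_adjoin \<theta> \<Longrightarrow> x - y \<in> rat_adjoin \<theta>"
| mult: "x \<in> rat_adjoin \<theta> \<Longrightarrow> y \<in> rat_adjoin \<theta> \<Longrightarrow> x * y \<in> rat_adjoin \<theta>"
| inverse: "x \<in> rat_adjoin \<theta> \<Longrightarrow> x \<noteq> 0 \<Longrightarrow> inverse x \<in> rat_adjoin \<theta>"

text \<open>
  The measure $\frac12\delta_{-a} + \frac12\delta_a$, as the law of a fair random sign times \<open>a\<close>;
  see \<open>emeasure_two_point\<close>.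
\<close>
definition two_point :: "real \<Rightarrow> real measure" where
  "two_point a = distr (measure_pmf (bernoulli_pmf (1/2))) borel (\<lambda>b. if b then a else - a)"

text \<open>The convolution of the first \<open>n\<close> factors; the empty convolution is $\delta_0$.\<close>
primrec bernoulli_partial :: "real \<Rightarrow> nat \<Rightarrow> real measure" where
  "bernoulli_partial \<theta> 0 = return borel 0"
| "bernoulli_partial \<theta> (Suc n) = (bernoulli_partial \<theta> n \<star> two_point (1 / \<theta> ^ n))"

text \<open>
  The infinite convolution product is the weak limit of the finite ones. For \<open>\<theta> > 1\<close> it exists and
  is unique; see \<open>bernoulli_convolution\<close>.
\<close>
definition bernoulli_convolution :: "real \<Rightarrow> real measure" where
  "bernoulli_convolution \<theta> =
     (THE \<mu>. real_distribution \<mu> \<and> weak_conv_m (bernoulli_partial \<theta>) \<mu>)"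

text \<open>
  The Fourier transform $\hat\mu(t) = \int e^{2\pi i t x}\,d\mu(x)$. The library's \<open>char\<close> lacks
  the factor $2\pi$.
\<close>
definition fourier :: "real measure \<Rightarrow> real \<Rightarrow> complex" where
  "fourier \<mu> t = char \<mu> (2 * pi * t)"

text \<open>
  As a set of reals; for the Bernoulli convolutions \<open>fourier\<close> is real-valued, see
  \<open>fourier_bernoulli_convolution\<close> and \<open>fourier_values_bernoulli_convolution\<close>.
\<close>
definition fourier_values :: "real measure \<Rightarrow> real \<Rightarrow> real set" where
  "fourier_values \<mu> r = {x. \<exists>n :: int. complex_of_real x = fourier \<mu> (r * of_int n)}"


lemma emeasure_two_point:
  assumes [measurable]: "A \<in> sets borel"
  shows "emeasure (two_point a) A =
    1/2 * emeasure (return borel (- a)) A + 1/2 * emeasure (return borel a) A"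
proof -
  have "emeasure (two_point a) A = (\<integral>\<^sup>+b. indicator A (if b then a else - a) \<partial>measure_pmf (bernoulli_pmf (1/2)))"
  proof -
    have "emeasure (two_point a) A = (\<integral>\<^sup>+x. indicator A x \<partial>two_point a)"
      by (simp add: two_point_def)
    then show ?thesis
      unfolding two_point_def by (subst (asm) nn_integral_distr) auto
  qed
  also have "\<dots> = (\<Sum>b\<in>UNIV. indicator A (if b then a else - a) * ennreal (1/2))"
    by (subst nn_integral_measure_pmf_support[of UNIV]) auto
  also have "\<dots> = 1/2 * indicator A (- a) + 1/2 * indicator A a"
  proof -
    have "ennreal (1/2) = 1/2"
      by (subst divide_ennreal[symmetric]) auto
    then show ?thesis unfolding UNIV_bool by (subst sum.insert) (simp_all add: mult.commute)
  qed
  finally show ?thesis by simp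
qed

lemma real_distribution_two_point: "real_distribution (two_point a)"
  unfolding two_point_def by (rule prob_space.real_distribution_distr) (auto intro: prob_space_measure_pmf)

lemma char_two_point: "char (two_point a) t = of_real (cos (t * a))"
proof -
  have "char (two_point a) t = (\<integral>b. iexp (t * (if b then a else - a)) \<partial>measure_pmf (bernoulli_pmf (1/2)))"
    unfolding two_point_def char_def by (subst integral_distr) auto
  also have "\<dots> = iexp (t * a) / 2 + iexp (- (t * a)) / 2"
    by (subst integral_measure_pmf[of UNIV]) (auto simp: UNIV_bool scaleR_conv_of_real)
  also have "\<dots> = of_real (cos (t * a))"
    by (simp add: cos_of_real[symmetric] cos_exp_eq add_divide_distrib)
  finally show ?thesis .
qed

lemma AE_two_point: "AE x in two_point a. \<bar>x\<bar> \<le> \<bar>a\<bar>"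
  unfolding two_point_def by (subst AE_distr_iff) auto

context
  fixes M N :: "real measure"
  assumes MN: "real_distribution M" "real_distribution N"
begin

interpretation M: real_distribution M by (rule MN)
interpretation N: real_distribution N by (rule MN)
interpretation P: pair_prob_space M N ..

lemma real_distribution_convolution: "real_distribution (M \<star> N)"
  unfolding convolution_def by (rule P.real_distribution_distr) measurable

lemma char_convolution: "char (M \<star> N) t = char M t * char N t"
proof -
  have "char (M \<star> N) t = (\<integral>z. iexp (t * (fst z + snd z)) \<partial>(M \<Otimes>\<^sub>M N))"
    unfolding convolution_def char_def
    by (subst integral_distr) (auto simp: case_prod_unfold)
  also have "\<dots> = (\<integral>x. \<integral>y. iexp (t * (x + y)) \<partial>N \<partial>M)"
    by (subst P.integral_fst'[symmetric]) (auto intro!: P.integrable_iexp)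
  also have "\<dots> = (\<integral>x. \<integral>y. iexp (t * x) * iexp (t * y) \<partial>N \<partial>M)"
    by (simp add: distrib_left exp_add)
  also have "\<dots> = char M t * char N t"
    unfolding char_def by simp
  finally show ?thesis .
qed

lemma AE_convolution:
  assumes "AE x in M. \<bar>x\<bar> \<le> a" "AE y in N. \<bar>y\<bar> \<le> b"
  shows "AE z in M \<star> N. \<bar>z\<bar> \<le> a + b"
proof -
  have "AE z in M \<Otimes>\<^sub>M N. \<bar>fst z + snd z\<bar> \<le> a + b"
  proof (rule P.AE_pair_measure)
    show "AE x in M. AE y in N. \<bar>fst (x, y) + snd (x, y)\<bar> \<le> a + b"
      using assms(1)
    proof eventually_elim
      case (elim x)
      show ?case using assms(2) by eventually_elim (use elim in auto)
    qed
  qed measurable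
  then show ?thesis
    unfolding convolution_def by (subst AE_distr_iff) (auto simp: case_prod_unfold)
qed

end

lemma real_distribution_bernoulli_partial: "real_distribution (bernoulli_partial \<theta> n)"
  by (induction n)
     (simp_all add: real_distribution_convolution real_distribution_two_point
       real_distribution_def[of "return borel 0"] real_distribution_axioms_def prob_space_return)

lemma char_bernoulli_partial:
  "char (bernoulli_partial \<theta> n) t = of_real (\<Prod>k<n. cos (t / \<theta> ^ k))"
proof (induction n)
  case 0
  show ?case by (simp add: char_def integral_return)
next
  case (Suc n)
  then show ?case
    by (simp add: char_convolution real_distribution_bernoulli_partial real_distribution_two_point
        char_two_point)
qed

lemma AE_bernoulli_partial:
  assumes "\<theta> > 1"
  shows "AE x in bernoulli_partial \<theta> n. \<bar>x\<bar> \<le> (\<Sum>k<n. 1 / \<theta> ^ k)"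
proof (induction n)
  case 0
  have "{x :: real. x = 0} \<in> sets borel" by simp
  then show ?case
    unfolding bernoulli_partial.simps by (subst AE_return) (simp_all add: pred_def)
next
  case (Suc n)
  show ?case
    using AE_convolution[OF real_distribution_bernoulli_partial real_distribution_two_point Suc
        AE_two_point, of "1 / \<theta> ^ n"] assms
    unfolding bernoulli_partial.simps by simp
qed

lemma tight_bernoulli_partial:
  assumes "\<theta> > 1"
  shows "tight (bernoulli_partial \<theta>)"
proof -
  define C where "C = (\<Sum>k. (1 / \<theta>) ^ k)"
  have sm: "summable (\<lambda>k. (1 / \<theta>) ^ k)"
    using assms by (intro summable_geometric) auto
  have C: "(\<Sum>k<n. 1 / \<theta> ^ k) \<le> C" for n
    unfolding C_def using sum_le_suminf[OF sm, of "{..<n}"] assms by (simp add: power_one_over[symmetric])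
  from C[of 0] have "C \<ge> 0" by simp
  have 1: "measure (bernoulli_partial \<theta> n) {- (C + 1)<..C} = 1" for n
  proof -
    interpret real_distribution "bernoulli_partial \<theta> n"
      by (rule real_distribution_bernoulli_partial)
    show ?thesis
    proof (subst prob_eq_1)
      show "AE x in bernoulli_partial \<theta> n. x \<in> {- (C + 1)<..C}"
        using AE_bernoulli_partial[OF assms, of n] by eventually_elim (use C[of n] in auto)
    qed simp
  qed
  show ?thesis
    unfolding tight_def
  proof (intro conjI allI impI)
    fix e :: real assume "e > 0"
    then show "\<exists>a b. a < b \<and> (\<forall>n. 1 - e < measure (bernoulli_partial \<theta> n) {a<..b})"
      using 1 \<open>C \<ge> 0\<close> by (intro exI[of _ "- (C + 1)"] exI[of _ C]) auto
  qed (rule real_distribution_bernoulli_partial)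
qed

lemma convergent_prod_cos:
  fixes \<theta> :: real
  assumes "\<theta> > 1"
  shows "convergent_prod (\<lambda>k. cos (t / \<theta> ^ k))"
proof -
  have "summable (\<lambda>k. \<bar>t\<bar> * (1 / \<theta>) ^ k)"
    using assms by (intro summable_mult summable_geometric) auto
  moreover have "norm (norm (cos (t / \<theta> ^ k) - 1)) \<le> \<bar>t\<bar> * (1 / \<theta>) ^ k" for k
  proof -
    define u where "u = t / \<theta> ^ k"
    have "\<bar>cos u - 1\<bar> \<le> \<bar>u\<bar>"
    proof -
      have "\<bar>cos u - 1\<bar> = 2 * (sin (u/2))\<^sup>2"
        using cos_double_sin[of "u/2"] by simp
      also have "\<dots> = 2 * \<bar>sin (u/2)\<bar> * \<bar>sin (u/2)\<bar>"
        by (simp add: power2_eq_square)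
      also have "\<dots> \<le> 2 * \<bar>u/2\<bar> * 1"
        by (intro mult_mono abs_sin_x_le_abs_x abs_sin_le_one) auto
      finally show ?thesis by simp
    qed
    then show ?thesis
      using assms by (simp add: u_def power_one_over abs_mult)
  qed
  ultimately have "summable (\<lambda>k. norm (cos (t / \<theta> ^ k) - 1))"
    by (rule summable_comparison_test'[where N = 0])
  then show ?thesis
    by (intro abs_convergent_prod_imp_convergent_prod) (simp add: abs_convergent_prod_conv_summable)
qed

lemma char_bernoulli_partial_LIMSEQ:
  assumes "\<theta> > 1"
  shows "(\<lambda>n. char (bernoulli_partial \<theta> n) t) \<longlonglongrightarrow> of_real (\<Prod>k. cos (t / \<theta> ^ k))"
  unfolding char_bernoulli_partial
  by (intro tendsto_of_real has_prod_imp_tendsto' convergent_prod_has_prod convergent_prod_cos assms)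

lemma bernoulli_convolution_ex1:
  assumes "\<theta> > 1"
  shows "\<exists>!\<mu>. real_distribution \<mu> \<and> weak_conv_m (bernoulli_partial \<theta>) \<mu>"
proof -
  obtain r M where r: "strict_mono r" and M: "real_distribution M"
    and w: "weak_conv_m (bernoulli_partial \<theta> \<circ> id \<circ> r) M"
    using tight_imp_convergent_subsubsequence[OF tight_bernoulli_partial[OF assms] strict_mono_id]
    by blast
  have charM: "char M t = of_real (\<Prod>k. cos (t / \<theta> ^ k))" for t
  proof -
    have "(\<lambda>n. char ((bernoulli_partial \<theta> \<circ> id \<circ> r) n) t) \<longlonglongrightarrow> char M t"
      by (rule levy_continuity1[OF _ M w]) (simp add: real_distribution_bernoulli_partial)
    moreover have "(\<lambda>n. char ((bernoulli_partial \<theta> \<circ> id \<circ> r) n) t) \<longlonglongrightarrow> of_real (\<Prod>k. cos (t / \<theta> ^ k))"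
      using LIMSEQ_subseq_LIMSEQ[OF char_bernoulli_partial_LIMSEQ[OF assms] r] by (simp add: o_def)
    ultimately show ?thesis by (rule LIMSEQ_unique)
  qed
  show ?thesis
  proof (rule ex1I[of _ M])
    show "real_distribution M \<and> weak_conv_m (bernoulli_partial \<theta>) M"
      using M charM char_bernoulli_partial_LIMSEQ[OF assms]
      by (auto intro!: levy_continuity real_distribution_bernoulli_partial)
  next
    fix N assume N: "real_distribution N \<and> weak_conv_m (bernoulli_partial \<theta>) N"
    show "N = M"
    proof (rule Levy_uniqueness)
      show "char N = char M"
      proof
        fix t
        have "(\<lambda>n. char (bernoulli_partial \<theta> n) t) \<longlonglongrightarrow> char N t"
          using N by (intro levy_continuity1) (auto intro: real_distribution_bernoulli_partial)
        with char_bernoulli_partial_LIMSEQ[OF assms] show "char N t = char M t"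
          unfolding charM by (metis LIMSEQ_unique)
      qed
    qed (use M N in auto)
  qed
qed

lemma bernoulli_convolution:
  assumes "\<theta> > 1"
  shows "real_distribution (bernoulli_convolution \<theta>)"
    and "weak_conv_m (bernoulli_partial \<theta>) (bernoulli_convolution \<theta>)"
  using theI'[OF bernoulli_convolution_ex1[OF assms]] unfolding bernoulli_convolution_def by auto

lemma fourier_bernoulli_convolution:
  assumes "\<theta> > 1"
  shows "fourier (bernoulli_convolution \<theta>) t = of_real (\<Prod>k. cos (2 * pi * t / \<theta> ^ k))"
  unfolding fourier_def
  using levy_continuity1[OF real_distribution_bernoulli_partial bernoulli_convolution[OF assms]]
    char_bernoulli_partial_LIMSEQ[OF assms]
  by (metis LIMSEQ_unique)

lemma fourier_values_bernoulli_convolution: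
  assumes "\<theta> > 1"
  shows "fourier_values (bernoulli_convolution \<theta>) r =
    range (\<lambda>n :: int. \<Prod>k. cos (2 * pi * (r * of_int n) / \<theta> ^ k))"
  by (auto simp: fourier_values_def fourier_bernoulli_convolution[OF assms])

end

theory Submission
  imports Defs "HOL-Complex_Analysis.Cauchy_Integral_Formula"
begin

text \<open>
  Write $f(x) = \prod_k \cos(\pi x\theta^{-k})$, so that the values in question are $f(2rn)$.
  As $\cos(\alpha+\beta) - \cos\alpha\cos\beta = -\sin\alpha\sin\beta$, one has
  $|f(x+y) - f(x)f(y)| \le \sum_k |\sin(\pi x\theta^{-k})\sin(\pi y\theta^{-k})|$: \<open>f\<close> is almost
  multiplicative on numbers that live on distant scales. If $|f(x)| \ge c > 0$, then $x\theta^{-k}$ is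
  close to an integer $a_k$ for all but boundedly many \<open>k\<close>. The $a_k$ satisfy the linear recurrence
  of $\theta$ wherever they are close, which gives $x = \gamma s(\theta) + O(1)$ with an integer
  polynomial \<open>s\<close> that has boundedly many bounded coefficients and a constant $\gamma$ for which
  $\gamma\theta^m$ is exponentially close to the integers.
  Splitting \<open>s\<close> at a long gap, every nonzero limit point is \<open>u f(w)\<close> with \<open>u\<close> a limit of values
  $f(\gamma s_j(\theta))$, the exponents in $s_j$ tending to infinity.

  The limits of $|f(\gamma s(\theta))|$ over polynomials \<open>s\<close> with a bounded number of bounded
  coefficients form a countable set, by induction on that number. For \<open>r\<close> in the field of $\theta$ the
  numbers \<open>w\<close> lie in a lattice, so there are countably many limit points. They are infinitely many
  because there is $0 < V < 1$ such that the absolute values of limit points are stable under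
  multiplication by \<open>V\<close>, and because $f(x+t)f(x-t) < f(x)^2f(t)^2$ prevents \<open>f\<close> from being exactly
  multiplicative, which produces a first nonzero limit point. For almost every \<open>r\<close>, any
  $\gamma s_j(\theta) + t$ with real \<open>t\<close> is approximated by some \<open>2rn\<close> for infinitely many \<open>j\<close>, so that
  the limit points contain $u f(\mathbf{R})$ and form a set that is star-shaped about \<open>0\<close>.
\<close>

section \<open>The infinite product\<close>

text \<open>The hypothesis \<open>\<theta> \<noteq> 2\<close> acts through the lemma
  \<open>nonvanishing\<close>. For \<theta> = 2 the product is sin(2 pi x) / (2 pi x), which tends
  to 0 at infinity, so no nonzero limit point exists. Otherwise every real number has a positive
  integer multiple whose orbit under all powers of \<theta>, positive and negative, meets no zero of
  the cosine factor; this makes V positive and supplies a nonzero limit. Absolute values prevail in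
  part (i) because |f(\<theta>^n x)| is nonincreasing in n, whereas the sign of f(\<theta>^n x) need
  not settle. The limits u are taken from sets that do not involve r. In part (i) the field of
  \<theta> enters twice: a multiple of 2r in Z[\<theta>] puts points 2rn near numbers \<gamma>
  s(\<theta>), and a multiple of 1/(2r) in Z[1/\<theta>] confines w to a lattice. In part (ii) the
  exceptional null set depends on the target u f(t), so countably many targets are treated and the
  rest follows by taking closures.\<close>

definition bprod :: "real \<Rightarrow> real \<Rightarrow> real" where
  "bprod \<theta> x = (\<Prod>k. cos (pi * x / \<theta> ^ k))"

lemma abs_prod_diff_le:
  fixes a b :: "nat \<Rightarrow> real"
  assumes "\<And>k. \<bar>a k\<bar> \<le> 1" "\<And>k. \<bar>b k\<bar> \<le> 1"
  shows "\<bar>(\<Prod>k<n. a k) - (\<Prod>k<n. b k)\<bar> \<le> (\<Sum>k<n. \<bar>a k - b k\<bar>)"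
  using norm_prod_diff[of "{..<n}" a b] assms by simp

text \<open>Up to a constant factor, \<open>\<bar>sin (pi * x)\<bar>\<close> is the distance of x to
  the nearest integer. It is subadditive and requires no choice of that integer, which makes it the
  convenient measure throughout.\<close>

lemma abs_sin_add_le: "\<bar>sin (x + y)\<bar> \<le> \<bar>sin x\<bar> + \<bar>sin (y::real)\<bar>"
proof -
  have "\<bar>sin (x + y)\<bar> \<le> \<bar>sin x * cos y\<bar> + \<bar>cos x * sin y\<bar>"
    unfolding sin_add by (rule abs_triangle_ineq)
  also have "\<dots> \<le> \<bar>sin x\<bar> + \<bar>sin y\<bar>"
    by (intro add_mono) (auto simp: abs_mult intro: mult_left_le mult_left_le_one_le)
  finally show ?thesis .
qed

lemma abs_sin_sum_le: "\<bar>sin (\<Sum>i\<in>I. f i)\<bar> \<le> (\<Sum>i\<in>I. \<bar>sin (f i :: real)\<bar>)"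
proof (induction I rule: infinite_finite_induct)
  case (insert i I)
  then show ?case using abs_sin_add_le[of "f i" "sum f I"] by simp
qed auto

lemma abs_sin_of_int_mult_le: "\<bar>sin (of_int n * x)\<bar> \<le> of_int \<bar>n\<bar> * \<bar>sin (x::real)\<bar>"
proof -
  have nat: "\<bar>sin (of_nat m * x)\<bar> \<le> of_nat m * \<bar>sin x\<bar>" for m
    using abs_sin_sum_le[of "\<lambda>_. x" "{..<m}"] by simp
  show ?thesis
  proof (cases "n \<ge> 0")
    case True
    then show ?thesis using nat[of "nat n"] by simp
  next
    case False
    then show ?thesis using nat[of "nat (- n)"] by simp
  qed
qed

lemma sin_pi_of_int: "sin (pi * of_int n) = 0"
  using sin_times_pi_eq_0[of "of_int n"] by (simp add: mult.commute)

lemma abs_sin_pi_le: "\<bar>sin (pi * x)\<bar> \<le> pi * \<bar>x - of_int n\<bar>"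
proof -
  have "\<bar>sin (pi * x)\<bar> = \<bar>sin (pi * (x - of_int n))\<bar>"
  proof -
    have "(cos (pi * of_int n))\<^sup>2 = 1"
      using sin_cos_squared_add[of "pi * of_int n"] by (simp add: sin_pi_of_int)
    then have "\<bar>cos (pi * of_int n)\<bar> = 1" by (simp add: power2_eq_1_iff abs_if split: if_splits)
    then show ?thesis by (simp add: right_diff_distrib sin_diff sin_pi_of_int abs_mult)
  qed
  also have "\<dots> \<le> \<bar>pi * (x - of_int n)\<bar>" by (rule abs_sin_x_le_abs_x)
  finally show ?thesis by (simp add: abs_mult)
qed

section \<open>Continuity, near multiplicativity and zeros of the product\<close>

locale gt_one =
  fixes \<theta> :: real
  assumes gt1: "\<theta> > 1"
begin

abbreviation "f \<equiv> bprod \<theta>"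

lemma LIMSEQ_f: "(\<lambda>n. \<Prod>k<n. cos (pi * x / \<theta> ^ k)) \<longlonglongrightarrow> f x"
  unfolding bprod_def
  by (intro has_prod_imp_tendsto' convergent_prod_has_prod convergent_prod_cos gt1)

lemma abs_prod_cos_le_one: "\<bar>\<Prod>k<n. cos (c k :: real)\<bar> \<le> 1"
  unfolding abs_prod by (intro prod_le_1) auto

lemma abs_f_le_one: "\<bar>f x\<bar> \<le> 1"
proof (rule LIMSEQ_le_const2[OF tendsto_rabs[OF LIMSEQ_f]])
  show "\<exists>N. \<forall>n\<ge>N. \<bar>\<Prod>k<n. cos (pi * x / \<theta> ^ k)\<bar> \<le> 1"
    by (simp add: abs_prod_cos_le_one)
qed

lemma f_minus [simp]: "f (- x) = f x"
  by (simp add: bprod_def)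

lemma f_0 [simp]: "f 0 = 1"
  by (simp add: bprod_def)

lemma f_times_theta: "f (\<theta> * x) = cos (pi * (\<theta> * x)) * f x"
proof (rule LIMSEQ_unique)
  show "(\<lambda>n. \<Prod>k<Suc n. cos (pi * (\<theta> * x) / \<theta> ^ k)) \<longlonglongrightarrow> f (\<theta> * x)"
    by (rule LIMSEQ_Suc[OF LIMSEQ_f])
  have "(\<Prod>k<Suc n. cos (pi * (\<theta> * x) / \<theta> ^ k)) =
     cos (pi * (\<theta> * x)) * (\<Prod>k<n. cos (pi * x / \<theta> ^ k))" for n
    using gt1 by (subst prod.lessThan_Suc_shift) simp
  then show "(\<lambda>n. \<Prod>k<Suc n. cos (pi * (\<theta> * x) / \<theta> ^ k)) \<longlonglongrightarrow> cos (pi * (\<theta> * x)) * f x"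
    by (simp only:) (intro tendsto_intros LIMSEQ_f)
qed

lemma decseq_abs_f_power: "decseq (\<lambda>n. \<bar>f (\<theta> ^ n * x)\<bar>)"
proof (rule decseq_SucI)
  fix n
  have "\<bar>f (\<theta> ^ Suc n * x)\<bar> = \<bar>cos (pi * (\<theta> * (\<theta> ^ n * x)))\<bar> * \<bar>f (\<theta> ^ n * x)\<bar>"
    by (simp add: f_times_theta abs_mult mult.assoc)
  then show "\<bar>f (\<theta> ^ Suc n * x)\<bar> \<le> \<bar>f (\<theta> ^ n * x)\<bar>"
    by (simp add: mult_left_le_one_le)
qed

text \<open>The factor with index k has Lipschitz constant pi / \<theta>^k; these constants form a
  geometric series with sum pi \<theta> / (\<theta> - 1).\<close>

lemma f_lipschitz: "\<bar>f x - f y\<bar> \<le> pi * \<theta> / (\<theta> - 1) * \<bar>x - y\<bar>"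
proof (rule LIMSEQ_le_const2)
  show "(\<lambda>n. \<bar>(\<Prod>k<n. cos (pi * x / \<theta> ^ k)) - (\<Prod>k<n. cos (pi * y / \<theta> ^ k))\<bar>) \<longlonglongrightarrow> \<bar>f x - f y\<bar>"
    by (intro tendsto_intros LIMSEQ_f)
  have cos_lip: "\<bar>cos u - cos v\<bar> \<le> \<bar>u - v\<bar>" for u v :: real
  proof -
    have "\<bar>cos u - cos v\<bar> = 2 * \<bar>sin ((u + v) / 2)\<bar> * \<bar>sin ((v - u) / 2)\<bar>"
      by (simp add: cos_diff_cos abs_mult)
    also have "\<dots> \<le> 2 * 1 * \<bar>(v - u) / 2\<bar>"
      by (intro mult_mono abs_sin_x_le_abs_x abs_sin_le_one) auto
    finally show ?thesis by simp
  qed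
  have "\<bar>(\<Prod>k<n. cos (pi * x / \<theta> ^ k)) - (\<Prod>k<n. cos (pi * y / \<theta> ^ k))\<bar>
      \<le> pi * \<theta> / (\<theta> - 1) * \<bar>x - y\<bar>" for n
  proof -
    have "\<bar>(\<Prod>k<n. cos (pi * x / \<theta> ^ k)) - (\<Prod>k<n. cos (pi * y / \<theta> ^ k))\<bar>
       \<le> (\<Sum>k<n. \<bar>cos (pi * x / \<theta> ^ k) - cos (pi * y / \<theta> ^ k)\<bar>)"
      by (rule abs_prod_diff_le) auto
    also have "\<dots> \<le> (\<Sum>k<n. pi * \<bar>x - y\<bar> * (1 / \<theta>) ^ k)"
    proof (rule sum_mono)
      fix k
      have "pi * x / \<theta> ^ k - pi * y / \<theta> ^ k = pi * (x - y) / \<theta> ^ k"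
        by (simp add: diff_divide_distrib right_diff_distrib)
      then show "\<bar>cos (pi * x / \<theta> ^ k) - cos (pi * y / \<theta> ^ k)\<bar> \<le> pi * \<bar>x - y\<bar> * (1 / \<theta>) ^ k"
        using cos_lip[of "pi * x / \<theta> ^ k" "pi * y / \<theta> ^ k"] gt1 
        by (simp add: abs_mult power_one_over)
    qed
    also have "\<dots> = pi * \<bar>x - y\<bar> * (\<Sum>k<n. (1 / \<theta>) ^ k)"
      by (simp add: sum_distrib_left)
    also have "\<dots> \<le> pi * \<bar>x - y\<bar> * (\<Sum>k. (1 / \<theta>) ^ k)"
      using gt1 by (intro mult_left_mono sum_le_suminf summable_geometric) auto
    also have "(\<Sum>k. (1 / \<theta>) ^ k) = \<theta> / (\<theta> - 1)"
      using gt1 by (subst suminf_geometric) (auto simp: field_simps)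
    finally show ?thesis by (simp add: mult_ac)
  qed
  then show "\<exists>N. \<forall>n\<ge>N. \<bar>(\<Prod>k<n. cos (pi * x / \<theta> ^ k)) - (\<Prod>k<n. cos (pi * y / \<theta> ^ k))\<bar>
      \<le> pi * \<theta> / (\<theta> - 1) * \<bar>x - y\<bar>" by blast
qed

lemma f_diff_tendsto_0:
  assumes "((\<lambda>n. x n - y n) \<longlongrightarrow> 0) F"
  shows "((\<lambda>n. f (x n) - f (y n)) \<longlongrightarrow> 0) F"
proof (rule Lim_null_comparison)
  show "\<forall>\<^sub>F n in F. norm (f (x n) - f (y n)) \<le> pi * \<theta> / (\<theta> - 1) * \<bar>x n - y n\<bar>"
    using f_lipschitz by simp
  show "((\<lambda>n. pi * \<theta> / (\<theta> - 1) * \<bar>x n - y n\<bar>) \<longlongrightarrow> 0) F"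
    by (rule tendsto_mult_right_zero) (rule tendsto_rabs_zero[OF assms])
qed

lemma f_tendsto:
  assumes "(x \<longlongrightarrow> l) F"
  shows "((\<lambda>n. f (x n)) \<longlongrightarrow> f l) F"
  by (rule LIM_zero_cancel[OF f_diff_tendsto_0[OF LIM_zero[OF assms]]])

lemma continuous_f: "continuous_on S f"
  unfolding continuous_on by (intro ballI f_tendsto tendsto_ident_at)

lemma f_mult_le:
  assumes "\<And>n. (\<Sum>k<n. \<bar>sin (pi * x / \<theta> ^ k)\<bar> * \<bar>sin (pi * y / \<theta> ^ k)\<bar>) \<le> B"
  shows "\<bar>f (x + y) - f x * f y\<bar> \<le> B"
proof (rule LIMSEQ_le_const2)
  show "(\<lambda>n. \<bar>(\<Prod>k<n. cos (pi * (x + y) / \<theta> ^ k)) -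
      (\<Prod>k<n. cos (pi * x / \<theta> ^ k)) * (\<Prod>k<n. cos (pi * y / \<theta> ^ k))\<bar>)
    \<longlonglongrightarrow> \<bar>f (x + y) - f x * f y\<bar>"
    by (intro tendsto_intros LIMSEQ_f)
  have "\<bar>(\<Prod>k<n. cos (pi * (x + y) / \<theta> ^ k)) -
      (\<Prod>k<n. cos (pi * x / \<theta> ^ k)) * (\<Prod>k<n. cos (pi * y / \<theta> ^ k))\<bar> \<le> B" for n
  proof -
    have "\<bar>(\<Prod>k<n. cos (pi * (x + y) / \<theta> ^ k)) -
        (\<Prod>k<n. cos (pi * x / \<theta> ^ k) * cos (pi * y / \<theta> ^ k))\<bar>
      \<le> (\<Sum>k<n. \<bar>cos (pi * (x + y) / \<theta> ^ k) - cos (pi * x / \<theta> ^ k) * cos (pi * y / \<theta> ^ k)\<bar>)"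
      by (rule abs_prod_diff_le) (auto simp: abs_mult intro!: mult_le_one)
    also have "\<dots> = (\<Sum>k<n. \<bar>sin (pi * x / \<theta> ^ k)\<bar> * \<bar>sin (pi * y / \<theta> ^ k)\<bar>)"
      by (rule sum.cong) (simp_all add: distrib_left add_divide_distrib cos_add abs_mult)
    finally show ?thesis using assms[of n] by (simp add: prod.distrib)
  qed
  then show "\<exists>N. \<forall>n\<ge>N. \<bar>(\<Prod>k<n. cos (pi * (x + y) / \<theta> ^ k)) -
      (\<Prod>k<n. cos (pi * x / \<theta> ^ k)) * (\<Prod>k<n. cos (pi * y / \<theta> ^ k))\<bar> \<le> B" by blast
qed

lemma abs_f_le_abs_prod_cos: "finite I \<Longrightarrow> \<bar>f x\<bar> \<le> (\<Prod>k\<in>I. \<bar>cos (pi * x / \<theta> ^ k)\<bar>)"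
proof -
  assume I: "finite I"
  then obtain N where N: "I \<subseteq> {..<N}" using finite_nat_bounded by blast
  have "\<bar>\<Prod>k<n. cos (pi * x / \<theta> ^ k)\<bar> \<le> (\<Prod>k\<in>I. \<bar>cos (pi * x / \<theta> ^ k)\<bar>)" if "n \<ge> N" for n
    unfolding abs_prod
    by (subst prod.subset_diff[of I]) (use N that I in \<open>auto intro!: mult_left_le_one_le prod_nonneg prod_le_1\<close>)
  then show ?thesis
    by (intro LIMSEQ_le_const2[OF tendsto_rabs[OF LIMSEQ_f]]) blast
qed

text \<open>The notion \<open>convergent_prod\<close> asks for a nonzero limit once finitely many
  factors are dropped, so only a vanishing factor can make the product vanish.\<close>

lemma f_nonzero_iff: "f x \<noteq> 0 \<longleftrightarrow> (\<forall>k. cos (pi * x / \<theta> ^ k) \<noteq> 0)"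
proof
  show "\<forall>k. cos (pi * x / \<theta> ^ k) \<noteq> 0" if "f x \<noteq> 0"
  proof
    fix k
    show "cos (pi * x / \<theta> ^ k) \<noteq> 0"
      using abs_f_le_abs_prod_cos[of "{k}" x] that by auto
  qed
  show "f x \<noteq> 0" if "\<forall>k. cos (pi * x / \<theta> ^ k) \<noteq> 0"
    using prodinf_nonzero[OF convergent_prod_cos[OF gt1, of "pi * x"]] that
    unfolding bprod_def by blast
qed

text \<open>A zero of \<open>f\<close>: since the range of \<open>f\<close> is connected, it
  contains the whole segment from 0 to each of its values.\<close>

lemma f_half: "f (1/2) = 0"
proof -
  have "cos (pi * (1/2) / \<theta> ^ 0) = 0" by simp
  then show ?thesis using f_nonzero_iff[of "1/2"] by blast
qed

text \<open>From $\cos(\alpha+\beta)\cos(\alpha-\beta) = \cos^2\alpha\cos^2\beta - \sin^2\alpha\sin^2\beta$.\<close>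
lemma f_add_mult_diff_less:
  assumes x: "x \<noteq> 0" and y: "y \<noteq> 0" and fx: "f x \<noteq> 0" and fy: "f y \<noteq> 0"
    and small: "\<And>k. \<bar>sin (pi * x / \<theta> ^ k)\<bar> * \<bar>sin (pi * y / \<theta> ^ k)\<bar> \<le> \<bar>f x\<bar> * \<bar>f y\<bar>"
  shows "\<bar>f (x + y)\<bar> * \<bar>f (x - y)\<bar> < (f x)\<^sup>2 * (f y)\<^sup>2"
proof -
  define a b where "a k = pi * x / \<theta> ^ k" and "b k = pi * y / \<theta> ^ k" for k
  define P R where "P k = (cos (a k) * cos (b k))\<^sup>2" and "R k = (sin (a k) * sin (b k))\<^sup>2" for k
  have P0: "P k > 0" for k
    using fx fy unfolding f_nonzero_iff P_def a_def b_def by simp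
  have R0: "R k \<ge> 0" for k by (simp add: R_def)
  \<comment> \<open>All factors \<open>P k - R k\<close> are thus nonnegative, so that products can
    be compared factor by factor.\<close>
  have RP: "R k \<le> P k" for k
  proof -
    have "\<bar>sin (a k) * sin (b k)\<bar> \<le> \<bar>f x\<bar> * \<bar>f y\<bar>"
      using small[of k] by (simp add: a_def b_def abs_mult)
    also have "\<dots> \<le> \<bar>cos (a k)\<bar> * \<bar>cos (b k)\<bar>"
      using abs_f_le_abs_prod_cos[of "{k}" x] abs_f_le_abs_prod_cos[of "{k}" y]
      by (intro mult_mono) (auto simp: a_def b_def)
    finally show ?thesis
      unfolding R_def P_def by (simp add: abs_le_square_iff[symmetric] abs_mult)
  qed
  have fac: "cos (pi * (x + y) / \<theta> ^ k) * cos (pi * (x - y) / \<theta> ^ k) = P k - R k" for k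
  proof -
    have "pi * (x + y) / \<theta> ^ k = a k + b k" "pi * (x - y) / \<theta> ^ k = a k - b k"
      by (simp_all add: a_def b_def distrib_left right_diff_distrib add_divide_distrib diff_divide_distrib)
    then show ?thesis
      unfolding P_def R_def by (simp only: cos_add cos_diff power2_eq_square) (simp add: algebra_simps)
  qed
  have tend0: "(\<lambda>k. pi * z / \<theta> ^ k) \<longlonglongrightarrow> 0" for z
    using tendsto_mult_right_zero[OF LIMSEQ_abs_realpow_zero2[of "1 / \<theta>"], of "pi * z"] gt1
    by (simp add: power_one_over)
  have ev: "\<forall>\<^sub>F k in sequentially. sin (pi * z / \<theta> ^ k) \<noteq> 0" if "z \<noteq> 0" for z
  proof -
    have "\<forall>\<^sub>F k in sequentially. -1 < pi * z / \<theta> ^ k" "\<forall>\<^sub>F k in sequentially. pi * z / \<theta> ^ k < 1"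
      using order_tendstoD[OF tend0[of z]] by auto
    then show ?thesis
    proof eventually_elim
      case (elim k)
      define u where "u = pi * z / \<theta> ^ k"
      have "u \<noteq> 0" using that gt1 by (simp add: u_def)
      moreover have "-1 < u" "u < 1" using elim by (simp_all add: u_def)
      ultimately have "sin u \<noteq> 0"
        using sin_gt_zero[of u] sin_gt_zero[of "- u"] pi_gt3 by (cases "u > 0") auto
      then show ?case by (simp add: u_def)
    qed
  qed
  \<comment> \<open>Both arguments are nonzero and tend to 0, so some index has two nonzero sines.
    Its relative loss \<open>R k0 / P k0\<close> is independent of the number of factors and
    therefore keeps the inequality strict in the limit.\<close>
  have "\<exists>k. sin (a k) \<noteq> 0 \<and> sin (b k) \<noteq> 0"
    unfolding a_def b_def using eventually_conj[OF ev[OF x] ev[OF y]] by (auto simp: eventually_sequentially)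
  then obtain k0 where "R k0 > 0" by (auto simp: R_def)
  have le: "(\<Prod>k<n. P k - R k) \<le> (1 - R k0 / P k0) * (\<Prod>k<n. P k)" if "n > k0" for n
  proof -
    have "(\<Prod>k<n. P k - R k) = (P k0 - R k0) * (\<Prod>k\<in>{..<n} - {k0}. P k - R k)"
      using that by (subst prod.remove[of _ k0]) auto
    also have "\<dots> \<le> (P k0 - R k0) * (\<Prod>k\<in>{..<n} - {k0}. P k)"
      using RP R0 by (intro mult_left_mono prod_mono) auto
    also have "\<dots> = (1 - R k0 / P k0) * (P k0 * (\<Prod>k\<in>{..<n} - {k0}. P k))"
      using P0[of k0] by (simp add: field_simps)
    also have "P k0 * (\<Prod>k\<in>{..<n} - {k0}. P k) = (\<Prod>k<n. P k)"
      using that by (subst (2) prod.remove[of _ k0]) auto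
    finally show ?thesis .
  qed
  have "f (x + y) * f (x - y) \<le> (1 - R k0 / P k0) * ((f x)\<^sup>2 * (f y)\<^sup>2)"
  proof (rule LIMSEQ_le)
    show "(\<lambda>n. (\<Prod>k<n. cos (pi * (x + y) / \<theta> ^ k)) * (\<Prod>k<n. cos (pi * (x - y) / \<theta> ^ k)))
        \<longlonglongrightarrow> f (x + y) * f (x - y)"
      by (intro tendsto_intros LIMSEQ_f)
    show "(\<lambda>n. (1 - R k0 / P k0) * ((\<Prod>k<n. cos (pi * x / \<theta> ^ k))\<^sup>2 * (\<Prod>k<n. cos (pi * y / \<theta> ^ k))\<^sup>2))
        \<longlonglongrightarrow> (1 - R k0 / P k0) * ((f x)\<^sup>2 * (f y)\<^sup>2)"
      by (intro tendsto_intros LIMSEQ_f)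
    have "(\<Prod>k<n. cos (pi * (x + y) / \<theta> ^ k)) * (\<Prod>k<n. cos (pi * (x - y) / \<theta> ^ k)) = (\<Prod>k<n. P k - R k)" for n
      by (simp add: prod.distrib[symmetric] fac)
    moreover have "(\<Prod>k<n. cos (pi * x / \<theta> ^ k))\<^sup>2 * (\<Prod>k<n. cos (pi * y / \<theta> ^ k))\<^sup>2 = (\<Prod>k<n. P k)" for n
      unfolding P_def a_def b_def prod_power_distrib[symmetric] prod.distrib power_mult_distrib ..
    ultimately show "\<exists>N. \<forall>n\<ge>N. (\<Prod>k<n. cos (pi * (x + y) / \<theta> ^ k)) * (\<Prod>k<n. cos (pi * (x - y) / \<theta> ^ k))
       \<le> (1 - R k0 / P k0) * ((\<Prod>k<n. cos (pi * x / \<theta> ^ k))\<^sup>2 * (\<Prod>k<n. cos (pi * y / \<theta> ^ k))\<^sup>2)"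
      using le by (intro exI[of _ "Suc k0"]) auto
  qed
  moreover have "f (x + y) * f (x - y) \<ge> 0"
  proof (rule LIMSEQ_le_const)
    show "(\<lambda>n. (\<Prod>k<n. cos (pi * (x + y) / \<theta> ^ k)) * (\<Prod>k<n. cos (pi * (x - y) / \<theta> ^ k)))
        \<longlonglongrightarrow> f (x + y) * f (x - y)"
      by (intro tendsto_intros LIMSEQ_f)
    show "\<exists>N. \<forall>n\<ge>N. 0 \<le> (\<Prod>k<n. cos (pi * (x + y) / \<theta> ^ k)) * (\<Prod>k<n. cos (pi * (x - y) / \<theta> ^ k))"
      using RP by (auto simp: prod.distrib[symmetric] fac intro!: prod_nonneg)
  qed
  moreover have "(1 - R k0 / P k0) * ((f x)\<^sup>2 * (f y)\<^sup>2) < (f x)\<^sup>2 * (f y)\<^sup>2"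
  proof -
    have "R k0 / P k0 > 0" using \<open>R k0 > 0\<close> P0[of k0] by simp
    moreover have "(f x)\<^sup>2 * (f y)\<^sup>2 > 0" using fx fy by simp
    ultimately have "R k0 / P k0 * ((f x)\<^sup>2 * (f y)\<^sup>2) > 0" by (rule mult_pos_pos)
    then show ?thesis unfolding left_diff_distrib by linarith
  qed
  moreover have "\<bar>f (x + y)\<bar> * \<bar>f (x - y)\<bar> = \<bar>f (x + y) * f (x - y)\<bar>"
    by (rule abs_mult[symmetric])
  ultimately show ?thesis by linarith
qed

end

section \<open>Separated scales\<close>

definition nat_dist :: "nat \<Rightarrow> nat \<Rightarrow> nat" where
  "nat_dist m k = (m - k) + (k - m)"

definition supp :: "int poly \<Rightarrow> nat set" where
  "supp s = {m. coeff s m \<noteq> 0}"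

definition sparse_polys :: "nat \<Rightarrow> int \<Rightarrow> int poly set" where
  "sparse_polys K B = {s. card (supp s) \<le> K \<and> (\<forall>m. \<bar>coeff s m\<bar> \<le> B)}"

lemma finite_supp [simp]: "finite (supp s)"
  by (rule finite_subset[of _ "{..degree s}"]) (auto simp: supp_def le_degree)

lemma supp_monom_mult: "supp (monom 1 p * s) = (+) p ` supp s"
proof -
  have "m \<in> supp (monom 1 p * s) \<longleftrightarrow> m \<in> (+) p ` supp s" for m
    by (auto simp: supp_def coeff_monom_mult image_iff le_iff_add)
  then show ?thesis by blast
qed

lemma sparse_polys_monom_mult: "s \<in> sparse_polys K B \<Longrightarrow> monom 1 p * s \<in> sparse_polys K B"
  unfolding sparse_polys_def mem_Collect_eq supp_monom_mult
  by (auto simp: card_image coeff_monom_mult)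

lemma supp_cutoff: "supp (poly_cutoff M s) = supp s \<inter> {..<M}"
  by (auto simp: supp_def coeff_poly_cutoff)

lemma supp_diff_cutoff: "supp (s - poly_cutoff M s) = supp s \<inter> {M..}"
  by (auto simp: supp_def coeff_poly_cutoff)

lemma poly_cutoff_mem_sparse_polys: "s \<in> sparse_polys K B \<Longrightarrow> poly_cutoff M s \<in> sparse_polys K B"
  unfolding sparse_polys_def mem_Collect_eq supp_cutoff
  by (auto simp: coeff_poly_cutoff intro: order_trans[OF card_mono[OF finite_supp]] order_trans[OF abs_ge_zero])

lemma diff_poly_cutoff_mem_sparse_polys:
  "s \<in> sparse_polys K B \<Longrightarrow> s - poly_cutoff M s \<in> sparse_polys K B"
  unfolding sparse_polys_def mem_Collect_eq supp_diff_cutoff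
  by (auto simp: coeff_poly_cutoff intro: order_trans[OF card_mono[OF finite_supp]] order_trans[OF abs_ge_zero])

lemma finite_bounded_polys: "finite {s :: int poly. (\<forall>m. \<bar>coeff s m\<bar> \<le> B) \<and> supp s \<subseteq> {..<M}}"
proof (rule finite_imageD)
  show "inj_on (\<lambda>s. restrict (coeff s) {..<M}) {s :: int poly. (\<forall>m. \<bar>coeff s m\<bar> \<le> B) \<and> supp s \<subseteq> {..<M}}"
  proof (rule inj_onI)
    fix s t :: "int poly"
    assume s: "s \<in> {s. (\<forall>m. \<bar>coeff s m\<bar> \<le> B) \<and> supp s \<subseteq> {..<M}}"
      and t: "t \<in> {s. (\<forall>m. \<bar>coeff s m\<bar> \<le> B) \<and> supp s \<subseteq> {..<M}}"
      and eq: "restrict (coeff s) {..<M} = restrict (coeff t) {..<M}"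
    show "s = t"
    proof (rule poly_eqI)
      fix m
      show "coeff s m = coeff t m"
      proof (cases "m < M")
        case True
        then show ?thesis using fun_cong[OF eq, of m] by simp
      next
        case False
        then have "m \<notin> supp s" "m \<notin> supp t" using s t by auto
        then show ?thesis by (simp add: supp_def)
      qed
    qed
  qed
  show "finite ((\<lambda>s. restrict (coeff s) {..<M}) ` {s :: int poly. (\<forall>m. \<bar>coeff s m\<bar> \<le> B) \<and> supp s \<subseteq> {..<M}})"
  proof (rule finite_subset)
    show "(\<lambda>s. restrict (coeff s) {..<M}) ` {s :: int poly. (\<forall>m. \<bar>coeff s m\<bar> \<le> B) \<and> supp s \<subseteq> {..<M}}
      \<subseteq> {..<M} \<rightarrow>\<^sub>E {- B..B}"
      by (auto simp: abs_le_iff minus_le_iff PiE_def extensional_def)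
    show "finite ({..<M} \<rightarrow>\<^sub>E {- B..B})"
      by (intro finite_PiE) auto
  qed
qed

lemma countable_int_polys: "countable (UNIV :: int poly set)"
proof (rule countable_image_inj_on)
  show "countable (range (coeffs :: int poly \<Rightarrow> int list))" by simp
  show "inj (coeffs :: int poly \<Rightarrow> int list)" by (simp add: inj_def coeffs_eq_iff)
qed

text \<open>\<open>M\<^sub>0\<close> is placed after the largest number of elements that infinitely many of the sets keep in a bounded range.\<close>
lemma gap_subsequence:
  fixes T :: "nat \<Rightarrow> nat set"
  assumes fin: "\<And>j. finite (T j)" and card: "\<And>j. card (T j) \<le> K"
  shows "\<exists>M0 \<phi>. strict_mono (\<phi> :: nat \<Rightarrow> nat) \<and> (\<forall>M. \<forall>\<^sub>F j in sequentially. T (\<phi> j) \<inter> {M0..<M} = {})"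
proof -
  define P where "P h \<longleftrightarrow> (\<exists>M. infinite {j. card (T j \<inter> {..<M}) \<ge> h})" for h
  have "P 0" by (simp add: P_def)
  moreover have bound: "h \<le> K" if "P h" for h
  proof -
    from that obtain M where "infinite {j. card (T j \<inter> {..<M}) \<ge> h}" by (auto simp: P_def)
    then obtain j where "card (T j \<inter> {..<M}) \<ge> h" using not_finite_existsD by blast
    then show ?thesis using card[of j] card_mono[OF fin[of j], of "T j \<inter> {..<M}"] by simp
  qed
  ultimately have G: "P (Greatest P)" and max: "\<And>h. P h \<Longrightarrow> h \<le> Greatest P"
    by (auto intro: GreatestI_nat Greatest_le_nat)
  define h where "h = Greatest P"
  obtain M0 where M0: "infinite {j. card (T j \<inter> {..<M0}) \<ge> h}"
    using G by (auto simp: P_def h_def)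
  define J where "J = {j. card (T j \<inter> {..<M0}) \<ge> h}"
  define \<phi> where "\<phi> = enumerate J"
  have sm: "strict_mono \<phi>" using M0 by (simp add: \<phi>_def J_def strict_mono_enumerate)
  have inJ: "\<phi> j \<in> J" for j
    unfolding \<phi>_def by (rule enumerate_in_set) (use M0 in \<open>simp add: J_def\<close>)
  show ?thesis
  proof (intro exI[of _ M0] exI[of _ \<phi>] conjI sm allI)
    fix M
    show "\<forall>\<^sub>F j in sequentially. T (\<phi> j) \<inter> {M0..<M} = {}"
    proof (rule ccontr)
      assume "\<not> ?thesis"
      \<comment> \<open>Each such j has a further element below \<open>max M M0\<close> besides the
        h elements below \<open>M0\<close>, which contradicts the maximality of h.\<close>
      then have inf: "infinite {j. T (\<phi> j) \<inter> {M0..<M} \<noteq> {}}"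
        by (simp add: cofinite_eq_sequentially[symmetric] eventually_cofinite)
      have "\<phi> ` {j. T (\<phi> j) \<inter> {M0..<M} \<noteq> {}} \<subseteq> {j. card (T j \<inter> {..<max M M0}) \<ge> Suc h}"
      proof (rule image_subsetI, rule CollectI)
        fix j assume "j \<in> {j. T (\<phi> j) \<inter> {M0..<M} \<noteq> {}}"
        then have ne: "T (\<phi> j) \<inter> {M0..<M} \<noteq> {}" by simp
        have "card (T (\<phi> j) \<inter> {..<M0}) < card (T (\<phi> j) \<inter> {..<max M M0})"
        proof (rule psubset_card_mono)
          from ne obtain m where "m \<in> T (\<phi> j)" "M0 \<le> m" "m < M" by auto
          then have "m \<in> T (\<phi> j) \<inter> {..<max M M0}" "m \<notin> T (\<phi> j) \<inter> {..<M0}" by auto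
          then show "T (\<phi> j) \<inter> {..<M0} \<subset> T (\<phi> j) \<inter> {..<max M M0}" by auto
        qed (use fin in auto)
        moreover have "h \<le> card (T (\<phi> j) \<inter> {..<M0})" using inJ[of j] by (simp add: J_def)
        ultimately show "Suc h \<le> card (T (\<phi> j) \<inter> {..<max M M0})" by simp
      qed
      moreover have "infinite (\<phi> ` {j. T (\<phi> j) \<inter> {M0..<M} \<noteq> {}})"
        using inf finite_imageD[OF _ inj_on_subset[OF strict_mono_imp_inj_on[OF sm] subset_UNIV]] by blast
      ultimately have "P (Suc h)" unfolding P_def using infinite_super by blast
      then show False using max h_def by force
    qed
  qed
qed

text \<open>The decay is assumed on both sides: for k < m the power \<theta>^(m - k), scaled by
  \<gamma>, is close to an integer, and for k > m it is itself small. The exponent carries the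
  factor 2 so that one half of the decay can pay for a gap between two supports while the other half
  keeps sums over k finite. The bound on \<open>1 / \<theta>\<close> gives a fixed real number the
  same rate of decay.\<close>

locale concentrated = gt_one +
  fixes \<gamma> \<rho> A :: real
  assumes \<gamma>_nonzero: "\<gamma> \<noteq> 0" and \<rho>_pos: "\<rho> > 0" and \<rho>_less_1: "\<rho> < 1"
    and inverse_\<theta>_le: "1 / \<theta> \<le> \<rho>\<^sup>2" and A_nonneg: "A \<ge> 0"
    and near_int: "\<exists>b :: int. pi * \<bar>\<gamma> * \<theta> ^ m / \<theta> ^ k - of_int b\<bar> \<le> A * \<rho> ^ (2 * nat_dist m k)"
begin

lemma sin_\<gamma>_le: "\<bar>sin (pi * (\<gamma> * \<theta> ^ m) / \<theta> ^ k)\<bar> \<le> A * \<rho> ^ (2 * nat_dist m k)"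
proof -
  obtain b :: int where "pi * \<bar>\<gamma> * \<theta> ^ m / \<theta> ^ k - of_int b\<bar> \<le> A * \<rho> ^ (2 * nat_dist m k)"
    using near_int by blast
  then show ?thesis using abs_sin_pi_le[of "\<gamma> * \<theta> ^ m / \<theta> ^ k" b] by simp
qed

definition ev :: "int poly \<Rightarrow> real" where
  "ev s = \<gamma> * poly (map_poly of_int s) \<theta>"

text \<open>\<open>x / \<theta> ^ k\<close> is exponentially close to an integer when \<open>k\<close> is far from \<open>T\<close>.\<close>
definition conc :: "real \<Rightarrow> nat set \<Rightarrow> real \<Rightarrow> bool" where
  "conc U T x \<longleftrightarrow> finite T \<and> U \<ge> 0 \<and> (\<forall>k. \<bar>sin (pi * x / \<theta> ^ k)\<bar> \<le> U * (\<Sum>m\<in>T. \<rho> ^ (2 * nat_dist m k)))"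

lemma ev_0 [simp]: "ev 0 = 0"
  by (simp add: ev_def)

lemma ev_add: "ev (s + t) = ev s + ev t"
proof -
  have "map_poly real_of_int (s + t) = map_poly of_int s + map_poly of_int t"
    by (intro poly_eqI) (simp add: coeff_map_poly)
  then show ?thesis by (simp add: ev_def distrib_left)
qed

lemma ev_diff: "ev (s - t) = ev s - ev t"
  using ev_add[of "s - t" t] by simp

lemma ev_altdef: "ev s = (\<Sum>m\<in>supp s. of_int (coeff s m) * (\<gamma> * \<theta> ^ m))"
proof -
  have "poly (map_poly real_of_int s) \<theta> = (\<Sum>m\<le>degree s. of_int (coeff s m) * \<theta> ^ m)"
    by (simp add: poly_altdef degree_map_poly coeff_map_poly)
  also have "\<dots> = (\<Sum>m\<in>supp s. of_int (coeff s m) * \<theta> ^ m)"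
    by (rule sum.mono_neutral_right) (auto simp: supp_def le_degree)
  finally show ?thesis by (simp add: ev_def sum_distrib_left mult_ac)
qed

lemma ev_monom_mult: "ev (monom 1 p * s) = \<theta> ^ p * ev s"
  unfolding ev_altdef supp_monom_mult
  by (subst sum.reindex) (simp_all add: coeff_monom_mult, simp add: sum_distrib_left power_add mult_ac)

text \<open>Sines are subadditive and an integer multiple costs at most its absolute value. The
  constant depends on the bound B only, not on s.\<close>

lemma conc_ev:
  assumes B: "\<And>m. \<bar>coeff s m\<bar> \<le> B"
  shows "conc (of_int B * A) (supp s) (ev s)"
  unfolding conc_def
proof (intro conjI allI)
  have "B \<ge> 0" using B[of 0] by simp
  then show "of_int B * A \<ge> 0" using A_nonneg by simp
  fix k
  have "\<bar>sin (pi * ev s / \<theta> ^ k)\<bar> = \<bar>sin (\<Sum>m\<in>supp s. of_int (coeff s m) * (pi * (\<gamma> * \<theta> ^ m) / \<theta> ^ k))\<bar>"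
    by (simp add: ev_altdef sum_distrib_left sum_divide_distrib mult_ac)
  also have "\<dots> \<le> (\<Sum>m\<in>supp s. \<bar>sin (of_int (coeff s m) * (pi * (\<gamma> * \<theta> ^ m) / \<theta> ^ k))\<bar>)"
    by (rule abs_sin_sum_le)
  also have "\<dots> \<le> (\<Sum>m\<in>supp s. of_int B * (A * \<rho> ^ (2 * nat_dist m k)))"
  proof (rule sum_mono)
    fix m
    have "\<bar>sin (of_int (coeff s m) * (pi * (\<gamma> * \<theta> ^ m) / \<theta> ^ k))\<bar>
       \<le> of_int \<bar>coeff s m\<bar> * \<bar>sin (pi * (\<gamma> * \<theta> ^ m) / \<theta> ^ k)\<bar>"
      by (rule abs_sin_of_int_mult_le)
    also have "\<dots> \<le> of_int B * (A * \<rho> ^ (2 * nat_dist m k))"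
      using B[of m] \<open>B \<ge> 0\<close> by (intro mult_mono sin_\<gamma>_le) (auto simp flip: of_int_abs)
    finally show "\<bar>sin (of_int (coeff s m) * (pi * (\<gamma> * \<theta> ^ m) / \<theta> ^ k))\<bar> \<le> of_int B * (A * \<rho> ^ (2 * nat_dist m k))" .
  qed
  finally show "\<bar>sin (pi * ev s / \<theta> ^ k)\<bar> \<le> of_int B * A * (\<Sum>m\<in>supp s. \<rho> ^ (2 * nat_dist m k))"
    by (simp add: sum_distrib_left mult.assoc)
qed simp

text \<open>A fixed real number behaves like a term with exponent 0, since its quotients by powers
  of \<theta> only shrink.\<close>

lemma conc_real: "conc (pi * \<bar>w\<bar>) {0} w"
  unfolding conc_def
proof (intro conjI allI)
  fix k
  have "\<bar>sin (pi * w / \<theta> ^ k)\<bar> \<le> \<bar>pi * w / \<theta> ^ k\<bar>" by (rule abs_sin_x_le_abs_x)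
  also have "\<dots> = pi * \<bar>w\<bar> * (1 / \<theta>) ^ k" using gt1 by (simp add: abs_mult power_one_over)
  also have "\<dots> \<le> pi * \<bar>w\<bar> * (\<rho>\<^sup>2) ^ k"
    using gt1 inverse_\<theta>_le by (intro mult_left_mono power_mono) auto
  finally show "\<bar>sin (pi * w / \<theta> ^ k)\<bar> \<le> pi * \<bar>w\<bar> * (\<Sum>m\<in>{0}. \<rho> ^ (2 * nat_dist m k))"
    by (simp add: nat_dist_def power_mult)
qed auto

lemma sum_nat_dist_le: "(\<Sum>k<N. \<rho> ^ nat_dist m k) \<le> 2 / (1 - \<rho>)"
proof -
  have geo: "(\<Sum>i\<in>I. \<rho> ^ i) \<le> 1 / (1 - \<rho>)" if "finite I" for I
  proof -
    have "(\<Sum>i\<in>I. \<rho> ^ i) \<le> (\<Sum>i. \<rho> ^ i)"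
      using that \<rho>_pos \<rho>_less_1 by (intro sum_le_suminf summable_geometric) auto
    also have "\<dots> = 1 / (1 - \<rho>)" using \<rho>_pos \<rho>_less_1 by (intro suminf_geometric) auto
    finally show ?thesis .
  qed
  have "(\<Sum>k<N. \<rho> ^ nat_dist m k) \<le> (\<Sum>k\<in>{..m} \<union> {m..m+N}. \<rho> ^ nat_dist m k)"
    using \<rho>_pos by (intro sum_mono2) auto
  also have "\<dots> \<le> (\<Sum>k\<in>{..m}. \<rho> ^ nat_dist m k) + (\<Sum>k\<in>{m..m+N}. \<rho> ^ nat_dist m k)"
    using \<rho>_pos by (subst sum.union_inter[symmetric]) (auto intro!: sum_nonneg)
  also have "(\<Sum>k\<in>{..m}. \<rho> ^ nat_dist m k) = (\<Sum>i\<in>{..m}. \<rho> ^ i)"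
    by (rule sum.reindex_bij_witness[of _ "\<lambda>i. m - i" "\<lambda>i. m - i"]) (auto simp: nat_dist_def)
  also have "(\<Sum>k\<in>{m..m+N}. \<rho> ^ nat_dist m k) = (\<Sum>i\<in>{..N}. \<rho> ^ i)"
    by (rule sum.reindex_bij_witness[of _ "\<lambda>i. m + i" "\<lambda>i. i - m"]) (auto simp: nat_dist_def)
  finally show ?thesis using geo[of "{..m}"] geo[of "{..N}"] by simp
qed

text \<open>The factor \<open>2 / (1 - \<rho>)\<close> bounds the two geometric series on either
  side of an exponent, and \<open>\<rho> ^ g\<close> is the decay across a gap of length g.\<close>

definition sep_bound :: "real \<Rightarrow> nat \<Rightarrow> real" where
  "sep_bound c g = c * (2 / (1 - \<rho>)) * \<rho> ^ g"

lemma sep_bound_tendsto_0: "sep_bound c \<longlonglongrightarrow> 0"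
  unfolding sep_bound_def using \<rho>_pos \<rho>_less_1
  by (intro tendsto_mult_right_zero LIMSEQ_power_zero) auto

lemma sum_sin_sin_le:
  assumes x: "conc U T x" and y: "conc W S y"
    and gap: "\<And>m n. m \<in> T \<Longrightarrow> n \<in> S \<Longrightarrow> g \<le> nat_dist m n"
  shows "(\<Sum>k<N. \<bar>sin (pi * x / \<theta> ^ k)\<bar> * \<bar>sin (pi * y / \<theta> ^ k)\<bar>) \<le> sep_bound (U * W * card T * card S) g"
proof -
  have U: "U \<ge> 0" "W \<ge> 0" using x y by (auto simp: conc_def)
  have mult_mult_mult: "(U * a) * (W * b) = U * W * (a * b)" for a b by simp
  \<comment> \<open>By the triangle inequality the two distances to k add up to at least g. One copy
    of each pays for the gap, and the second copy of \<open>nat_dist m k\<close> is left for the sum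
    over k.\<close>
  have pw: "\<rho> ^ (2 * nat_dist m k) * \<rho> ^ (2 * nat_dist n k) \<le> \<rho> ^ g * \<rho> ^ nat_dist m k"
    if "m \<in> T" "n \<in> S" for m n k
  proof -
    have "g + nat_dist m k \<le> 2 * nat_dist m k + 2 * nat_dist n k"
      using gap[OF that] by (simp add: nat_dist_def)
    then show ?thesis
      unfolding power_add[symmetric] using \<rho>_pos \<rho>_less_1 by (intro power_decreasing) auto
  qed
  have "(\<Sum>k<N. \<bar>sin (pi * x / \<theta> ^ k)\<bar> * \<bar>sin (pi * y / \<theta> ^ k)\<bar>)
    \<le> (\<Sum>k<N. (U * (\<Sum>m\<in>T. \<rho> ^ (2 * nat_dist m k))) * (W * (\<Sum>n\<in>S. \<rho> ^ (2 * nat_dist n k))))"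
    using x y U \<rho>_pos unfolding conc_def by (intro sum_mono mult_mono) (auto intro!: mult_nonneg_nonneg sum_nonneg)
  also have "\<dots> = U * W * (\<Sum>k<N. \<Sum>m\<in>T. \<Sum>n\<in>S. \<rho> ^ (2 * nat_dist m k) * \<rho> ^ (2 * nat_dist n k))"
    unfolding mult_mult_mult sum_distrib_left[symmetric] sum_product ..
  also have "\<dots> \<le> U * W * (\<Sum>k<N. \<Sum>m\<in>T. \<Sum>n\<in>S. \<rho> ^ g * \<rho> ^ nat_dist m k)"
    using U by (intro mult_left_mono sum_mono pw) auto
  also have "\<dots> = U * W * (\<rho> ^ g * card S * (\<Sum>m\<in>T. \<Sum>k<N. \<rho> ^ nat_dist m k))"
    by (subst sum.swap) (simp add: sum_distrib_left mult_ac)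
  also have "\<dots> \<le> U * W * (\<rho> ^ g * card S * (\<Sum>m\<in>T. 2 / (1 - \<rho>)))"
    using U \<rho>_pos by (intro mult_left_mono sum_mono sum_nat_dist_le) auto
  finally show ?thesis by (simp add: sep_bound_def mult_ac)
qed

lemma f_add_le:
  assumes "conc U T x" and "conc W S y" and "\<And>m n. m \<in> T \<Longrightarrow> n \<in> S \<Longrightarrow> g \<le> nat_dist m n"
  shows "\<bar>f (x + y) - f x * f y\<bar> \<le> sep_bound (U * W * card T * card S) g"
  by (rule f_mult_le) (rule sum_sin_sin_le[OF assms])

text \<open>The error bound has to be uniform, so the cardinalities of the supports may not grow.\<close>
lemma f_add_tendsto_0:
  assumes x: "\<And>j. conc U (T j) (x j)" and y: "\<And>j. conc W (S j) (y j)"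
    and T: "\<And>j. card (T j) \<le> K" and S: "\<And>j. card (S j) \<le> L"
    and gap: "\<And>g. \<forall>\<^sub>F j in sequentially. \<forall>m\<in>T j. \<forall>n\<in>S j. g \<le> nat_dist m n"
  shows "(\<lambda>j. f (x j + y j) - f (x j) * f (y j)) \<longlonglongrightarrow> 0"
proof (rule LIMSEQ_I)
  fix e :: real assume "e > 0"
  define c where "c = U * W * K * L"
  from order_tendstoD(2)[OF sep_bound_tendsto_0[of c] \<open>e > 0\<close>]
  obtain g where g: "sep_bound c g < e" by (auto simp: eventually_sequentially)
  have U: "U \<ge> 0" "W \<ge> 0" using x[of 0] y[of 0] by (auto simp: conc_def)
  have "\<forall>\<^sub>F j in sequentially. norm (f (x j + y j) - f (x j) * f (y j) - 0) < e"
    using gap[of g]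
  proof eventually_elim
    case (elim j)
    have "\<bar>f (x j + y j) - f (x j) * f (y j)\<bar> \<le> sep_bound (U * W * card (T j) * card (S j)) g"
      using elim by (intro f_add_le[OF x y]) auto
    also have "\<dots> \<le> sep_bound c g"
      unfolding sep_bound_def c_def using U T[of j] S[of j] \<rho>_pos \<rho>_less_1
      by (intro mult_right_mono mult_mono) auto
    finally show ?case using g by simp
  qed
  then show "\<exists>no. \<forall>n\<ge>no. norm (f (x n + y n) - f (x n) * f (y n) - 0) < e"
    by (simp add: eventually_sequentially)
qed

end

section \<open>Limits along sparse polynomials\<close>

lemma constant_subsequence:
  fixes a :: "nat \<Rightarrow> 'a"
  assumes "finite F" and "\<And>j. a j \<in> F"
  shows "\<exists>c \<psi>. strict_mono (\<psi> :: nat \<Rightarrow> nat) \<and> (\<forall>j. a (\<psi> j) = c)"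
proof -
  have "\<exists>c\<in>F. infinite {j. a j = c}"
  proof (rule ccontr)
    assume "\<not> ?thesis"
    then have "finite (\<Union>c\<in>F. {j. a j = c})" using assms(1) by auto
    moreover have "(\<Union>c\<in>F. {j. a j = c}) = UNIV" using assms(2) by auto
    ultimately show False by simp
  qed
  then obtain c where c: "infinite {j. a j = c}" by blast
  show ?thesis
    by (intro exI[of _ c] exI[of _ "enumerate {j. a j = c}"])
      (use c enumerate_in_set[OF c] in \<open>auto intro: strict_mono_enumerate\<close>)
qed

context concentrated
begin

lemma gap_imp_f_mult_tendsto_0:
  assumes a: "\<And>j. a j \<in> sparse_polys K B" and b: "\<And>j. b j \<in> sparse_polys L B'"
    and gap: "\<And>g. \<forall>\<^sub>F j in sequentially. \<forall>m\<in>supp (a j). \<forall>n\<in>supp (b j). g \<le> nat_dist m n"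
  shows "(\<lambda>j. f (ev (a j) + ev (b j)) - f (ev (a j)) * f (ev (b j))) \<longlonglongrightarrow> 0"
proof (rule f_add_tendsto_0[of "of_int B * A" "\<lambda>j. supp (a j)" _ "of_int B' * A" "\<lambda>j. supp (b j)"])
  show "conc (of_int B * A) (supp (a j)) (ev (a j))" for j
    using a[of j] by (intro conc_ev) (auto simp: sparse_polys_def)
  show "conc (of_int B' * A) (supp (b j)) (ev (b j))" for j
    using b[of j] by (intro conc_ev) (auto simp: sparse_polys_def)
  show "card (supp (a j)) \<le> K" "card (supp (b j)) \<le> L" for j
    using a[of j] b[of j] by (auto simp: sparse_polys_def)
qed (rule gap)

text \<open>The number w sits at exponent 0, and the supports of the polynomials move away from
  it.\<close>

lemma f_add_ev_tendsto_0:
  assumes s: "\<And>j. s j \<in> sparse_polys K B" and far: "\<And>M. \<forall>\<^sub>F j in sequentially. supp (s j) \<subseteq> {M..}"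
  shows "(\<lambda>j. f (ev (s j) + w) - f (ev (s j)) * f w) \<longlonglongrightarrow> 0"
proof (rule f_add_tendsto_0[of "of_int B * A" "\<lambda>j. supp (s j)" _ "pi * \<bar>w\<bar>" "\<lambda>_. {0}" _ K 1])
  show "conc (of_int B * A) (supp (s j)) (ev (s j))" for j
    using s[of j] by (intro conc_ev) (auto simp: sparse_polys_def)
  show "card (supp (s j)) \<le> K" for j using s[of j] by (simp add: sparse_polys_def)
  show "\<forall>\<^sub>F j in sequentially. \<forall>m\<in>supp (s j). \<forall>n\<in>{0}. g \<le> nat_dist m n" for g
    using far[of g] by eventually_elim (auto simp: nat_dist_def)
qed (auto intro: conc_real)

text \<open>After division by the lowest power of the variable and passage to a subsequence, the
  part below the gap is one fixed polynomial a. The shifts of a give values from a monotone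
  sequence, which together with its limit is a countable compact set \<open>R a\<close>. The part
  above the gap has lost the lowest term, so the induction hypothesis applies to it, and the limit
  is a product of an element of \<open>R a\<close> and one from the previous stage. A single Q must
  serve all sequences at once, since there are uncountably many of them.\<close>

lemma countable_limits_abs_f_ev:
  "\<exists>Q. countable Q \<and> (\<forall>s y. (\<forall>j. s j \<in> sparse_polys K B) \<longrightarrow> (\<lambda>j. \<bar>f (ev (s j))\<bar>) \<longlonglongrightarrow> y \<longrightarrow> y \<in> Q)"
proof (induction K)
  case 0
  have "s j = 0" if "\<forall>j. s j \<in> sparse_polys 0 B" for s j
  proof -
    have "supp (s j) = {}" using that finite_supp[of "s j"] by (auto simp: sparse_polys_def)
    then show ?thesis by (auto simp: supp_def poly_eq_iff)
  qed
  then have "y = 1" if "\<forall>j. s j \<in> sparse_polys 0 B" "(\<lambda>j. \<bar>f (ev (s j))\<bar>) \<longlonglongrightarrow> y" for s y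
  proof -
    have "s j = 0" for j using that(1) by (rule \<open>\<And>s j. \<forall>j. s j \<in> sparse_polys 0 B \<Longrightarrow> s j = 0\<close>)
    then show ?thesis using that(2) by (simp add: LIMSEQ_const_iff)
  qed
  then show ?case by (intro exI[of _ "{1}"]) auto
next
  case (Suc K)
  then obtain Q where Q: "countable Q"
    and lim: "\<And>s y. (\<And>j. s j \<in> sparse_polys K B) \<Longrightarrow> (\<lambda>j. \<bar>f (ev (s j))\<bar>) \<longlonglongrightarrow> y \<Longrightarrow> y \<in> Q"
    by metis
  define R where "R a = insert (lim (\<lambda>p. \<bar>f (\<theta> ^ p * ev a)\<bar>)) (range (\<lambda>p. \<bar>f (\<theta> ^ p * ev a)\<bar>))" for a
  have compact_R: "compact (R a)" for a
  proof -
    have "convergent (\<lambda>p. \<bar>f (\<theta> ^ p * ev a)\<bar>)"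
      using decseq_abs_f_power[of "ev a"] by (intro Bseq_monoseq_convergent decseq_imp_monoseq)
        (auto intro!: BseqI'[of _ 1] simp: abs_f_le_one)
    then have "(\<lambda>p. \<bar>f (\<theta> ^ p * ev a)\<bar>) \<longlonglongrightarrow> lim (\<lambda>p. \<bar>f (\<theta> ^ p * ev a)\<bar>)"
      by (simp add: convergent_LIMSEQ_iff)
    then show ?thesis unfolding R_def by (rule compact_sequence_with_limit)
  qed
  \<comment> \<open>The element 1 accounts for sequences that contain the zero polynomial infinitely
    often; these have no lowest exponent to divide by.\<close>
  define Q' where "Q' = insert 1 ((\<lambda>(u, v). u * v) ` ((\<Union>a. R a) \<times> Q))"
  have "countable Q'"
    unfolding Q'_def R_def
    by (intro countable_insert countable_image countable_SIGMA countable_UN countable_int_polys Q) auto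
  moreover have "y \<in> Q'" if s: "\<forall>j. s j \<in> sparse_polys (Suc K) B" and y: "(\<lambda>j. \<bar>f (ev (s j))\<bar>) \<longlonglongrightarrow> y" for s y
  proof (cases "y = 1")
    case False
    have "\<forall>\<^sub>F j in sequentially. s j \<noteq> 0"
      using tendsto_imp_eventually_ne[OF y False] by eventually_elim auto
    then obtain N where N: "\<And>j. j \<ge> N \<Longrightarrow> s j \<noteq> 0" by (auto simp: eventually_sequentially)
    define s1 where "s1 j = s (j + N)" for j
    have s1: "s1 j \<in> sparse_polys (Suc K) B" "s1 j \<noteq> 0" for j
      using s N by (auto simp: s1_def)
    have y1: "(\<lambda>j. \<bar>f (ev (s1 j))\<bar>) \<longlonglongrightarrow> y"
      unfolding s1_def by (rule LIMSEQ_ignore_initial_segment[OF y])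
    define p where "p j = Min (supp (s1 j))" for j
    define h where "h j = poly_shift (p j) (s1 j)" for j
    have ne: "supp (s1 j) \<noteq> {}" for j
      using s1(2)[of j] by (auto simp: supp_def poly_eq_iff)
    have p_in: "p j \<in> supp (s1 j)" and p_le: "m \<in> supp (s1 j) \<Longrightarrow> p j \<le> m" for j m
      unfolding p_def using ne by (auto intro: Min_in)
    have s1_eq: "s1 j = monom 1 (p j) * h j" for j
    proof (rule poly_eqI)
      fix m show "coeff (s1 j) m = coeff (monom 1 (p j) * h j) m"
        using p_le[of m j] by (cases "p j \<le> m") (auto simp: coeff_monom_mult h_def coeff_poly_shift supp_def)
    qed
    have h: "h j \<in> sparse_polys (Suc K) B" for j
    proof -
      have "card (supp (h j)) = card (supp (s1 j))"
        unfolding s1_eq[of j] supp_monom_mult by (simp add: card_image)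
      then show ?thesis
        using s1(1)[of j] by (auto simp: sparse_polys_def h_def coeff_poly_shift)
    qed
    have h0: "0 \<in> supp (h j)" for j
      using p_in[of j] by (simp add: h_def supp_def coeff_poly_shift)
    obtain M0 \<phi> where \<phi>: "strict_mono \<phi>" and gap: "\<And>M. \<forall>\<^sub>F j in sequentially. supp (h (\<phi> j)) \<inter> {M0..<M} = {}"
      using gap_subsequence[of "\<lambda>j. supp (h j)" "Suc K"] h unfolding sparse_polys_def by auto
    \<comment> \<open>The successor puts exponent 0, which every \<open>h j\<close> contains, below
      the cut even when \<open>M0 = 0\<close>. The upper part thus always has fewer terms.\<close>
    define M1 where "M1 = Suc M0"
    have "finite {s :: int poly. (\<forall>m. \<bar>coeff s m\<bar> \<le> B) \<and> supp s \<subseteq> {..<M1}}" by (rule finite_bounded_polys)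
    moreover have "poly_cutoff M1 (h (\<phi> j)) \<in> {s. (\<forall>m. \<bar>coeff s m\<bar> \<le> B) \<and> supp s \<subseteq> {..<M1}}" for j
      using poly_cutoff_mem_sparse_polys[OF h, of M1 "\<phi> j"] by (auto simp: sparse_polys_def supp_cutoff)
    ultimately have "\<exists>a \<psi>. strict_mono (\<psi> :: nat \<Rightarrow> nat) \<and> (\<forall>j. poly_cutoff M1 (h (\<phi> (\<psi> j))) = a)"
      by (rule constant_subsequence)
    then obtain a and \<psi> :: "nat \<Rightarrow> nat" where \<psi>: "strict_mono \<psi>" and a: "\<And>j. poly_cutoff M1 (h (\<phi> (\<psi> j))) = a"
      by blast
    define \<sigma> where "\<sigma> j = \<phi> (\<psi> j)" for j
    define b where "b j = h (\<sigma> j) - a" for j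
    have b_eq: "b j = h (\<sigma> j) - poly_cutoff M1 (h (\<sigma> j))" for j
      by (simp add: b_def \<sigma>_def a)
    have supp_b: "supp (b j) = supp (h (\<sigma> j)) \<inter> {M1..}" for j
      unfolding b_eq by (rule supp_diff_cutoff)
    have b: "b j \<in> sparse_polys K B" for j
    proof -
      have "supp (b j) \<subset> supp (h (\<sigma> j))" using h0[of "\<sigma> j"] by (auto simp: supp_b M1_def)
      then have "card (supp (b j)) < card (supp (h (\<sigma> j)))" by (intro psubset_card_mono) auto
      then show ?thesis
        using diff_poly_cutoff_mem_sparse_polys[OF h, of "\<sigma> j" M1] h[of "\<sigma> j"]
        unfolding b_eq[symmetric] by (auto simp: sparse_polys_def)
    qed
    have a_sparse: "a \<in> sparse_polys (Suc K) B"
      using poly_cutoff_mem_sparse_polys[OF h, of M1] a by metis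
    have supp_a: "supp a \<subseteq> {..<M1}" using a[of 0] supp_cutoff[of M1] by auto
    define x z where "x j = monom 1 (p (\<sigma> j)) * a" and "z j = monom 1 (p (\<sigma> j)) * b j" for j
    have "s1 (\<sigma> j) = x j + z j" for j
      unfolding s1_eq x_def z_def b_def by (simp add: algebra_simps)
    then have ev_s1: "ev (s1 (\<sigma> j)) = ev (x j) + ev (z j)" for j by (simp add: ev_add)
    have "(\<lambda>j. f (ev (x j) + ev (z j)) - f (ev (x j)) * f (ev (z j))) \<longlonglongrightarrow> 0"
    proof (rule gap_imp_f_mult_tendsto_0)
      show "x j \<in> sparse_polys (Suc K) B" "z j \<in> sparse_polys K B" for j
        unfolding x_def z_def using a_sparse b by (auto intro: sparse_polys_monom_mult)
      fix g
      have "\<forall>\<^sub>F j in sequentially. supp (h (\<sigma> j)) \<inter> {M0..<M1 + g} = {}"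
        unfolding \<sigma>_def by (rule eventually_subseq[OF \<psi> gap])
      then show "\<forall>\<^sub>F j in sequentially. \<forall>m\<in>supp (x j). \<forall>n\<in>supp (z j). g \<le> nat_dist m n"
      proof eventually_elim
        case (elim j)
        show ?case
        proof (intro ballI)
          fix m n assume "m \<in> supp (x j)" "n \<in> supp (z j)"
          then obtain m' n' where m': "m = p (\<sigma> j) + m'" "m' \<in> supp a" and n': "n = p (\<sigma> j) + n'" "n' \<in> supp (b j)"
            by (auto simp: x_def z_def supp_monom_mult)
          have "m' < M1" using supp_a m' by auto
          moreover have "n' \<ge> M1 + g" using elim n' by (force simp: supp_b M1_def)
          ultimately show "g \<le> nat_dist m n" using m' n' by (simp add: nat_dist_def)
        qed
      qed
    qed
    then have "(\<lambda>j. \<bar>f (ev (x j) + ev (z j))\<bar> - \<bar>f (ev (x j)) * f (ev (z j))\<bar>) \<longlonglongrightarrow> 0"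
      by (rule Lim_null_comparison[OF _ tendsto_rabs_zero, rotated]) (simp add: abs_triangle_ineq3)
    moreover have \<sigma>: "strict_mono \<sigma>" unfolding \<sigma>_def using \<phi> \<psi> by (auto simp: strict_mono_def)
    then have "(\<lambda>j. \<bar>f (ev (x j) + ev (z j))\<bar>) \<longlonglongrightarrow> y"
      using LIMSEQ_subseq_LIMSEQ[OF y1 \<sigma>] by (simp add: o_def ev_s1)
    ultimately have prod: "(\<lambda>j. \<bar>f (ev (x j))\<bar> * \<bar>f (ev (z j))\<bar>) \<longlonglongrightarrow> y"
      using tendsto_diff by (fastforce simp: abs_mult)
    \<comment> \<open>So far only the product is known to converge; compactness yields a subsequence
      along which both factors do.\<close>
    define uv where "uv j = (\<bar>f (ev (x j))\<bar>, \<bar>f (ev (z j))\<bar>)" for j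
    have "compact (R a \<times> {0..1::real})" by (intro compact_Times compact_R compact_Icc)
    moreover have "uv j \<in> R a \<times> {0..1}" for j
      by (auto simp: uv_def R_def x_def ev_monom_mult abs_f_le_one)
    ultimately obtain l \<tau> where l: "l \<in> R a \<times> {0..1}" and \<tau>: "strict_mono \<tau>" and lim_uv: "(uv \<circ> \<tau>) \<longlonglongrightarrow> l"
      unfolding compact_def by metis
    have "(\<lambda>j. \<bar>f (ev (z (\<tau> j)))\<bar>) \<longlonglongrightarrow> snd l"
      using tendsto_snd[OF lim_uv] by (simp add: o_def uv_def)
    moreover have "z (\<tau> j) \<in> sparse_polys K B" for j
      unfolding z_def using b by (auto intro: sparse_polys_monom_mult)
    ultimately have "snd l \<in> Q" by (intro lim[of "\<lambda>j. z (\<tau> j)"])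
    moreover have "y = fst l * snd l"
    proof (rule LIMSEQ_unique)
      show "(\<lambda>j. \<bar>f (ev (x (\<tau> j)))\<bar> * \<bar>f (ev (z (\<tau> j)))\<bar>) \<longlonglongrightarrow> y"
        using LIMSEQ_subseq_LIMSEQ[OF prod \<tau>] by (simp add: o_def)
      show "(\<lambda>j. \<bar>f (ev (x (\<tau> j)))\<bar> * \<bar>f (ev (z (\<tau> j)))\<bar>) \<longlonglongrightarrow> fst l * snd l"
        using tendsto_mult[OF tendsto_fst[OF lim_uv] tendsto_snd[OF lim_uv]] by (simp add: o_def uv_def)
    qed
    ultimately show ?thesis
      using l unfolding Q'_def by (cases l) force
  qed (simp add: Q'_def)
  ultimately show ?case by blast
qed

end

text \<open>
  The coefficients of \<open>s\<close> are the defects in the linear recurrence of \<open>\<theta>\<close> for the integers nearest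
  to the numbers \<open>x / \<theta> ^ k\<close>.
\<close>
locale pisot_system = concentrated +
  assumes rep: "\<exists>\<delta> B C d. 0 < \<delta> \<and> \<delta> \<le> 1/2 \<and> (\<forall>x. \<exists>s. (\<forall>m. \<bar>coeff s m\<bar> \<le> B) \<and> \<bar>x - ev s\<bar> \<le> C \<and>
    (\<forall>m\<in>supp s. \<exists>j\<le>d. \<delta> \<le> \<bar>x / \<theta> ^ (m + j) - of_int (round (x / \<theta> ^ (m + j)))\<bar>))"
begin

text \<open>Each k for which \<open>x / \<theta> ^ k\<close> is at least \<delta> away from the
  integers contributes to f(x) a factor of modulus at most cos(pi \<delta>) < 1, so the lower bound
  c allows fewer than N such k. Every exponent of s lies at most d below one of them.\<close>

lemma card_supp_bounded:
  fixes \<delta> c :: real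
  assumes \<delta>: "0 < \<delta>" "\<delta> \<le> 1/2" and c: "c > 0"
  shows "\<exists>K. \<forall>x s. c \<le> \<bar>f x\<bar> \<longrightarrow>
    (\<forall>m\<in>supp s. \<exists>j\<le>d. \<delta> \<le> \<bar>x / \<theta> ^ (m + j) - of_int (round (x / \<theta> ^ (m + j)))\<bar>) \<longrightarrow>
    card (supp s) \<le> K"
proof -
  define \<kappa> where "\<kappa> = cos (pi * \<delta>)"
  have "pi * \<delta> \<le> pi * (1/2)" using \<delta> by (intro mult_left_mono) auto
  moreover have pi_\<delta>_pos: "pi * \<delta> > 0" using \<delta> by simp
  ultimately have pi_\<delta>: "- (pi / 2) \<le> pi * \<delta>" "pi * \<delta> \<le> pi / 2" using pi_gt_zero by linarith+
  then have \<kappa>: "0 \<le> \<kappa>" "\<kappa> < 1"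
    unfolding \<kappa>_def using \<delta> pi_\<delta> cos_monotone_0_pi[of 0 "pi * \<delta>"] pi_gt_zero by (auto intro!: cos_ge_zero)
  have cos_le: "\<bar>cos (pi * y)\<bar> \<le> \<kappa>" if "\<delta> \<le> \<bar>y - of_int (round y)\<bar>" for y
  proof -
    define e where "e = \<bar>y - of_int (round y)\<bar>"
    have cos_abs: "cos (pi * u) = cos (pi * \<bar>u\<bar>)" for u :: real by (cases "u \<ge> 0") simp_all
    have "e \<le> 1/2" unfolding e_def using of_int_round_abs_le[of y] by (simp add: abs_minus_commute)
    have c1: "\<bar>cos (pi * of_int n)\<bar> = 1" for n :: int
      using sin_cos_squared_add[of "pi * of_int n"] sin_pi_of_int[of n] by (simp add: power2_eq_1_iff abs_if split: if_splits)
    have "\<bar>cos (pi * (y - of_int (round y)))\<bar> = \<bar>cos (pi * y)\<bar>"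
      by (simp add: right_diff_distrib cos_diff sin_pi_of_int abs_mult c1)
    moreover have "cos (pi * (y - of_int (round y))) = cos (pi * e)"
      unfolding e_def by (rule cos_abs)
    moreover have "pi * e \<le> pi * (1/2)" "pi * \<delta> \<le> pi * e" 
      using \<open>e \<le> 1/2\<close> that by (auto intro!: mult_left_mono simp: e_def)
    then have "- (pi / 2) \<le> pi * e" "pi * e \<le> pi / 2" "pi * \<delta> \<le> pi * e" "0 \<le> pi * \<delta>" "pi * e \<le> pi"
      using pi_\<delta> pi_\<delta>_pos pi_gt_zero by linarith+
    then have "cos (pi * e) \<ge> 0" "cos (pi * e) \<le> \<kappa>"
      unfolding \<kappa>_def by - (rule cos_ge_zero, assumption+, rule cos_monotone_0_pi_le, assumption+)
    ultimately show ?thesis by simp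
  qed
  obtain N where N: "\<kappa> ^ N < c" using real_arch_pow_inv[OF c \<kappa>(2)] by blast
  show ?thesis
  proof (intro exI[of _ "Suc d * N"] allI impI)
    fix x :: real and s :: "int poly"
    assume cx: "c \<le> \<bar>f x\<bar>"
      and s: "\<forall>m\<in>supp s. \<exists>j\<le>d. \<delta> \<le> \<bar>x / \<theta> ^ (m + j) - of_int (round (x / \<theta> ^ (m + j)))\<bar>"
    define I where "I = {k. \<delta> \<le> \<bar>x / \<theta> ^ k - of_int (round (x / \<theta> ^ k))\<bar>}"
    have card_I: "card J < N" if "J \<subseteq> I" "finite J" for J
    proof (rule ccontr)
      assume "\<not> card J < N"
      have "\<bar>f x\<bar> \<le> (\<Prod>k\<in>J. \<bar>cos (pi * x / \<theta> ^ k)\<bar>)" by (rule abs_f_le_abs_prod_cos) (rule that)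
      also have "\<dots> \<le> (\<Prod>k\<in>J. \<kappa>)"
        using that cos_le by (intro prod_mono) (auto simp: I_def simp flip: times_divide_eq_right)
      also have "\<dots> = \<kappa> ^ card J" by simp
      also have "\<dots> \<le> \<kappa> ^ N" using \<kappa> \<open>\<not> card J < N\<close> by (intro power_decreasing) auto
      finally show False using N cx by simp
    qed
    have "finite I"
    proof (rule ccontr)
      assume "infinite I"
      then obtain J where "J \<subseteq> I" "finite J" "card J = N" by (meson infinite_arbitrarily_large)
      then show False using card_I by blast
    qed
    have "supp s \<subseteq> (\<lambda>(j, k). k - j) ` ({..d} \<times> I)"
    proof
      fix m assume "m \<in> supp s"
      then obtain j where "j \<le> d" "m + j \<in> I" using s by (auto simp: I_def)
      then show "m \<in> (\<lambda>(j, k). k - j) ` ({..d} \<times> I)" by (auto intro!: rev_image_eqI[of "(j, m + j)"])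
    qed
    then have "card (supp s) \<le> card ({..d} \<times> I)"
      using \<open>finite I\<close> by (intro surj_card_le) auto
    also have "\<dots> \<le> Suc d * N"
      using mult_le_mono2[OF less_imp_le[OF card_I[OF subset_refl \<open>finite I\<close>]], of "Suc d"]
      by (simp add: card_cartesian_product)
    finally show "card (supp s) \<le> Suc d * N" .
  qed
qed

text \<open>The terms below the gap have bounded exponents and coefficients, so their value is
  bounded. It is merged with the bounded error of the representation, and the number w is a limit of
  the merged remainders.\<close>

lemma decomposition:
  fixes x :: "nat \<Rightarrow> real"
  assumes c: "c > 0" and x: "\<And>j. c \<le> \<bar>f (x j)\<bar>"
  shows "\<exists>K B s \<phi> w. strict_mono (\<phi> :: nat \<Rightarrow> nat) \<and> (\<forall>j. s j \<in> sparse_polys K B) \<and>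
    (\<forall>M. \<forall>\<^sub>F j in sequentially. supp (s j) \<subseteq> {M..}) \<and>
    (\<lambda>j. x (\<phi> j) - ev (s j)) \<longlonglongrightarrow> w \<and>
    (\<lambda>j. f (x (\<phi> j)) - f (ev (s j)) * f w) \<longlonglongrightarrow> 0"
proof -
  obtain \<delta> B C d where \<delta>: "0 < \<delta>" "\<delta> \<le> 1/2"
    and ex: "\<And>x. \<exists>s. (\<forall>m. \<bar>coeff s m\<bar> \<le> B) \<and> \<bar>x - ev s\<bar> \<le> C \<and>
    (\<forall>m\<in>supp s. \<exists>j\<le>d. \<delta> \<le> \<bar>x / \<theta> ^ (m + j) - of_int (round (x / \<theta> ^ (m + j)))\<bar>)"
    using rep by blast
  obtain K where K: "\<And>x s. c \<le> \<bar>f x\<bar> \<Longrightarrow>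
    \<forall>m\<in>supp s. \<exists>j\<le>d. \<delta> \<le> \<bar>x / \<theta> ^ (m + j) - of_int (round (x / \<theta> ^ (m + j)))\<bar> \<Longrightarrow>
    card (supp s) \<le> K" using card_supp_bounded[OF \<delta> c, of d] by blast
  from ex have "\<exists>t. \<forall>j. (\<forall>m. \<bar>coeff (t j) m\<bar> \<le> B) \<and> \<bar>x j - ev (t j)\<bar> \<le> C \<and>
    (\<forall>m\<in>supp (t j). \<exists>i\<le>d. \<delta> \<le> \<bar>x j / \<theta> ^ (m + i) - of_int (round (x j / \<theta> ^ (m + i)))\<bar>)"
    by (intro choice) blast
  then obtain t where tB: "\<And>j m. \<bar>coeff (t j) m\<bar> \<le> B" and tC: "\<And>j. \<bar>x j - ev (t j)\<bar> \<le> C"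
    and td: "\<And>j. \<forall>m\<in>supp (t j). \<exists>i\<le>d. \<delta> \<le> \<bar>x j / \<theta> ^ (m + i) - of_int (round (x j / \<theta> ^ (m + i)))\<bar>"
    by blast
  have t: "t j \<in> sparse_polys K B" for j
    using tB K[OF x td] by (simp add: sparse_polys_def)
  obtain M0 \<phi> where \<phi>: "strict_mono \<phi>" and gap: "\<And>M. \<forall>\<^sub>F j in sequentially. supp (t (\<phi> j)) \<inter> {M0..<M} = {}"
    using gap_subsequence[of "\<lambda>j. supp (t j)" K] t unfolding sparse_polys_def by auto
  define s where "s j = t (\<phi> j) - poly_cutoff M0 (t (\<phi> j))" for j
  define w0 where "w0 j = x (\<phi> j) - ev (s j)" for j
  define W where "W = C + (\<Sum>m<M0. of_int B * (\<bar>\<gamma>\<bar> * \<theta> ^ m))"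
  have "\<bar>w0 j\<bar> \<le> W" for j
  proof -
    have "\<bar>ev (poly_cutoff M0 (t (\<phi> j)))\<bar> \<le> (\<Sum>m\<in>supp (poly_cutoff M0 (t (\<phi> j))). of_int B * (\<bar>\<gamma>\<bar> * \<theta> ^ m))"
      unfolding ev_altdef
    proof (rule order_trans[OF sum_abs sum_mono])
      fix m assume "m \<in> supp (poly_cutoff M0 (t (\<phi> j)))"
      then have "coeff (poly_cutoff M0 (t (\<phi> j))) m = coeff (t (\<phi> j)) m"
        by (simp add: supp_def coeff_poly_cutoff split: if_splits)
      then show "\<bar>of_int (coeff (poly_cutoff M0 (t (\<phi> j))) m) * (\<gamma> * \<theta> ^ m)\<bar> \<le> of_int B * (\<bar>\<gamma>\<bar> * \<theta> ^ m)"
        using tB[of "\<phi> j" m] gt1 by (auto simp: abs_mult simp flip: of_int_abs intro!: mult_right_mono)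
    qed
    also have "\<dots> \<le> (\<Sum>m<M0. of_int B * (\<bar>\<gamma>\<bar> * \<theta> ^ m))"
      using tB[of 0 0] gt1 by (intro sum_mono2) (auto simp: supp_cutoff)
    moreover have "w0 j = (x (\<phi> j) - ev (t (\<phi> j))) + ev (poly_cutoff M0 (t (\<phi> j)))"
      by (simp add: w0_def s_def ev_diff)
    ultimately show ?thesis using tC[of "\<phi> j"] unfolding W_def by linarith
  qed
  then have "bounded (range w0)" by (auto simp: bounded_iff)
  then obtain w \<psi> where \<psi>: "strict_mono \<psi>" and w: "(w0 \<circ> \<psi>) \<longlonglongrightarrow> w"
    using bounded_imp_convergent_subsequence by blast
  have s: "s j \<in> sparse_polys K B" for j
    unfolding s_def by (rule diff_poly_cutoff_mem_sparse_polys[OF t])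
  have far: "\<forall>\<^sub>F j in sequentially. supp (s (\<psi> j)) \<subseteq> {M..}" for M
    using eventually_subseq[OF \<psi> gap[of M]]
  proof eventually_elim
    case (elim j)
    then show ?case by (fastforce simp: s_def supp_diff_cutoff)
  qed
  have w': "(\<lambda>j. x (\<phi> (\<psi> j)) - ev (s (\<psi> j))) \<longlonglongrightarrow> w"
    using w by (simp add: w0_def o_def)
  have "(\<lambda>j. f (ev (s (\<psi> j)) + w) - f (ev (s (\<psi> j))) * f w) \<longlonglongrightarrow> 0"
    by (rule f_add_ev_tendsto_0[OF s far])
  moreover have "(\<lambda>j. f (x (\<phi> (\<psi> j))) - f (ev (s (\<psi> j)) + w)) \<longlonglongrightarrow> 0"
    using LIM_zero[OF w'] by (intro f_diff_tendsto_0) (simp add: algebra_simps)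
  ultimately have "(\<lambda>j. f (x (\<phi> (\<psi> j))) - f (ev (s (\<psi> j))) * f w) \<longlonglongrightarrow> 0"
    using tendsto_add by fastforce
  moreover have "strict_mono (\<lambda>j. \<phi> (\<psi> j))" using \<phi> \<psi> by (auto simp: strict_mono_def)
  ultimately show ?thesis
    using s far w' by (intro exI[of _ K] exI[of _ B] exI[of _ "\<lambda>j. s (\<psi> j)"] exI[of _ "\<lambda>j. \<phi> (\<psi> j)"] exI[of _ w]) auto
qed

end

section \<open>Minimal polynomials\<close>

lemma map_poly_hom_add:
  fixes h :: "'a :: comm_ring_1 \<Rightarrow> 'b :: comm_ring_1"
  assumes "h 0 = 0" "\<And>x y. h (x + y) = h x + h y"
  shows "map_poly h (p + q) = map_poly h p + map_poly h q"
  by (rule poly_eqI) (simp add: coeff_map_poly assms)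

lemma map_poly_hom_mult:
  fixes h :: "'a :: comm_ring_1 \<Rightarrow> 'b :: comm_ring_1"
  assumes "h 0 = 0" "\<And>x y. h (x + y) = h x + h y" "\<And>x y. h (x * y) = h x * h y"
  shows "map_poly h (p * q) = map_poly h p * map_poly h q"
proof (rule poly_eqI)
  have sum: "h (sum g A) = (\<Sum>a\<in>A. h (g a))" for g :: "nat \<Rightarrow> 'a" and A
    by (induction A rule: infinite_finite_induct) (simp_all add: assms)
  show "coeff (map_poly h (p * q)) n = coeff (map_poly h p * map_poly h q) n" for n
    by (simp add: coeff_map_poly coeff_mult assms sum)
qed

definition rat_eval :: "rat poly \<Rightarrow> 'a :: field_char_0 \<Rightarrow> 'a" where
  "rat_eval p x = poly (map_poly of_rat p) x"

lemma rat_eval_simps [simp]: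
  "rat_eval (p + q) x = rat_eval p x + rat_eval q x"
  "rat_eval (p * q) x = rat_eval p x * rat_eval q x"
  "rat_eval 0 x = 0" "rat_eval 1 x = 1"
  "rat_eval (pCons a p) x = of_rat a + x * rat_eval p x"
  by (simp_all add: rat_eval_def map_poly_hom_add map_poly_hom_mult of_rat_add of_rat_mult map_poly_pCons)

lemma rat_eval_minus [simp]: "rat_eval (- p) x = - rat_eval p x"
proof -
  have "rat_eval (- p) x + rat_eval p x = rat_eval (- p + p) x" unfolding rat_eval_simps ..
  also have "\<dots> = 0" by simp
  finally show ?thesis by (simp add: eq_neg_iff_add_eq_0)
qed

lemma rat_eval_diff [simp]: "rat_eval (p - q) x = rat_eval p x - rat_eval q x"
  using rat_eval_simps(1)[of p "- q" x] by simp

lemma map_poly_of_rat_of_int: "map_poly of_rat (map_poly of_int p :: rat poly) = map_poly of_int p"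
  by (rule poly_eqI) (simp add: coeff_map_poly)

text \<open>Minimality of the degree is the defining property because it comes directly from a least
  element; irreducibility, the form used by \<open>conjugates\<close>, is derived.\<close>

locale minimal_poly =
  fixes q :: "rat poly" and x :: "'a :: field_char_0"
  assumes monic: "lead_coeff q = 1" and root: "rat_eval q x = 0"
    and minimal: "\<And>p. rat_eval p x = 0 \<Longrightarrow> degree p < degree q \<Longrightarrow> p = 0"
begin

lemma nonzero: "q \<noteq> 0"
  using monic by auto

lemma degree_pos: "degree q > 0"
proof (rule ccontr)
  assume "\<not> ?thesis"
  then obtain a where "q = [:a:]" by (auto elim: degree_eq_zeroE)
  then show False using monic root by simp
qed

lemma dvd: "q dvd p" if "rat_eval p x = 0"
proof -
  have "rat_eval (p mod q) x = 0"
    using that root unfolding minus_div_mult_eq_mod[symmetric] by simp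
  moreover have "p mod q = 0 \<or> degree (p mod q) < degree q"
    using degree_mod_less[OF nonzero] .
  ultimately show ?thesis using minimal by (auto simp: mod_eq_0_iff_dvd)
qed

lemma irreducible: "irreducible q"
proof (rule irreducibleI)
  show "q \<noteq> 0" by (rule nonzero)
  show "\<not> q dvd 1" using degree_pos nonzero by (simp add: is_unit_iff_degree)
  fix a b assume ab: "q = a * b"
  then have ne: "a \<noteq> 0" "b \<noteq> 0" using nonzero by auto
  then have deg: "degree q = degree a + degree b" by (simp add: ab degree_mult_eq)
  from root have "rat_eval a x = 0 \<or> rat_eval b x = 0" by (simp add: ab)
  then have "degree a = 0 \<or> degree b = 0"
    using minimal[of a] minimal[of b] ne deg by linarith
  then show "a dvd 1 \<or> b dvd 1" using ne by (simp add: is_unit_iff_degree)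
qed

text \<open>Euclidean division as an induction on the degree: from q = u p + r follows r(x) = - u(x)
  p(x), so an inverse of r(x) gives one of p(x). The remainder cannot be 0, as otherwise a
  polynomial of smaller degree than q would vanish at x.\<close>

lemma inverse: "\<exists>s. rat_eval p x * rat_eval s x = 1" if "rat_eval p x \<noteq> 0"
proof -
  have small: "\<exists>s. rat_eval p x * rat_eval s x = 1" if "p \<noteq> 0" "degree p < degree q" for p
    using that
  proof (induction "degree p" arbitrary: p rule: less_induct)
    case less
    show ?case
    proof (cases "degree p = 0")
      case True
      then obtain a where "p = [:a:]" by (auto elim: degree_eq_zeroE)
      then have "rat_eval p x * rat_eval [:1 / a:] x = 1"
        using less.prems(1) by (simp add: of_rat_divide)
      then show ?thesis by blast
    next
      case False
      define u r where "u = q div p" and "r = q mod p"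
      have q_eq: "q = u * p + r" by (simp add: u_def r_def)
      have "r \<noteq> 0"
      proof
        assume "r = 0"
        then have q: "q = u * p" using q_eq by simp
        then have "u \<noteq> 0" using nonzero by auto
        moreover have "rat_eval u x = 0 \<or> rat_eval p x = 0" using root by (simp add: q)
        moreover have "degree u < degree q" using q \<open>u \<noteq> 0\<close> less.prems(1) False by (simp add: degree_mult_eq)
        ultimately show False using minimal less.prems by blast
      qed
      moreover have "degree r < degree p"
        using degree_mod_less[OF less.prems(1), of q] \<open>r \<noteq> 0\<close> by (simp add: r_def)
      ultimately obtain s where s: "rat_eval r x * rat_eval s x = 1"
        using less.hyps[of r] less.prems by auto
      have "rat_eval r x = - (rat_eval u x * rat_eval p x)"
        using root q_eq by (metis rat_eval_simps(1,2) add_eq_0_iff)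
      then have "rat_eval p x * rat_eval (- u * s) x = 1" using s by (simp add: mult_ac)
      then show ?thesis by blast
    qed
  qed
  have eq: "rat_eval (p mod q) x = rat_eval p x"
    using root unfolding minus_div_mult_eq_mod[symmetric] by simp
  then have "p mod q \<noteq> 0" using that by auto
  moreover have "degree (p mod q) < degree q"
    using degree_mod_less[OF nonzero, of p] \<open>p mod q \<noteq> 0\<close> by simp
  ultimately show ?thesis using small[of "p mod q"] unfolding eq by blast
qed

end

lemma ex_minimal_poly:
  assumes "p \<noteq> 0" "rat_eval p x = 0"
  shows "\<exists>q. minimal_poly q x"
proof -
  define P where "P p \<longleftrightarrow> p \<noteq> 0 \<and> rat_eval p x = 0" for p
  define q where "q = arg_min degree P"
  have "P p" using assms by (simp add: P_def)
  then have q: "P q" and least: "\<And>p. P p \<Longrightarrow> degree q \<le> degree p"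
    unfolding q_def by (auto intro: arg_min_natI arg_min_nat_le)
  have "minimal_poly (smult (inverse (lead_coeff q)) q) x"
  proof
    have "smult (inverse (lead_coeff q)) q = [:inverse (lead_coeff q):] * q" by simp
    then show "rat_eval (smult (inverse (lead_coeff q)) q) x = 0"
      using q by (simp only: rat_eval_simps) (simp add: P_def)
    show "lead_coeff (smult (inverse (lead_coeff q)) q) = 1" using q by (simp add: P_def)
    show "p = 0" if "rat_eval p x = 0" "degree p < degree (smult (inverse (lead_coeff q)) q)" for p
      using least[of p] that q by (auto simp: P_def)
  qed
  then show ?thesis by blast
qed

lemma clear_denominators:
  "\<exists>D q'. D > 0 \<and> map_poly of_int q' = smult (of_int D) (q :: rat poly)"
proof (induction q)
  case 0
  show ?case by (intro exI[of _ 1] exI[of _ 0]) simp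
next
  case (pCons a q)
  then obtain D q' where D: "D > 0" "map_poly of_int q' = smult (of_int D) q" by blast
  obtain n d where nd: "quotient_of a = (n, d)" by fastforce
  then have d: "d > 0" "a = of_int n / of_int d" by (auto dest: quotient_of_denom_pos quotient_of_div)
  have "map_poly of_int (pCons (n * D) (smult d q')) = smult (of_int (D * d)) (pCons a q)"
  proof -
    have "map_poly of_int (smult d q') = smult (of_int (D * d)) q"
      by (rule poly_eqI) (use D(2) in \<open>simp add: poly_eq_iff coeff_map_poly\<close>)
    then show ?thesis using d by (simp add: map_poly_pCons)
  qed
  then show ?case using D d by (intro exI[of _ "D * d"] exI[of _ "pCons (n * D) (smult d q')"]) simp
qed

lemma map_poly_of_int_eq_iff [simp]:
  "map_poly (of_int :: int \<Rightarrow> 'a :: ring_char_0) p = map_poly of_int q \<longleftrightarrow> p = q"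
  by (auto simp: poly_eq_iff coeff_map_poly)

text \<open>Gauss's lemma. Contents multiply and p has content 1, so after clearing denominators p
  is the product of the two primitive parts. Their leading coefficients multiply to 1, and
  positivity of D fixes the sign.\<close>

lemma monic_factor_integral:
  fixes p :: "int poly" and q :: "rat poly"
  assumes p: "lead_coeff p = 1" and q: "lead_coeff q = 1" and dvd: "q dvd map_poly of_int p"
  shows "\<exists>m. q = map_poly of_int m \<and> lead_coeff m = 1"
proof -
  obtain k where k: "map_poly of_int p = q * k" using dvd by blast
  obtain D q' where D: "D > 0" and q': "map_poly of_int q' = smult (of_int D) q"
    using clear_denominators[of q] by blast
  obtain E k' where E: "E > 0" and k': "map_poly of_int k' = smult (of_int E) k"
    using clear_denominators[of k] by blast
  have "map_poly of_int (smult (D * E) p) = (map_poly of_int (q' * k') :: rat poly)"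
  proof -
    have "map_poly of_int (smult (D * E) p) = smult (of_int (D * E)) (map_poly of_int p :: rat poly)"
      by (rule poly_eqI) (simp add: coeff_map_poly)
    then show ?thesis unfolding k by (simp add: map_poly_hom_mult q' k' mult_ac)
  qed
  then have eq: "smult (D * E) p = q' * k'" by (simp only: map_poly_of_int_eq_iff)
  have "content p dvd lead_coeff p" by (rule content_dvd_coeff)
  then have "content p = 1" using p by (metis is_unit_content_iff)
  then have DE: "D * E = content q' * content k'"
    using arg_cong[OF eq, of content] D E by (simp add: content_mult)
  have "smult (D * E) p = smult (D * E) (primitive_part q' * primitive_part k')"
  proof -
    have "smult (content q' * content k') (primitive_part q' * primitive_part k') =
        smult (content q') (primitive_part q') * smult (content k') (primitive_part k')"
      by (simp del: content_times_primitive_part add: mult.commute)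
    also have "\<dots> = q' * k'" by simp
    finally show ?thesis using eq DE by metis
  qed
  then have p_eq: "p = primitive_part q' * primitive_part k'"
    using D E by (auto simp: poly_eq_iff)
  define m where "m = primitive_part q'"
  have q'_eq: "q' = smult (content q') m" by (simp add: m_def)
  have lq': "of_int (lead_coeff q') = (of_int D :: rat)"
    using arg_cong[OF q', of lead_coeff] q D by (simp add: degree_map_poly coeff_map_poly)
  then have lq'': "lead_coeff q' = D" by simp
  have lq: "lead_coeff q' = content q' * lead_coeff m"
  proof -
    have "lead_coeff q' = lead_coeff (smult (content q') m)" using q'_eq by metis
    then show ?thesis by simp
  qed
  have "lead_coeff m * lead_coeff (primitive_part k') = 1"
    using p unfolding p_eq m_def by (simp add: lead_coeff_mult)
  then have "\<bar>lead_coeff m\<bar> = 1" by (simp add: zmult_eq_1_iff) auto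
  moreover have "lead_coeff m > 0"
  proof -
    have "content q' * lead_coeff m = D" using lq'' lq by simp
    moreover have "content q' \<ge> 0"
      using normalize_content[of q'] unfolding normalize_int_def by linarith
    ultimately show ?thesis using D zero_less_mult_iff[of "content q'" "lead_coeff m"] by auto
  qed
  ultimately have m1: "lead_coeff m = 1" by simp
  then have cD: "content q' = D" using lq'' lq by simp
  have "smult (of_int D) q = smult (of_int D) (map_poly of_int m)"
  proof -
    have "map_poly of_int (smult D m) = smult (of_int D) (map_poly of_int m :: rat poly)"
      by (rule poly_eqI) (simp add: coeff_map_poly)
    then show ?thesis using q' q'_eq cD by metis
  qed
  then show ?thesis using D m1 by (intro exI[of _ m]) (simp add: poly_eq_iff)
qed

lemma pisot_minimal_poly:
  assumes "pisot \<theta>"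
  obtains m :: "int poly" where "lead_coeff m = 1" "minimal_poly (map_poly of_int m) \<theta>"
    "\<And>z. poly (map_poly of_int m) (z :: complex) = 0 \<Longrightarrow> z \<noteq> of_real \<theta> \<Longrightarrow> norm z < 1"
proof -
  have "algebraic_int \<theta>" using assms by (simp add: pisot_def)
  then obtain p :: "int poly" where p: "poly (map_poly of_int p) \<theta> = 0" "lead_coeff p = 1"
    unfolding algebraic_int_altdef_ipoly by blast
  have p_rat: "rat_eval (map_poly of_int p) \<theta> = 0" 
    using p(1) by (simp add: rat_eval_def map_poly_of_rat_of_int)
  have "map_poly of_int p \<noteq> (0 :: rat poly)" using p(2) by (auto simp: poly_eq_iff coeff_map_poly intro!: exI[of _ "degree p"])
  then obtain q where q: "minimal_poly q \<theta>" using ex_minimal_poly[OF _ p_rat] by blast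
  interpret minimal_poly q \<theta> by (rule q)
  obtain m where m: "q = map_poly of_int m" "lead_coeff m = 1"
    using monic_factor_integral[OF p(2) monic dvd[OF p_rat]] by blast
  show ?thesis
  proof (rule that[OF m(2)])
    show "minimal_poly (map_poly of_int m) \<theta>" using q m by simp
    fix z :: complex assume z: "poly (map_poly of_int m) z = 0" "z \<noteq> of_real \<theta>"
    have "z \<in> conjugates \<theta>"
      unfolding conjugates_def
      using irreducible monic root z(1) by (auto simp: m(1) rat_eval_def map_poly_of_rat_of_int intro!: exI[of _ q])
    then show "norm z < 1" using assms z(2) by (simp add: pisot_def)
  qed
qed

section \<open>Pisot numbers\<close>

lemma poly_of_real_map: "poly (map_poly of_real p) (of_real x :: complex) = of_real (poly p x)"
  by (induction p) (simp_all add: map_poly_pCons)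

text \<open>The roots lie outside the closed unit disc and are finitely many, so 1 / p is analytic
  on a disc of radius r > 1, and its Taylor coefficients decay like s^(-n) for any s strictly
  between 1 and r.\<close>

lemma bounded_inverse_coeffs:
  fixes p :: "complex poly"
  assumes nz: "\<And>z. norm z \<le> 1 \<Longrightarrow> poly p z \<noteq> 0"
  shows "\<exists>C \<eta>. 0 < \<eta> \<and> \<eta> < 1 \<and> C \<ge> 0 \<and> (\<forall>n. norm (fps_nth (inverse (fps_of_poly p)) n) \<le> C * \<eta> ^ n)"
    and "norm z \<le> 1 \<Longrightarrow> (\<lambda>n. fps_nth (inverse (fps_of_poly p)) n * z ^ n) sums inverse (poly p z)"
proof -
  have "p \<noteq> 0" using nz[of 0] by auto
  then have fin: "finite {z. poly p z = 0}" by (rule poly_roots_finite)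
  \<comment> \<open>The entry 2 serves the case of a polynomial without roots.\<close>
  define r where "r = Min (insert 2 (norm ` {z. poly p z = 0}))"
  have "r > 1" unfolding r_def using fin nz by (subst Min_gr_iff) (auto simp: not_le[symmetric])
  have nz': "eval_fps (fps_of_poly p) z \<noteq> 0" if "ereal (norm z) < ereal r" for z
  proof
    assume "eval_fps (fps_of_poly p) z = 0"
    then have "r \<le> norm z" unfolding r_def using fin by (intro Min_le) auto
    then show False using that by simp
  qed
  have "fps_conv_radius (inverse (fps_of_poly p)) \<ge> min (ereal r) (fps_conv_radius (fps_of_poly p))"
    by (rule fps_conv_radius_inverse[OF nz'])
  then have radius: "fps_conv_radius (inverse (fps_of_poly p)) \<ge> ereal r" by simp
  define s where "s = (1 + r) / 2"
  have s: "1 < s" "s < r" using \<open>r > 1\<close> by (simp_all add: s_def)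
  have "summable (\<lambda>n. fps_nth (inverse (fps_of_poly p)) n * of_real s ^ n)"
    using s radius by (intro summable_fps) (auto intro: less_le_trans[of _ "ereal r"])
  then have "Bseq (\<lambda>n. fps_nth (inverse (fps_of_poly p)) n * of_real s ^ n)"
    by (rule summable_imp_Bseq)
  then obtain C where C: "C > 0" "\<And>n. norm (fps_nth (inverse (fps_of_poly p)) n * of_real s ^ n) \<le> C"
    by (auto simp: Bseq_def)
  have "norm (fps_nth (inverse (fps_of_poly p)) n) \<le> C * (1 / s) ^ n" for n
    using C(2)[of n] s by (simp add: norm_mult norm_power power_one_over field_simps)
  then show "\<exists>C \<eta>. 0 < \<eta> \<and> \<eta> < 1 \<and> C \<ge> 0 \<and> (\<forall>n. norm (fps_nth (inverse (fps_of_poly p)) n) \<le> C * \<eta> ^ n)"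
    using s C(1) by (intro exI[of _ C] exI[of _ "1 / s"]) auto
  show "(\<lambda>n. fps_nth (inverse (fps_of_poly p)) n * z ^ n) sums inverse (poly p z)" if "norm z \<le> 1"
  proof -
    have z: "ereal (norm z) < ereal r" using that \<open>r > 1\<close> by simp
    have "eval_fps (inverse (fps_of_poly p)) z = inverse (eval_fps (fps_of_poly p) z)"
      by (rule eval_fps_inverse[where r = "ereal r"]) (use z nz' in auto)
    then have "inverse (poly p z) = (\<Sum>n. fps_nth (inverse (fps_of_poly p)) n * z ^ n)"
      by (simp add: eval_fps_def[of "inverse (fps_of_poly p)"])
    moreover have "summable (\<lambda>n. fps_nth (inverse (fps_of_poly p)) n * z ^ n)"
      using z radius by (intro summable_fps) (auto intro: less_le_trans[of _ "ereal r"])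
    ultimately show ?thesis by (simp add: summable_sums)
  qed
qed

text \<open>
  With \<open>m\<close> the minimal polynomial and \<open>m = (X - \<theta>) Q\<close>, the reversed \<open>Q\<close> has no zero in the closed
  unit disc. The constant $\gamma = \theta^{d-1}/Q(\theta)$ is the leading coefficient of the integer
  sequence generated by the reciprocal of the reversed \<open>m\<close>.
\<close>
locale pisot_poly =
  fixes \<theta> :: real and m :: "int poly" and Q :: "real poly"
  assumes gt1: "\<theta> > 1" and monic: "lead_coeff m = 1"
    and factor: "map_poly of_int m = [:- \<theta>, 1:] * Q"
    and nz: "\<And>z :: complex. norm z \<le> 1 \<Longrightarrow> poly (reflect_poly (map_poly of_real Q)) z \<noteq> 0"
begin

definition d where "d = degree m"
definition c where "c j = coeff (reflect_poly m) j"
definition q where "q k = coeff (reflect_poly Q) k"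
text \<open>This is Q(\<theta>) / \<theta>^(d-1), the reciprocal of the constant \<gamma>.\<close>

definition \<kappa> where "\<kappa> = poly (reflect_poly Q) (1 / \<theta>)"

lemma Q_nonzero: "Q \<noteq> 0"
proof
  assume "Q = 0"
  then have "coeff (map_poly real_of_int m) (degree m) = 0" by (simp add: factor)
  then show False using monic by (simp add: coeff_map_poly)
qed

lemma degree_Q: "d = Suc (degree Q)"
proof -
  have "d = degree (map_poly real_of_int m)" by (simp add: d_def degree_map_poly)
  also have "\<dots> = Suc (degree Q)" unfolding factor using Q_nonzero by (subst degree_mult_eq) auto
  finally show ?thesis .
qed

lemma q_eq_0: "k \<ge> d \<Longrightarrow> q k = 0"
  by (simp add: q_def coeff_reflect_poly degree_Q)

lemma reflect_of_int: "reflect_poly (map_poly real_of_int m) = map_poly of_int (reflect_poly m)"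
  by (rule poly_eqI) (simp add: coeff_reflect_poly coeff_map_poly degree_map_poly)

lemma reflect_factor: "map_poly real_of_int (reflect_poly m) = [:1, - \<theta>:] * reflect_poly Q"
proof -
  have "reflect_poly [:- \<theta>, 1:] = [:1, - \<theta>:]" using gt1 by (simp add: reflect_poly_pCons)
  then show ?thesis
    unfolding reflect_of_int[symmetric] factor by (simp only: reflect_poly_mult)
qed

lemma c_eq: "of_int (c j) = q j - \<theta> * (if j = 0 then 0 else q (j - 1))"
proof -
  have "of_int (c j) = coeff ([:1, - \<theta>:] * reflect_poly Q) j"
    unfolding reflect_factor[symmetric] by (simp add: c_def coeff_map_poly)
  then show ?thesis by (cases j) (simp_all add: q_def)
qed

lemma c_0: "c 0 = 1"
  using monic by (simp add: c_def)

text \<open>The recurrence with coefficients c is the composition of the recurrence with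
  coefficients q and the operator 1 - \<theta> * shift, because the reversed m is (1 - \<theta> X)
  times the reversed Q.\<close>

lemma sum_c: "(\<Sum>j\<le>d. of_int (c j) * a (n + j)) =
    (\<Sum>k<d. q k * a (n + k)) - \<theta> * (\<Sum>k<d. q k * a (Suc n + k))"
proof -
  have "(\<Sum>j\<le>d. of_int (c j) * a (n + j)) =
     (\<Sum>j\<le>d. q j * a (n + j)) - \<theta> * (\<Sum>j\<le>d. (if j = 0 then 0 else q (j - 1)) * a (n + j))"
    by (simp add: c_eq left_diff_distrib sum_subtractf sum_distrib_left mult.assoc)
  also have "(\<Sum>j\<le>d. q j * a (n + j)) = (\<Sum>k<d. q k * a (n + k))"
    by (simp add: lessThan_Suc_atMost[symmetric] q_eq_0)
  also have "(\<Sum>j\<le>d. (if j = 0 then 0 else q (j - 1)) * a (n + j)) = (\<Sum>k<d. q k * a (Suc n + k))"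
    by (simp add: sum.atMost_shift)
  finally show ?thesis .
qed

lemma \<kappa>_altdef: "\<kappa> = (\<Sum>k<d. q k / \<theta> ^ k)"
proof -
  have "\<kappa> = (\<Sum>k\<le>degree (reflect_poly Q). q k * (1 / \<theta>) ^ k)"
    by (simp add: \<kappa>_def poly_altdef q_def)
  also have "\<dots> = (\<Sum>k<d. q k * (1 / \<theta>) ^ k)"
    using degree_reflect_poly_le[of Q]
    by (intro sum.mono_neutral_left) (auto simp: degree_Q q_def coeff_eq_0)
  finally show ?thesis by (simp add: power_one_over)
qed

lemma reflect_of_real: "reflect_poly (map_poly of_real Q :: complex poly) = map_poly of_real (reflect_poly Q)"
  by (rule poly_eqI) (simp add: coeff_reflect_poly coeff_map_poly degree_map_poly)

lemma \<kappa>_nonzero: "\<kappa> \<noteq> 0"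
proof -
  have "poly (reflect_poly (map_poly of_real Q)) (of_real (1 / \<theta>) :: complex) \<noteq> 0"
    using gt1 by (intro nz) (simp add: norm_divide)
  then show ?thesis unfolding reflect_of_real poly_of_real_map \<kappa>_def by simp
qed

text \<open>The reciprocal power series of the reversed m has integer coefficients, because the
  reversed m is integral with constant term 1. With U the reciprocal of the reversed Q, its
  coefficient of index n is \<theta>^n times the partial sum of U_k \<theta>^(-k) over k up to n.
  The full sum is 1 / \<kappa>, and the tail is exponentially small because U_k decays
  exponentially.\<close>

lemma near_int:
  "\<exists>C \<eta>. 0 < \<eta> \<and> \<eta> < 1 \<and> C \<ge> 0 \<and> (\<forall>n. \<exists>b :: int. \<bar>1 / \<kappa> * \<theta> ^ n - of_int b\<bar> \<le> C * \<eta> ^ n)"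
proof -
  define p where "p = reflect_poly (map_poly of_real Q :: complex poly)"
  define U where "U = inverse (fps_of_poly p)"
  obtain C \<eta> where \<eta>: "0 < \<eta>" "\<eta> < 1" "C \<ge> 0" and U: "\<And>n. norm (fps_nth U n) \<le> C * \<eta> ^ n"
    using bounded_inverse_coeffs(1)[OF nz] unfolding U_def p_def by blast
  define t where "t = (of_real \<theta> :: complex)"
  have t: "norm t = \<theta>" "t \<noteq> 0" using gt1 by (simp_all add: t_def)
  have \<kappa>_sums: "(\<lambda>k. fps_nth U k * (1 / t) ^ k) sums of_real (1 / \<kappa>)"
  proof -
    have "norm (1 / t) \<le> 1" using t gt1 by (simp add: norm_divide)
    from bounded_inverse_coeffs(2)[OF nz this]
    have "(\<lambda>k. fps_nth U k * (1 / t) ^ k) sums inverse (poly p (1 / t))" by (simp add: U_def p_def)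
    moreover have "poly p (1 / t) = of_real \<kappa>"
      unfolding p_def reflect_of_real \<kappa>_def poly_of_real_map[symmetric] by (simp add: t_def)
    ultimately show ?thesis by (simp add: divide_inverse)
  qed
  define G where "G = Abs_fps (\<lambda>n. t ^ n)"
  define B where "B = U * G"
  have B_nth: "fps_nth B n = (\<Sum>k\<le>n. fps_nth U k * t ^ (n - k))" for n
    by (simp add: B_def G_def fps_mult_nth atLeast0AtMost)
  have "fps_of_poly [:1, - t:] * G = 1"
  proof (rule fps_ext)
    fix n
    have "fps_of_poly [:1, - t:] * G = G - fps_const t * (fps_X * G)"
      by (simp add: fps_of_poly_pCons algebra_simps flip: fps_const_neg)
    then have "fps_nth (fps_of_poly [:1, - t:] * G) n = fps_nth (G - fps_const t * (fps_X * G)) n" by simp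
    also have "\<dots> = fps_nth 1 n" by (cases n) (simp_all add: G_def)
    finally show "fps_nth (fps_of_poly [:1, - t:] * G) n = fps_nth 1 n" .
  qed
  moreover have "fps_of_poly p * U = 1"
    unfolding U_def using nz[of 0] by (intro inverse_mult_eq_1') (simp add: p_def)
  moreover have R: "map_poly of_int (reflect_poly m) = [:1, - t:] * p"
  proof -
    have "map_poly of_real (map_poly real_of_int (reflect_poly m)) = (map_poly of_int (reflect_poly m) :: complex poly)"
      by (rule poly_eqI) (simp add: coeff_map_poly)
    then have "(map_poly of_int (reflect_poly m) :: complex poly) = map_poly of_real ([:1, - \<theta>:] * reflect_poly Q)"
      by (simp only: reflect_factor)
    also have "\<dots> = map_poly of_real [:1, - \<theta>:] * map_poly of_real (reflect_poly Q)"
      by (rule map_poly_hom_mult) auto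
    finally show ?thesis by (simp add: p_def reflect_of_real t_def map_poly_pCons)
  qed
  ultimately have RB: "fps_of_poly (map_poly of_int (reflect_poly m)) * B = 1"
    unfolding R fps_of_poly_mult B_def by (metis mult.assoc mult.left_commute mult.right_neutral)
  have int: "fps_nth B n \<in> \<int>" for n
  proof (induction n rule: less_induct)
    case (less n)
    have "(\<Sum>i\<le>n. of_int (c i) * fps_nth B (n - i)) = fps_nth 1 n"
      unfolding RB[symmetric] by (simp add: fps_mult_nth atLeast0AtMost coeff_map_poly c_def)
    also have "(\<Sum>i\<le>n. of_int (c i) * fps_nth B (n - i)) =
        fps_nth B n + (\<Sum>i\<in>{..n} - {0}. of_int (c i) * fps_nth B (n - i))"
      by (subst sum.remove[of _ 0]) (simp_all add: c_0)
    finally have "fps_nth B n = fps_nth 1 n - (\<Sum>i\<in>{..n} - {0}. of_int (c i) * fps_nth B (n - i))"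
      by (simp add: algebra_simps)
    moreover have "(\<Sum>i\<in>{..n} - {0}. of_int (c i) * fps_nth B (n - i)) \<in> \<int>"
      by (intro Ints_sum Ints_mult less) auto
    ultimately show ?case by (auto intro!: Ints_diff)
  qed
  define C' where "C' = C * (1 / (1 - 1 / \<theta>))"
  have "\<exists>b :: int. \<bar>1 / \<kappa> * \<theta> ^ n - of_int b\<bar> \<le> C' * \<eta> ^ n" for n
  proof -
    obtain b where b: "fps_nth B n = of_int b" using int[of n] by (auto elim: Ints_cases)
    have "(\<lambda>k. fps_nth U (k + Suc n) * (1 / t) ^ (k + Suc n)) sums
       (of_real (1 / \<kappa>) - (\<Sum>k<Suc n. fps_nth U k * (1 / t) ^ k))"
      using \<kappa>_sums by (rule sums_split_initial_segment)
    then have "(\<lambda>k. t ^ n * (fps_nth U (k + Suc n) * (1 / t) ^ (k + Suc n))) sums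
       (t ^ n * (of_real (1 / \<kappa>) - (\<Sum>k<Suc n. fps_nth U k * (1 / t) ^ k)))"
      by (rule sums_mult)
    moreover have "t ^ n * (\<Sum>k<Suc n. fps_nth U k * (1 / t) ^ k) = of_int b"
      unfolding b[symmetric] B_nth sum_distrib_left lessThan_Suc_atMost
      using t by (intro sum.cong) (auto simp: power_one_over power_diff)
    ultimately have sums: "(\<lambda>k. t ^ n * (fps_nth U (k + Suc n) * (1 / t) ^ (k + Suc n))) sums
       of_real (1 / \<kappa> * \<theta> ^ n - of_int b)"
      by (simp add: right_diff_distrib t_def mult.commute)
    have bound: "norm (t ^ n * (fps_nth U (k + Suc n) * (1 / t) ^ (k + Suc n))) \<le> C * \<eta> ^ n * (1 / \<theta>) ^ k" for k
    proof -
      have "t ^ n * (fps_nth U (k + Suc n) * (1 / t) ^ (k + Suc n)) = fps_nth U (k + Suc n) * (1 / t) ^ Suc k"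
        using t by (simp add: power_add power_one_over field_simps)
      also have "norm \<dots> = norm (fps_nth U (k + Suc n)) * (1 / \<theta>) ^ Suc k"
        using t by (simp add: norm_mult norm_power norm_divide)
      also have "\<dots> \<le> (C * \<eta> ^ n) * (1 / \<theta>) ^ k"
      proof (rule mult_mono)
        have "\<eta> ^ (k + Suc n) \<le> \<eta> ^ n" using \<eta> by (intro power_decreasing) auto
        then show "norm (fps_nth U (k + Suc n)) \<le> C * \<eta> ^ n"
          using U[of "k + Suc n"] \<eta> by (meson mult_left_mono order_trans)
        show "(1 / \<theta>) ^ Suc k \<le> (1 / \<theta>) ^ k" using gt1 by (intro power_decreasing) auto
      qed (use \<eta> gt1 in auto)
      finally show ?thesis .
    qed
    have geo: "(\<lambda>k. C * \<eta> ^ n * (1 / \<theta>) ^ k) sums (C * \<eta> ^ n * (1 / (1 - 1 / \<theta>)))"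
      using gt1 by (intro sums_mult geometric_sums) auto
    have "norm (of_real (1 / \<kappa> * \<theta> ^ n - of_int b) :: complex) \<le> C * \<eta> ^ n * (1 / (1 - 1 / \<theta>))"
      unfolding sums_unique[OF sums] sums_unique[OF geo]
      by (rule norm_suminf_le[OF bound sums_summable[OF geo]])
    then show ?thesis
      unfolding norm_of_real C'_def by (intro exI[of _ b]) (simp add: mult_ac)
  qed
  moreover have "C' \<ge> 0" using \<eta> gt1 by (simp add: C'_def)
  ultimately show ?thesis using \<eta> by blast
qed

text \<open>The weights \<theta>^n turn \<open>sum_c\<close> into a telescoping sum.\<close>

lemma sum_q_eq: "(\<Sum>n<N. (\<Sum>j\<le>d. of_int (c j) * a (n + j)) * \<theta> ^ n) =
    (\<Sum>k<d. q k * a k) - \<theta> ^ N * (\<Sum>k<d. q k * a (N + k))"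
  unfolding sum_c by (induction N) (simp_all add: algebra_simps)

lemma sum_c_geometric: "(\<Sum>j\<le>d. of_int (c j) * (x / \<theta> ^ (n + j))) = 0"
proof -
  have "(\<Sum>k<d. q k * (x / \<theta> ^ (n + k))) - \<theta> * (\<Sum>k<d. q k * (x / \<theta> ^ (Suc n + k))) = 0"
    using gt1 by (simp add: sum_distrib_left)
  then show ?thesis using sum_c[of "\<lambda>k. x / \<theta> ^ k" n] by simp
qed

text \<open>Let a_k be the integer nearest to x / \<theta>^k and let s have the coefficients \<Sum>
  c_j a_(n+j). The recurrence annihilates the geometric sequence x / \<theta>^k, so these
  coefficients depend on the rounding errors only. Since a_k = 0 for large k, s is a polynomial and
  the telescoped sum gives s(\<theta>) = \<Sum> q_k a_k, while \<kappa> x = \<Sum> q_k x /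
  \<theta>^k holds exactly.\<close>

lemma representation:
  fixes x :: real
  defines "\<epsilon> k \<equiv> x / \<theta> ^ k - of_int (round (x / \<theta> ^ k))"
  obtains s where "\<And>n. of_int (coeff s n) = - (\<Sum>j\<le>d. of_int (c j) * \<epsilon> (n + j))"
    "x - 1 / \<kappa> * poly (map_poly of_int s) \<theta> = 1 / \<kappa> * (\<Sum>k<d. q k * \<epsilon> k)"
proof -
  define a where "a k = round (x / \<theta> ^ k)" for k
  have "(\<lambda>k. x * (1 / \<theta>) ^ k) \<longlonglongrightarrow> 0"
    using gt1 by (intro tendsto_mult_right_zero LIMSEQ_power_zero) auto
  then have "\<forall>\<^sub>F k in sequentially. \<bar>x * (1 / \<theta>) ^ k\<bar> < 1/2"
    by (intro order_tendstoD(2)[OF tendsto_rabs_zero]) auto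
  then obtain N where "\<And>k. k \<ge> N \<Longrightarrow> \<bar>x / \<theta> ^ k\<bar> < 1/2"
    by (auto simp: eventually_sequentially power_one_over)
  then have a0: "a k = 0" if "k \<ge> N" for k
    unfolding a_def using that by (intro round_unique') simp
  define \<sigma> where "\<sigma> n = (\<Sum>j\<le>d. c j * a (n + j))" for n
  define s where "s = Abs_poly \<sigma>"
  have coeff: "coeff s n = \<sigma> n" for n
    unfolding s_def by (subst coeff_Abs_poly[of N]) (simp_all add: \<sigma>_def a0)
  have deg: "coeff s n = 0" if "n \<ge> N" for n using that by (simp add: coeff \<sigma>_def a0)
  have "of_int (coeff s n) = - (\<Sum>j\<le>d. of_int (c j) * \<epsilon> (n + j))" for n
    using sum_c_geometric[of x n] by (simp add: coeff \<sigma>_def \<epsilon>_def a_def right_diff_distrib sum_subtractf)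
  moreover have "x - 1 / \<kappa> * poly (map_poly of_int s) \<theta> = 1 / \<kappa> * (\<Sum>k<d. q k * \<epsilon> k)"
  proof -
    have "poly (map_poly real_of_int s) \<theta> = (\<Sum>n\<le>degree s. of_int (coeff s n) * \<theta> ^ n)"
      by (simp add: poly_altdef degree_map_poly coeff_map_poly)
    also have "\<dots> = (\<Sum>n<N. of_int (coeff s n) * \<theta> ^ n)"
      by (rule sum.mono_neutral_cong) (auto simp: coeff_eq_0 not_le not_less deg)
    also have "\<dots> = (\<Sum>k<d. q k * of_int (a k))"
      using sum_q_eq[of "\<lambda>k. of_int (a k)" N] by (simp add: coeff \<sigma>_def a0)
    finally have "poly (map_poly real_of_int s) \<theta> = (\<Sum>k<d. q k * of_int (a k))" .
    moreover have "\<kappa> * x = (\<Sum>k<d. q k * (x / \<theta> ^ k))"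
      by (simp add: \<kappa>_altdef sum_distrib_right)
    then have "x = 1 / \<kappa> * (\<Sum>k<d. q k * (x / \<theta> ^ k))" using \<kappa>_nonzero by (simp add: field_simps)
    ultimately show ?thesis
      by (simp add: \<epsilon>_def a_def right_diff_distrib sum_subtractf diff_divide_distrib)
  qed
  ultimately show ?thesis by (rule that)
qed

lemma ex_concentrated: "\<exists>\<rho> A. concentrated \<theta> (1 / \<kappa>) \<rho> A"
proof -
  obtain C \<eta> where \<eta>: "0 < \<eta>" "\<eta> < 1" "C \<ge> 0" and near: "\<And>n. \<exists>b :: int. \<bar>1 / \<kappa> * \<theta> ^ n - of_int b\<bar> \<le> C * \<eta> ^ n"
    using near_int by blast
  \<comment> \<open>The root compensates for the doubled exponents in \<open>concentrated\<close>.
    The rate \<eta> is required for k below n, the rate 1 / \<theta> for k above n.\<close>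
  define \<rho> where "\<rho> = sqrt (max \<eta> (1 / \<theta>))"
  define A where "A = pi * (C + \<bar>1 / \<kappa>\<bar>)"
  have mx: "max \<eta> (1 / \<theta>) > 0" "max \<eta> (1 / \<theta>) < 1" using \<eta> gt1 by auto
  have \<rho>2: "\<rho>\<^sup>2 = max \<eta> (1 / \<theta>)" using mx by (simp add: \<rho>_def)
  have "concentrated \<theta> (1 / \<kappa>) \<rho> A"
  proof
    show "\<theta> > 1" by (rule gt1)
    show "1 / \<kappa> \<noteq> 0" using \<kappa>_nonzero by simp
    show "\<rho> > 0" "\<rho> < 1" "A \<ge> 0" using mx \<eta> by (auto simp: \<rho>_def A_def)
    show "1 / \<theta> \<le> \<rho>\<^sup>2" by (simp add: \<rho>2)
    fix n k
    show "\<exists>b :: int. pi * \<bar>1 / \<kappa> * \<theta> ^ n / \<theta> ^ k - of_int b\<bar> \<le> A * \<rho> ^ (2 * nat_dist n k)"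
    proof (cases "k \<le> n")
      case True
      obtain b :: int where b: "\<bar>1 / \<kappa> * \<theta> ^ (n - k) - of_int b\<bar> \<le> C * \<eta> ^ (n - k)" using near by blast
      have eq: "1 / \<kappa> * \<theta> ^ n / \<theta> ^ k = 1 / \<kappa> * \<theta> ^ (n - k)"
        using True gt1 by (simp add: power_diff)
      have "pi * \<bar>1 / \<kappa> * \<theta> ^ (n - k) - of_int b\<bar> \<le> pi * (C * \<eta> ^ (n - k))"
        using b by (intro mult_left_mono) auto
      also have "\<dots> \<le> pi * ((C + \<bar>1 / \<kappa>\<bar>) * (\<rho>\<^sup>2) ^ (n - k))"
        unfolding \<rho>2 using \<eta> by (intro mult_left_mono mult_mono power_mono) auto
      finally show ?thesis
        unfolding eq using True by (intro exI[of _ b]) (simp add: A_def nat_dist_def power_mult mult.assoc)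
    next
      case False
      have "\<theta> ^ k = \<theta> ^ n * \<theta> ^ (k - n)" using False by (simp add: power_add[symmetric])
      then have "pi * \<bar>1 / \<kappa> * \<theta> ^ n / \<theta> ^ k\<bar> = pi * (\<bar>1 / \<kappa>\<bar> * (1 / \<theta>) ^ (k - n))"
        using gt1 by (simp add: abs_mult power_one_over)
      also have "\<dots> \<le> pi * ((C + \<bar>1 / \<kappa>\<bar>) * (\<rho>\<^sup>2) ^ (k - n))"
        unfolding \<rho>2 using \<eta> gt1 by (intro mult_left_mono mult_mono power_mono) auto
      finally show ?thesis
        using False by (intro exI[of _ 0]) (simp add: A_def nat_dist_def power_mult mult.assoc)
    qed
  qed
  then show ?thesis by blast
qed

lemma ex_pisot_system: "\<exists>\<gamma> \<rho> A. pisot_system \<theta> \<gamma> \<rho> A"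
proof -
  obtain \<rho> A where "concentrated \<theta> (1 / \<kappa>) \<rho> A" using ex_concentrated by blast
  then interpret concentrated \<theta> "1 / \<kappa>" \<rho> A .
  define S where "S = (\<Sum>j\<le>d. \<bar>c j\<bar>)"
  have "S \<ge> 0" by (simp add: S_def sum_nonneg)
  \<comment> \<open>Chosen so that S \<delta> < 1: if all errors entering a coefficient are at most
    \<delta>, the coefficient is an integer of modulus below 1 and hence 0. The summand 2 keeps
    \<delta> at most 1/2.\<close>
  define \<delta> where "\<delta> = 1 / (2 + real_of_int S)"
  have half: "\<bar>y - of_int (round y)\<bar> \<le> 1/2" for y :: real
    using of_int_round_abs_le[of y] by (simp add: abs_minus_commute)
  have "pisot_system \<theta> (1 / \<kappa>) \<rho> A"
  proof
    show "\<exists>\<delta> B C d. 0 < \<delta> \<and> \<delta> \<le> 1/2 \<and> (\<forall>x. \<exists>s. (\<forall>m. \<bar>coeff s m\<bar> \<le> B) \<and> \<bar>x - ev s\<bar> \<le> C \<and>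
      (\<forall>m\<in>supp s. \<exists>j\<le>d. \<delta> \<le> \<bar>x / \<theta> ^ (m + j) - of_int (round (x / \<theta> ^ (m + j)))\<bar>))"
    proof (rule exI[of _ \<delta>], rule exI[of _ S], rule exI[of _ "\<bar>1 / \<kappa>\<bar> * (\<Sum>k<d. \<bar>q k\<bar>)"],
        rule exI[of _ d], intro conjI allI)
      show "0 < \<delta>" "\<delta> \<le> 1/2" using \<open>S \<ge> 0\<close> by (auto simp: \<delta>_def field_simps)
      fix x :: real
      define \<epsilon> where "\<epsilon> k = x / \<theta> ^ k - of_int (round (x / \<theta> ^ k))" for k
      have \<epsilon>: "\<bar>\<epsilon> k\<bar> \<le> 1/2" for k unfolding \<epsilon>_def by (rule half)
      have \<epsilon>1: "\<bar>\<epsilon> k\<bar> \<le> 1" for k using \<epsilon>[of k] by linarith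
      obtain s where s: "\<And>n. of_int (coeff s n) = - (\<Sum>j\<le>d. of_int (c j) * \<epsilon> (n + j))"
        and xs: "x - 1 / \<kappa> * poly (map_poly of_int s) \<theta> = 1 / \<kappa> * (\<Sum>k<d. q k * \<epsilon> k)"
        using representation[of x] unfolding \<epsilon>_def by blast
      have bound: "\<bar>real_of_int (coeff s n)\<bar> \<le> of_int S * e" if "\<And>j. j \<le> d \<Longrightarrow> \<bar>\<epsilon> (n + j)\<bar> \<le> e" for n e
      proof -
        have "\<bar>real_of_int (coeff s n)\<bar> \<le> (\<Sum>j\<le>d. \<bar>of_int (c j) * \<epsilon> (n + j)\<bar>)"
          unfolding s abs_minus_cancel by (rule sum_abs)
        also have "\<dots> \<le> (\<Sum>j\<le>d. \<bar>of_int (c j)\<bar> * e)"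
          using that by (intro sum_mono) (auto simp: abs_mult intro!: mult_left_mono)
        finally show ?thesis by (simp add: S_def sum_distrib_right)
      qed
      show "\<exists>s. (\<forall>m. \<bar>coeff s m\<bar> \<le> S) \<and> \<bar>x - ev s\<bar> \<le> \<bar>1 / \<kappa>\<bar> * (\<Sum>k<d. \<bar>q k\<bar>) \<and>
        (\<forall>m\<in>supp s. \<exists>j\<le>d. \<delta> \<le> \<bar>x / \<theta> ^ (m + j) - of_int (round (x / \<theta> ^ (m + j)))\<bar>)"
      proof (intro exI[of _ s] conjI allI ballI)
        fix n
        have "\<bar>real_of_int (coeff s n)\<bar> \<le> of_int S * 1" using \<epsilon>1 by (intro bound)
        then show "\<bar>coeff s n\<bar> \<le> S" by linarith
      next
        have "\<bar>\<Sum>k<d. q k * \<epsilon> k\<bar> \<le> (\<Sum>k<d. \<bar>q k\<bar>)"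
        proof (rule order_trans[OF sum_abs sum_mono])
          fix k show "\<bar>q k * \<epsilon> k\<bar> \<le> \<bar>q k\<bar>"
            unfolding abs_mult using \<epsilon>[of k] by (intro mult_left_le) auto
        qed
        then show "\<bar>x - ev s\<bar> \<le> \<bar>1 / \<kappa>\<bar> * (\<Sum>k<d. \<bar>q k\<bar>)"
          unfolding ev_def xs abs_mult by (intro mult_left_mono) auto
      next
        fix n assume n: "n \<in> supp s"
        show "\<exists>j\<le>d. \<delta> \<le> \<bar>x / \<theta> ^ (n + j) - of_int (round (x / \<theta> ^ (n + j)))\<bar>"
        proof (rule ccontr)
          assume "\<not> ?thesis"
          then have "\<bar>\<epsilon> (n + j)\<bar> \<le> \<delta>" if "j \<le> d" for j
            using that unfolding \<epsilon>_def by (meson less_imp_le not_le)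
          then have "\<bar>real_of_int (coeff s n)\<bar> \<le> of_int S * \<delta>" by (rule bound)
          also have "\<dots> < 1" using \<open>S \<ge> 0\<close> by (simp add: \<delta>_def field_simps)
          finally have "coeff s n = 0" by linarith
          then show False using n by (simp add: supp_def)
        qed
      qed
    qed
  qed
  then show ?thesis by blast
qed

end

lemma pisot_imp_pisot_system:
  assumes "pisot \<theta>"
  shows "\<exists>\<gamma> \<rho> A. pisot_system \<theta> \<gamma> \<rho> A"
proof -
  have gt1: "\<theta> > 1" using assms by (simp add: pisot_def)
  obtain m :: "int poly" where m_monic: "lead_coeff m = 1" and mp: "minimal_poly (map_poly of_int m) \<theta>"
    and conj: "\<And>z. poly (map_poly of_int m) (z :: complex) = 0 \<Longrightarrow> z \<noteq> of_real \<theta> \<Longrightarrow> norm z < 1"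
    using pisot_minimal_poly[OF assms] by blast
  interpret minimal_poly "map_poly of_int m" \<theta> by (rule mp)
  have "poly (map_poly of_int m) \<theta> = 0"
    using root by (simp add: rat_eval_def map_poly_of_rat_of_int)
  then obtain Q where Q: "map_poly of_int m = [:- \<theta>, 1:] * Q"
    by (auto simp: poly_eq_0_iff_dvd dvd_def)
  \<comment> \<open>A zero of the reversed Q in the closed unit disc would be nonzero, and its
    inverse a root of m of modulus at least 1, hence \<theta> itself. Simplicity of the root
    \<theta> rules this out.\<close>
  have simple: "poly Q \<theta> \<noteq> 0"
  proof
    assume "poly Q \<theta> = 0"
    then have "poly (pderiv (map_poly of_int m)) \<theta> = 0"
      unfolding Q pderiv_mult by (simp add: pderiv_pCons)
    moreover have "map_poly of_rat (pderiv (map_poly of_int m :: rat poly)) = pderiv (map_poly real_of_int m)"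
      by (rule poly_eqI) (simp add: coeff_map_poly coeff_pderiv of_rat_mult of_rat_add)
    ultimately have "rat_eval (pderiv (map_poly of_int m)) \<theta> = 0" by (simp add: rat_eval_def)
    then have "pderiv (map_poly of_int m :: rat poly) = 0"
      by (rule minimal) (use degree_pos in \<open>simp add: degree_pderiv\<close>)
    then show False using degree_pos by (simp add: pderiv_eq_0_iff)
  qed
  interpret pisot_poly \<theta> m Q
  proof
    fix z :: complex assume z: "norm z \<le> 1"
    define Qc where "Qc = (map_poly of_real Q :: complex poly)"
    have "Q \<noteq> 0" using simple by auto
    then have Qc: "Qc \<noteq> 0" by (auto simp: Qc_def poly_eq_iff coeff_map_poly)
    show "poly (reflect_poly (map_poly of_real Q)) z \<noteq> 0"
    proof (cases "z = 0")
      case True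
      then show ?thesis using Qc by (simp add: Qc_def)
    next
      case False
      have "poly Qc (inverse z) \<noteq> 0"
      proof
        assume 0: "poly Qc (inverse z) = 0"
        have "map_poly of_real (map_poly real_of_int m) = (map_poly of_int m :: complex poly)"
          by (rule poly_eqI) (simp add: coeff_map_poly)
        then have "map_poly of_int m = map_poly complex_of_real ([:- \<theta>, 1:] * Q)"
          unfolding Q by (rule sym)
        also have "\<dots> = map_poly of_real [:- \<theta>, 1:] * Qc"
          unfolding Qc_def by (rule map_poly_hom_mult) auto
        finally have "map_poly of_int m = map_poly of_real [:- \<theta>, 1:] * Qc" .
        then have "poly (map_poly of_int m) (inverse z) = 0" using 0 by simp
        moreover have "\<not> norm (inverse z) < 1"
          using z False by (auto simp: norm_inverse not_less intro!: one_le_inverse)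
        ultimately have "inverse z = of_real \<theta>" using conj by blast
        then show False using 0 simple poly_of_real_map[of Q \<theta>] by (simp add: Qc_def)
      qed
      then show ?thesis using False by (simp add: poly_reflect_poly_nz Qc_def)
    qed
  qed (rule gt1, rule m_monic, rule Q)
  show ?thesis by (rule ex_pisot_system)
qed

section \<open>Nonvanishing\<close>

lemma int_tendsto_0_imp_eventually_0:
  assumes "(\<lambda>n. real_of_int (a n)) \<longlonglongrightarrow> 0"
  shows "\<forall>\<^sub>F n in sequentially. a n = 0"
proof -
  have "\<forall>\<^sub>F n in sequentially. \<bar>real_of_int (a n)\<bar> < 1"
    using assms by (intro order_tendstoD(2)[OF tendsto_rabs_zero]) auto
  then show ?thesis by eventually_elim linarith
qed

lemma cos_pi_eq_0D:
  assumes "cos (pi * y) = 0"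
  obtains o' :: int where "odd o'" "2 * y = of_int o'"
proof -
  from assms obtain i where i: "odd i" "pi * y = of_int i * (pi / 2)"
    unfolding cos_zero_iff_int by blast
  then have "pi * (2 * y) = pi * of_int i" by simp
  then have "2 * y = of_int i" by (simp only: mult_cancel_left) simp
  with i(1) show ?thesis by (rule that)
qed

context concentrated
begin

text \<open>Let \<delta>_n be the difference of \<gamma> \<theta>^n and its integer approximation
  b_n. If \<theta>^k = p / q, then q \<delta>_(n+k) - p \<delta>_n is an integer tending to 0, hence
  eventually 0, and \<delta> is multiplied by \<theta>^k > 1 at every k-th step. As \<delta> tends
  to 0, it vanishes from some point on, and \<theta> is a quotient of two integers b_n.\<close>

lemma power_rational_imp_rational:
  assumes k: "k > 0" and rat: "\<theta> ^ k \<in> \<rat>"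
  shows "\<theta> \<in> \<rat>"
proof -
  obtain p q :: int where pq: "\<theta> ^ k = of_int p / of_int q" "q \<noteq> 0"
    using rat by (auto elim!: Rats_cases')
  have "\<exists>b. \<forall>n. pi * \<bar>\<gamma> * \<theta> ^ n - of_int (b n)\<bar> \<le> A * \<rho> ^ (2 * n)"
    using near_int[of _ 0] by (intro choice) (simp add: nat_dist_def)
  then obtain b :: "nat \<Rightarrow> int" where b: "\<And>n. pi * \<bar>\<gamma> * \<theta> ^ n - of_int (b n)\<bar> \<le> A * \<rho> ^ (2 * n)" by blast
  define \<delta> where "\<delta> n = \<gamma> * \<theta> ^ n - of_int (b n)" for n
  have \<delta>: "\<delta> \<longlonglongrightarrow> 0"
  proof (rule Lim_null_comparison)
    have "\<bar>\<delta> n\<bar> \<le> A / pi * (\<rho>\<^sup>2) ^ n" for n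
      using b[of n] unfolding power_mult[symmetric] by (simp add: \<delta>_def field_simps)
    then show "\<forall>\<^sub>F n in sequentially. norm (\<delta> n) \<le> A / pi * (\<rho>\<^sup>2) ^ n" by simp
    show "(\<lambda>n. A / pi * (\<rho>\<^sup>2) ^ n) \<longlonglongrightarrow> 0"
      using \<rho>_pos \<rho>_less_1 by (intro tendsto_mult_right_zero LIMSEQ_power_zero) (simp add: power_less_one_iff)
  qed
  have comb: "of_int q * \<delta> (n + k) - of_int p * \<delta> n = of_int (p * b n - q * b (n + k))" for n
    using pq by (simp add: \<delta>_def power_add algebra_simps)
  have "(\<lambda>n. of_int q * \<delta> (n + k) - of_int p * \<delta> n) \<longlonglongrightarrow> of_int q * 0 - of_int p * 0"
    by (intro tendsto_intros LIMSEQ_ignore_initial_segment \<delta>)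
  then have "\<forall>\<^sub>F n in sequentially. p * b n - q * b (n + k) = 0"
    unfolding comb by (intro int_tendsto_0_imp_eventually_0) simp
  then obtain N where N: "\<And>n. n \<ge> N \<Longrightarrow> p * b n - q * b (n + k) = 0"
    by (auto simp: eventually_sequentially)
  have step: "\<delta> (n + k) = \<theta> ^ k * \<delta> n" if "n \<ge> N" for n
  proof -
    have "of_int q * \<delta> (n + k) - of_int p * \<delta> n = 0" unfolding comb N[OF that] by simp
    then have "\<delta> (n + k) = of_int p / of_int q * \<delta> n" using pq(2) by (simp add: field_simps)
    then show ?thesis unfolding pq(1) .
  qed
  have "\<delta> n = 0" if n: "n \<ge> N" for n
  proof -
    have pow: "\<delta> (n + j * k) = (\<theta> ^ k) ^ j * \<delta> n" for j
      using n by (induction j) (simp_all add: step add.assoc[symmetric] add.commute[of k])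
    have "\<bar>\<delta> n\<bar> \<le> \<bar>\<delta> (n + j * k)\<bar>" for j
    proof -
      have "1 \<le> (\<theta> ^ k) ^ j" using gt1 by (intro one_le_power) auto
      then show ?thesis
        unfolding pow abs_mult using mult_right_mono[of 1 "\<bar>(\<theta> ^ k) ^ j\<bar>" "\<bar>\<delta> n\<bar>"] by simp
    qed
    moreover have "(\<lambda>j. \<bar>\<delta> (n + j * k)\<bar>) \<longlonglongrightarrow> 0"
    proof -
      have "strict_mono (\<lambda>j. n + j * k)" using k by (auto intro!: strict_monoI)
      from LIMSEQ_subseq_LIMSEQ[OF tendsto_rabs_zero[OF \<delta>] this] show ?thesis by (simp add: o_def)
    qed
    ultimately have "\<bar>\<delta> n\<bar> \<le> 0" by (intro LIMSEQ_le_const) auto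
    then show ?thesis by simp
  qed
  then have eq: "\<gamma> * \<theta> ^ n = of_int (b n)" if "n \<ge> N" for n using that by (simp add: \<delta>_def)
  have "\<theta> = of_int (b (Suc N)) / of_int (b N)"
    using \<gamma>_nonzero gt1 by (simp add: eq[symmetric])
  then show ?thesis by simp
qed

end

text \<open>The multipliers 2^t suffice. If they all fail, comparison of the zeros for 1 and for 2^t
  gives 2^t o1 = o2 N^j with o1, o2 odd and j > 0. The case t = 1 shows N = 2u with u odd. Counting
  powers of 2 then gives j = t and o1 = o2 u^t for every t > 0, which is impossible for large t
  because u is at least 3. For N = 2 one has u = 1 and the argument breaks down.\<close>

lemma nonvanishing_integer:
  fixes N :: int and \<zeta> :: real
  assumes N: "N \<ge> 3"
  shows "\<exists>g::nat. g > 0 \<and> (\<forall>i k. cos (pi * (of_nat g * \<zeta> * of_int N ^ i / of_int N ^ k)) \<noteq> 0)"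
proof (rule ccontr)
  assume neg: "\<not> ?thesis"
  have ex: "\<exists>i k o'. odd o' \<and> 2 * (of_nat g * \<zeta> * of_int N ^ i / of_int N ^ k) = of_int o'" if "g > 0" for g :: nat
  proof -
    from neg that obtain i k where "cos (pi * (of_nat g * \<zeta> * of_int N ^ i / of_int N ^ k)) = 0" by blast
    then show ?thesis by (elim cos_pi_eq_0D) blast
  qed
  obtain i k o1 where o1: "odd o1" "2 * (\<zeta> * of_int N ^ i / of_int N ^ k) = of_int o1"
    using ex[of 1] by auto
  have key: "\<exists>a b o2. odd o2 \<and> 2 ^ t * o1 * N ^ a = o2 * N ^ b" for t
  proof -
    obtain i' k' o2 where o2: "odd o2" "2 * (of_nat (2 ^ t) * \<zeta> * of_int N ^ i' / of_int N ^ k') = of_int o2"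
      using ex[of "2 ^ t"] by auto
    have "of_int (2 ^ t * o1 * N ^ (k + i')) = (of_int (o2 * N ^ (i + k')) :: real)"
    proof -
      have \<zeta>1: "2 * \<zeta> * of_int N ^ i = of_int o1 * of_int N ^ k" using o1(2) N by (simp add: field_simps)
      have \<zeta>2: "2 ^ t * (2 * \<zeta>) * of_int N ^ i' = of_int o2 * of_int N ^ k'" using o2(2) N by (simp add: field_simps)
      have "real_of_int (2 ^ t * o1 * N ^ (k + i')) = 2 ^ t * of_int N ^ i' * (of_int o1 * of_int N ^ k)"
        by (simp add: power_add mult_ac)
      also have "\<dots> = (2 ^ t * (2 * \<zeta>) * of_int N ^ i') * of_int N ^ i"
        unfolding \<zeta>1[symmetric] by (simp add: mult_ac)
      also have "\<dots> = of_int (o2 * N ^ (i + k'))" unfolding \<zeta>2 by (simp add: power_add mult_ac)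
      finally show ?thesis .
    qed
    then have "2 ^ t * o1 * N ^ (k + i') = o2 * N ^ (i + k')" by (simp only: of_int_eq_iff)
    with o2(1) show ?thesis by blast
  qed
  have key': "\<exists>j>0. \<exists>o2. odd o2 \<and> 2 ^ t * o1 = o2 * N ^ j" if t: "t > 0" for t
  proof -
    obtain a b o2 where o2: "odd o2" "2 ^ t * o1 * N ^ a = o2 * N ^ b" using key by blast
    show ?thesis
    proof (cases "a < b")
      case True
      then have "N ^ b = N ^ (b - a) * N ^ a" by (simp add: power_add[symmetric])
      then have "2 ^ t * o1 = o2 * N ^ (b - a)" using o2(2) N by simp
      then show ?thesis using o2(1) True by (intro exI[of _ "b - a"]) auto
    next
      case False
      then have "N ^ a = N ^ (a - b) * N ^ b" by (simp add: power_add[symmetric])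
      then have "2 ^ t * o1 * N ^ (a - b) = o2" using o2(2) N by simp
      then have "even o2" using t by (metis dvd_mult2 dvd_power dvd_refl)
      then show ?thesis using o2(1) by simp
    qed
  qed
  have "even N"
  proof (rule ccontr)
    assume "odd N"
    obtain j o2 where "odd o2" "2 ^ 1 * o1 = o2 * N ^ j" using key'[of 1] by auto
    then show False using \<open>odd N\<close> by (metis dvd_triv_left even_mult_iff even_power power_one_right)
  qed
  then obtain u where u: "N = 2 * u" by blast
  have "odd u"
  proof
    assume "even u"
    then have "4 dvd N" using u by auto
    obtain j o2 where j: "j > 0" and o2: "odd o2" "2 ^ 1 * o1 = o2 * N ^ j" using key'[of 1] by auto
    have "N dvd N ^ j" using j by (simp add: dvd_power)
    then have "4 dvd 2 ^ 1 * o1" unfolding o2(2) using \<open>4 dvd N\<close> by (meson dvd_mult dvd_trans)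
    then have "4 dvd 2 * o1" by simp
    then show False using o1(1) by presburger
  qed
  have "u \<ge> 3" using u N \<open>odd u\<close> by presburger
  \<comment> \<open>Large enough that already 2^t exceeds |o1|.\<close>
  define t where "t = Suc (nat \<bar>o1\<bar>)"
  obtain j o2 where j: "j > 0" and o2: "odd o2" "2 ^ t * o1 = o2 * N ^ j" using key'[of t] by (auto simp: t_def)
  have eq: "2 ^ t * o1 = 2 ^ j * (o2 * u ^ j)" using o2(2) by (simp add: u power_mult_distrib mult_ac)
  have odd2: "odd (o2 * u ^ j)" using o2(1) \<open>odd u\<close> by simp
  have "j = t"
  proof (rule linorder_cases[of j t])
    assume "j < t"
    then have "(2::int) ^ t = 2 ^ j * 2 ^ (t - j)" by (simp add: power_add[symmetric])
    then have "2 ^ (t - j) * o1 = o2 * u ^ j" using eq by simp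
    moreover have "even (2 ^ (t - j) * o1)" using \<open>j < t\<close> by simp
    ultimately show ?thesis using odd2 by simp
  next
    assume "t < j"
    then have "(2::int) ^ j = 2 ^ t * 2 ^ (j - t)" by (simp add: power_add[symmetric])
    then have "o1 = 2 ^ (j - t) * (o2 * u ^ j)" using eq by simp
    moreover have "even (2 ^ (j - t) * (o2 * u ^ j))" using \<open>t < j\<close> by simp
    ultimately show ?thesis using o1(1) by simp
  qed
  then have o1_eq: "o1 = o2 * u ^ t" using eq by simp
  have "\<bar>o1\<bar> < int t" by (simp add: t_def)
  also have "int t < 2 ^ t" by (metis of_nat_less_two_power)
  also have "(2::int) ^ t \<le> u ^ t" using \<open>u \<ge> 3\<close> by (intro power_mono) auto
  also have "\<dots> \<le> \<bar>o2\<bar> * u ^ t"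
  proof -
    have "1 \<le> \<bar>o2\<bar>" using o2(1) by presburger
    then show ?thesis using \<open>u \<ge> 3\<close> mult_right_mono[of 1 "\<bar>o2\<bar>" "u ^ t"] by simp
  qed
  also have "\<dots> = \<bar>o1\<bar>" using \<open>u \<ge> 3\<close> by (simp add: o1_eq abs_mult)
  finally show False by simp
qed

context concentrated
begin

text \<open>For irrational \<theta> one of the multipliers 1 and 2 works: zeros for both give 2 o1
  \<theta>^a = o2 \<theta>^b with o1, o2 odd. If a and b differ, a positive power of \<theta> is
  rational and so is \<theta>; if they agree, o2 is even.\<close>

lemma nonvanishing:
  assumes alg: "algebraic_int \<theta>" and ne2: "\<theta> \<noteq> 2"
  shows "\<exists>g::nat. g > 0 \<and> (\<forall>i k. cos (pi * (of_nat g * \<zeta> * \<theta> ^ i / \<theta> ^ k)) \<noteq> 0)"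
proof (cases "\<theta> \<in> \<rat>")
  case True
  then have "\<theta> \<in> \<int>" using rational_algebraic_int_is_int[OF alg] by blast
  then obtain N where N: "\<theta> = of_int N" by (auto elim: Ints_cases)
  then have "N > 1" "N \<noteq> 2" using gt1 ne2 by auto
  then show ?thesis unfolding N by (intro nonvanishing_integer) auto
next
  case False
  show ?thesis
  proof (rule ccontr)
    assume neg: "\<not> ?thesis"
    have ex: "\<exists>i k o'. odd o' \<and> 2 * (of_nat g * \<zeta> * \<theta> ^ i / \<theta> ^ k) = of_int o'" if "g > 0" for g :: nat
    proof -
      from neg that obtain i k where "cos (pi * (of_nat g * \<zeta> * \<theta> ^ i / \<theta> ^ k)) = 0" by blast
      then show ?thesis by (elim cos_pi_eq_0D) blast
    qed
    obtain i k o1 where o1: "odd o1" "2 * (\<zeta> * \<theta> ^ i / \<theta> ^ k) = of_int o1" using ex[of 1] by auto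
    obtain i' k' o2 where o2: "odd o2" "2 * (2 * \<zeta> * \<theta> ^ i' / \<theta> ^ k') = of_int o2" using ex[of 2] by auto
    have z1: "2 * \<zeta> * \<theta> ^ i = of_int o1 * \<theta> ^ k" using o1(2) gt1 by (simp add: field_simps)
    have z2: "2 * (2 * \<zeta>) * \<theta> ^ i' = of_int o2 * \<theta> ^ k'" using o2(2) gt1 by (simp add: field_simps)
    have "2 * of_int o1 * \<theta> ^ (k + i') = 2 * \<theta> ^ i' * (of_int o1 * \<theta> ^ k)"
      by (simp add: power_add mult_ac)
    also have "\<dots> = (2 * (2 * \<zeta>) * \<theta> ^ i') * \<theta> ^ i" unfolding z1[symmetric] by (simp add: mult_ac)
    also have "\<dots> = of_int o2 * \<theta> ^ (i + k')" unfolding z2 by (simp add: power_add mult_ac)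
    finally have eq: "2 * of_int o1 * \<theta> ^ (k + i') = of_int o2 * \<theta> ^ (i + k')" .
    have ne: "o1 \<noteq> 0" "o2 \<noteq> 0" using o1(1) o2(1) by auto
    show False
    proof (rule linorder_cases[of "k + i'" "i + k'"])
      assume lt: "k + i' < i + k'"
      then have "\<theta> ^ (i + k') = \<theta> ^ (i + k' - (k + i')) * \<theta> ^ (k + i')" by (simp add: power_add[symmetric])
      then have "\<theta> ^ (i + k' - (k + i')) = 2 * of_int o1 / of_int o2" using eq gt1 ne by (simp add: field_simps)
      then have "\<theta> ^ (i + k' - (k + i')) \<in> \<rat>" by simp
      then show False using power_rational_imp_rational[of "i + k' - (k + i')"] lt False by simp
    next
      assume lt: "i + k' < k + i'"
      then have "\<theta> ^ (k + i') = \<theta> ^ (k + i' - (i + k')) * \<theta> ^ (i + k')" by (simp add: power_add[symmetric])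
      then have "\<theta> ^ (k + i' - (i + k')) = of_int o2 / (2 * of_int o1)" using eq gt1 ne by (simp add: field_simps)
      then have "\<theta> ^ (k + i' - (i + k')) \<in> \<rat>" by simp
      then show False using power_rational_imp_rational[of "k + i' - (i + k')"] lt False by simp
    next
      assume "k + i' = i + k'"
      then have "2 * of_int o1 = real_of_int o2" using eq gt1 by simp
      then have "2 * o1 = o2" by linarith
      then show False using o2(1) by auto
    qed
  qed
qed

text \<open>The quotients of consecutive terms are |cos(pi \<theta>^i ev s)| with i > 0. They tend
  to 1 exponentially fast because \<theta>^i ev s approaches the integers, and none of them
  vanishes, so the infinite product is positive.\<close>

lemma f_ev_power_limit:
  assumes nz: "\<And>i k. cos (pi * (ev s * \<theta> ^ i / \<theta> ^ k)) \<noteq> 0"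
  obtains V where "V > 0" "(\<lambda>n. \<bar>f (\<theta> ^ n * ev s)\<bar>) \<longlonglongrightarrow> V"
proof -
  define a where "a i = \<bar>cos (pi * (\<theta> ^ Suc i * ev s))\<bar>" for i
  obtain B where B: "\<And>m. \<bar>coeff s m\<bar> \<le> B"
  proof
    fix m show "\<bar>coeff s m\<bar> \<le> (\<Sum>i\<le>degree s. \<bar>coeff s i\<bar>)"
      by (cases "m \<le> degree s") (auto intro: member_le_sum simp: coeff_eq_0 not_le sum_nonneg)
  qed
  have sin_le: "\<bar>sin (pi * (\<theta> ^ i * ev s))\<bar> \<le> of_int B * A * card (supp s) * (\<rho>\<^sup>2) ^ i" for i
  proof -
    have "conc (of_int B * A) (supp (monom 1 i * s)) (ev (monom 1 i * s))"
      using B order_trans[OF abs_ge_zero B] by (intro conc_ev) (auto simp: coeff_monom_mult)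
    then have "\<bar>sin (pi * (\<theta> ^ i * ev s) / \<theta> ^ 0)\<bar>
        \<le> of_int B * A * (\<Sum>m\<in>supp (monom 1 i * s). \<rho> ^ (2 * nat_dist m 0))" and U: "of_int B * A \<ge> 0"
      unfolding conc_def ev_monom_mult by blast+
    then have "\<bar>sin (pi * (\<theta> ^ i * ev s))\<bar> \<le> of_int B * A * (\<Sum>m\<in>supp (monom 1 i * s). \<rho> ^ (2 * nat_dist m 0))"
      by simp
    also have "\<dots> \<le> of_int B * A * (\<Sum>m\<in>supp (monom 1 i * s). (\<rho>\<^sup>2) ^ i)"
      using U \<rho>_pos \<rho>_less_1 unfolding power_mult[symmetric]
      by (intro mult_left_mono sum_mono power_decreasing) (auto simp: supp_monom_mult nat_dist_def)
    also have "\<dots> = of_int B * A * card (supp s) * (\<rho>\<^sup>2) ^ i"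
      by (simp add: supp_monom_mult card_image)
    finally show ?thesis .
  qed
  have "summable (\<lambda>i. of_int B * A * card (supp s) * (\<rho>\<^sup>2) ^ Suc i)"
    using \<rho>_pos \<rho>_less_1 by (intro summable_mult summable_Suc_iff[THEN iffD2] summable_geometric) (simp add: power_less_one_iff)
  moreover have "norm (norm (a i - 1)) \<le> of_int B * A * card (supp s) * (\<rho>\<^sup>2) ^ Suc i" for i
  proof -
    define u where "u = pi * (\<theta> ^ Suc i * ev s)"
    have "\<bar>cos u\<bar> * \<bar>cos u\<bar> \<le> \<bar>cos u\<bar> * 1" by (intro mult_left_mono) auto
    then have "1 - \<bar>cos u\<bar> \<le> 1 - \<bar>cos u\<bar> * \<bar>cos u\<bar>" by linarith
    also have "\<dots> = \<bar>sin u\<bar> * \<bar>sin u\<bar>"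
      using sin_cos_squared_add[of u] by (simp add: power2_eq_square abs_mult[symmetric])
    also have "\<dots> \<le> \<bar>sin u\<bar> * 1" by (intro mult_left_mono) auto
    also have "\<dots> = \<bar>sin u\<bar>" by simp
    finally have "norm (norm (a i - 1)) \<le> \<bar>sin u\<bar>" unfolding a_def u_def[symmetric] by (simp add: abs_minus_commute)
    then show ?thesis using sin_le[of "Suc i"] by (simp add: u_def)
  qed
  ultimately have "summable (\<lambda>i. norm (a i - 1))" by (rule summable_comparison_test'[where N = 0])
  then have conv: "convergent_prod a"
    by (intro abs_convergent_prod_imp_convergent_prod) (simp add: abs_convergent_prod_conv_summable)
  have a_pos: "a i > 0" for i using nz[of "Suc i" 0] by (simp add: a_def mult.commute)
  have "(\<lambda>n. \<Prod>i<n. a i) \<longlonglongrightarrow> prodinf a"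
    by (intro has_prod_imp_tendsto' convergent_prod_has_prod conv)
  then have lim: "(\<lambda>n. (\<Prod>i<n. a i) * \<bar>f (ev s)\<bar>) \<longlonglongrightarrow> prodinf a * \<bar>f (ev s)\<bar>"
    by (intro tendsto_intros)
  have f_eq: "\<bar>f (\<theta> ^ n * ev s)\<bar> = (\<Prod>i<n. a i) * \<bar>f (ev s)\<bar>" for n
  proof (induction n)
    case (Suc n)
    have "\<bar>f (\<theta> ^ Suc n * ev s)\<bar> = a n * \<bar>f (\<theta> ^ n * ev s)\<bar>"
      using f_times_theta[of "\<theta> ^ n * ev s"] by (simp add: a_def abs_mult mult.assoc)
    then show ?case using Suc by simp
  qed simp
  show ?thesis
  proof (rule that)
    show "(\<lambda>n. \<bar>f (\<theta> ^ n * ev s)\<bar>) \<longlonglongrightarrow> prodinf a * \<bar>f (ev s)\<bar>" unfolding f_eq by (rule lim)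
    have "prodinf a \<noteq> 0" using prodinf_nonzero[OF conv] a_pos by (metis less_irrefl)
    moreover have "prodinf a \<ge> 0"
      by (rule LIMSEQ_le_const[OF \<open>(\<lambda>n. \<Prod>i<n. a i) \<longlonglongrightarrow> prodinf a\<close>]) (auto intro!: prod_nonneg less_imp_le[OF a_pos])
    moreover have "f (ev s) \<noteq> 0" unfolding f_nonzero_iff using nz[of 0] by simp
    ultimately show "prodinf a * \<bar>f (ev s)\<bar> > 0" by simp
  qed
qed

lemma abs_f_less_one: "\<bar>f x\<bar> < 1" if "x \<noteq> 0"
proof -
  have "(\<lambda>k. x * (1 / \<theta>) ^ k) \<longlonglongrightarrow> 0"
    using gt1 by (intro tendsto_mult_right_zero LIMSEQ_power_zero) auto
  then have "\<forall>\<^sub>F k in sequentially. \<bar>x * (1 / \<theta>) ^ k\<bar> < 1"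
    by (intro order_tendstoD(2)[OF tendsto_rabs_zero]) auto
  then obtain k where k: "\<bar>x / \<theta> ^ k\<bar> < 1" by (auto simp: eventually_sequentially power_one_over)
  define u where "u = x / \<theta> ^ k"
  have u: "\<bar>u\<bar> < 1" "u \<noteq> 0" using k that gt1 by (simp_all add: u_def)
  have "sin (pi * u) \<noteq> 0"
  proof
    assume "sin (pi * u) = 0"
    then have "u \<in> \<int>" using sin_times_pi_eq_0[of u] by (simp add: mult.commute)
    then show False using u by (auto elim!: Ints_cases)
  qed
  then have "(cos (pi * u))\<^sup>2 < 1" using sin_cos_squared_add[of "pi * u"] zero_less_power2[of "sin (pi * u)"] by linarith
  then have "\<bar>cos (pi * u)\<bar> < 1" by (simp add: abs_square_less_1)
  then show ?thesis using abs_f_le_abs_prod_cos[of "{k}" x] by (simp add: u_def)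
qed

end

section \<open>The arithmetic case\<close>

lemma euclidean_derived_set_of: "euclidean derived_set_of S = {x :: real. x islimpt S}"
  by (auto simp: derived_set_of_def islimpt_def)

lemma islimpt_abs_imageE:
  fixes E :: "real set"
  assumes bdd: "bounded E" and y: "y islimpt (abs ` E)"
  obtains e where "e islimpt E" "\<bar>e\<bar> = y"
proof -
  obtain a where a: "\<And>n. a n \<in> abs ` E - {y}" and lim: "a \<longlonglongrightarrow> y"
    using y unfolding islimpt_sequential by blast
  have "\<forall>n. \<exists>e. e \<in> E \<and> a n = \<bar>e\<bar>" using a by blast
  then obtain e where e: "\<And>n. e n \<in> E" "\<And>n. a n = \<bar>e n\<bar>" by metis
  have "bounded (range e)" using e(1) by (intro bounded_subset[OF bdd]) auto
  then obtain l \<phi> where \<phi>: "strict_mono \<phi>" and l: "(e \<circ> \<phi>) \<longlonglongrightarrow> l"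
    using bounded_imp_convergent_subsequence by blast
  have "\<bar>l\<bar> = y"
  proof (rule LIMSEQ_unique)
    show "(\<lambda>n. \<bar>e (\<phi> n)\<bar>) \<longlonglongrightarrow> \<bar>l\<bar>" using tendsto_rabs[OF l] by (simp add: o_def)
    show "(\<lambda>n. \<bar>e (\<phi> n)\<bar>) \<longlonglongrightarrow> y" using LIMSEQ_subseq_LIMSEQ[OF lim \<phi>] by (simp add: o_def e(2))
  qed
  moreover have "(e \<circ> \<phi>) n \<in> E - {l}" for n using e a[of "\<phi> n"] \<open>\<bar>l\<bar> = y\<close> by auto
  then have "l islimpt E" unfolding islimpt_sequential using l by blast
  ultimately show ?thesis using that by blast
qed

lemma eventually_eq_if_not_islimpt:
  fixes v :: "'a :: metric_space"
  assumes "a \<longlonglongrightarrow> v" "\<And>n. a n \<in> S" "\<not> v islimpt S"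
  shows "\<forall>\<^sub>F n in sequentially. a n = v"
proof -
  obtain e where e: "e > 0" "\<And>y. y \<in> S \<Longrightarrow> y \<noteq> v \<Longrightarrow> \<not> dist y v < e"
    using assms(3) unfolding islimpt_approachable by blast
  have "\<forall>\<^sub>F n in sequentially. dist (a n) v < e" using assms(1) e(1) by (rule tendstoD)
  then show ?thesis by eventually_elim (use e(2) assms(2) in blast)
qed

text \<open>The values of rational polynomials at an algebraic number form a field, by
  \<open>minimal_poly.inverse\<close>. The applications take both \<theta> and 1 / \<theta> for
  \<omega>.\<close>

lemma rat_adjoin_subset:
  assumes "minimal_poly q \<omega>" and \<theta>: "\<theta> = rat_eval p\<^sub>0 \<omega>" and "x \<in> rat_adjoin \<theta>"
  shows "\<exists>p. x = rat_eval p \<omega>"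
  using assms(3)
proof induction
  case base
  then show ?case using \<theta> by blast
next
  case (rat c)
  have "of_rat c = rat_eval [:c:] \<omega>" by simp
  then show ?case by blast
next
  case (diff x y)
  then show ?case by (metis rat_eval_diff)
next
  case (mult x y)
  then show ?case by (metis rat_eval_simps(2))
next
  case (inverse x)
  then obtain p where p: "x = rat_eval p \<omega>" by blast
  interpret minimal_poly q \<omega> by fact
  obtain s where "rat_eval p \<omega> * rat_eval s \<omega> = 1" using inverse inverse.hyps p by (metis minimal_poly.inverse assms(1))
  then have "Fields.inverse x = rat_eval s \<omega>" using p by (simp add: inverse_unique)
  then show ?case by blast
qed

lemma int_multiple_rat_eval:
  "\<exists>D h. D > 0 \<and> of_int D * rat_eval p \<omega> = poly (map_poly of_int h) (\<omega> :: real)"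
proof -
  obtain D h where D: "D > 0" "map_poly of_int h = smult (of_int D) p"
    using clear_denominators by blast
  have "poly (map_poly of_int h) \<omega> = rat_eval (map_poly of_int h) \<omega>"
    by (simp add: rat_eval_def map_poly_of_rat_of_int)
  also have "\<dots> = rat_eval ([:of_int D:] * p) \<omega>" using D by simp
  also have "\<dots> = of_int D * rat_eval p \<omega>" unfolding rat_eval_simps by simp
  finally show ?thesis using D(1) by metis
qed

lemma algebraic_int_minimal_polys:
  assumes "algebraic_int (\<theta> :: real)" "\<theta> \<noteq> 0"
  shows "\<exists>q. minimal_poly q \<theta>" "\<exists>q. minimal_poly q (1 / \<theta>)"
proof -
  obtain p :: "int poly" where p: "poly (map_poly of_int p) \<theta> = 0" "lead_coeff p = 1"
    using assms(1) unfolding algebraic_int_altdef_ipoly by blast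
  have ne: "map_poly of_int p \<noteq> (0 :: rat poly)"
    using p(2) by (auto simp: poly_eq_iff coeff_map_poly intro!: exI[of _ "degree p"])
  have root: "rat_eval (map_poly of_int p) \<theta> = 0"
    using p(1) by (simp add: rat_eval_def map_poly_of_rat_of_int)
  then show "\<exists>q. minimal_poly q \<theta>" using ex_minimal_poly[OF ne] by blast
  have "map_poly of_rat (reflect_poly (map_poly of_int p :: rat poly)) = reflect_poly (map_poly real_of_int p)"
    by (rule poly_eqI) (simp add: coeff_reflect_poly coeff_map_poly degree_map_poly)
  then have "rat_eval (reflect_poly (map_poly of_int p)) (1 / \<theta>) = 0"
    unfolding rat_eval_def using assms(2) p(1) by (simp add: poly_reflect_poly_nz)
  then show "\<exists>q. minimal_poly q (1 / \<theta>)"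
    using ex_minimal_poly[of "reflect_poly (map_poly of_int p)" "1 / \<theta>"] ne by auto
qed

text \<open>The form in \<theta> is applied to 2r, where it turns \<gamma> D 2r into a value of
  \<open>ev\<close>. The form in 1 / \<theta> is applied to 1/(2r), where it expresses
  multiplication by D/(2r) through divisions by powers of \<theta>.\<close>

lemma rat_adjoin_int_multiple:
  assumes alg: "algebraic_int (\<theta> :: real)" and "\<theta> \<noteq> 0" and x: "x \<in> rat_adjoin \<theta>"
  shows "\<exists>D h. D > 0 \<and> of_int D * x = poly (map_poly of_int h) \<theta>"
    and "\<exists>D h. D > 0 \<and> of_int D * x = poly (map_poly of_int h) (1 / \<theta>)"
proof -
  obtain q where q: "minimal_poly q \<theta>" using algebraic_int_minimal_polys[OF assms(1,2)] by blast
  have "\<theta> = rat_eval [:0, 1:] \<theta>" by simp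
  then show "\<exists>D h. D > 0 \<and> of_int D * x = poly (map_poly of_int h) \<theta>"
    using rat_adjoin_subset[OF q _ x] int_multiple_rat_eval by metis
  obtain q' where q': "minimal_poly q' (1 / \<theta>)" using algebraic_int_minimal_polys[OF assms(1,2)] by blast
  have "rat_eval [:0, 1:] (1 / \<theta>) \<noteq> 0" using \<open>\<theta> \<noteq> 0\<close> by simp
  then obtain s where "rat_eval [:0, 1:] (1 / \<theta>) * rat_eval s (1 / \<theta>) = 1"
    using minimal_poly.inverse[OF q'] by blast
  then have "\<theta> = rat_eval s (1 / \<theta>)" using \<open>\<theta> \<noteq> 0\<close> by (simp add: field_simps)
  then show "\<exists>D h. D > 0 \<and> of_int D * x = poly (map_poly of_int h) (1 / \<theta>)"
    using rat_adjoin_subset[OF q' _ x] int_multiple_rat_eval by metis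
qed

context concentrated
begin

lemma sin_ev_tendsto_0:
  assumes s: "\<And>j. s j \<in> sparse_polys K B" and far: "\<And>M. \<forall>\<^sub>F j in sequentially. supp (s j) \<subseteq> {M..}"
  shows "(\<lambda>j. sin (pi * ev (s j) / \<theta> ^ i)) \<longlonglongrightarrow> 0"
proof (rule LIMSEQ_I)
  fix e :: real assume "e > 0"
  define c where "c = of_int B * A * real K"
  have "B \<ge> 0" using s[of 0] abs_ge_zero[of "coeff (s 0) 0"] unfolding sparse_polys_def by force
  have "(\<lambda>g. c * \<rho> ^ g) \<longlonglongrightarrow> 0"
    using \<rho>_pos \<rho>_less_1 by (intro tendsto_mult_right_zero LIMSEQ_power_zero) auto
  from order_tendstoD(2)[OF this \<open>e > 0\<close>] obtain g where g: "c * \<rho> ^ g < e"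
    by (auto simp: eventually_sequentially)
  have "\<forall>\<^sub>F j in sequentially. norm (sin (pi * ev (s j) / \<theta> ^ i) - 0) < e"
    using far[of "i + g"]
  proof eventually_elim
    case (elim j)
    have "conc (of_int B * A) (supp (s j)) (ev (s j))"
      using s[of j] by (intro conc_ev) (auto simp: sparse_polys_def)
    then have "\<bar>sin (pi * ev (s j) / \<theta> ^ i)\<bar> \<le> of_int B * A * (\<Sum>m\<in>supp (s j). \<rho> ^ (2 * nat_dist m i))"
      unfolding conc_def by blast
    also have "\<dots> \<le> of_int B * A * (\<Sum>m\<in>supp (s j). \<rho> ^ g)"
      using elim \<rho>_pos \<rho>_less_1 A_nonneg \<open>B \<ge> 0\<close>
      by (intro mult_left_mono sum_mono power_decreasing) (auto simp: nat_dist_def)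
    also have "\<dots> = of_int B * A * card (supp (s j)) * \<rho> ^ g" by simp
    also have "\<dots> \<le> c * \<rho> ^ g"
      unfolding c_def using s[of j] \<rho>_pos A_nonneg \<open>B \<ge> 0\<close>
      by (intro mult_right_mono mult_left_mono) (auto simp: sparse_polys_def)
    finally show ?case using g by simp
  qed
  then show "\<exists>no. \<forall>n\<ge>no. norm (sin (pi * ev (s n) / \<theta> ^ i) - 0) < e"
    by (simp add: eventually_sequentially)
qed

end

context pisot_system
begin

text \<open>Put \<omega> = D / (2r), an integer combination of powers of 1 / \<theta>. Then \<omega>
  x is an integer at the sample points x, and \<omega> ev(s_j) approaches the integers because each
  ev(s_j) / \<theta>^i does. In the limit \<omega> w is an integer, so w ranges over a
  lattice.\<close>

lemma countable_limit_points:
  fixes r :: real and h :: "int poly"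
  assumes r: "r > 0" and D: "D > 0" and h: "of_int D * inverse (2 * r) = poly (map_poly of_int h) (1 / \<theta>)"
  shows "countable {y. y islimpt (range (\<lambda>n :: int. f (2 * r * of_int n)))}" (is "countable {y. y islimpt ?E}")
proof -
  obtain Q where Q: "\<And>K B. countable (Q K B)"
    and limQ: "\<And>K B s y. (\<And>j. s j \<in> sparse_polys K B) \<Longrightarrow> (\<lambda>j. \<bar>f (ev (s j))\<bar>) \<longlonglongrightarrow> y \<Longrightarrow> y \<in> Q K B"
    using countable_limits_abs_f_ev by metis
  \<comment> \<open>The set is meant to contain |y| for every nonzero limit point y; the sign is
    restored by adding the negatives.\<close>
  define C where "C = (\<Union>K. \<Union>B. \<Union>k :: int. (\<lambda>v. v * \<bar>f (of_int k * (2 * r / of_int D))\<bar>) ` Q K B)"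
  have "countable C" unfolding C_def by (intro countable_UN countable_image Q) auto
  moreover have "y \<in> insert 0 (C \<union> uminus ` C)" if y: "y islimpt ?E" for y
  proof (cases "y = 0")
    case False
    obtain a where a: "\<And>j. a j \<in> ?E - {y}" and lim: "a \<longlonglongrightarrow> y"
      using y unfolding islimpt_sequential by blast
    have "\<forall>j. \<exists>n :: int. a j = f (2 * r * of_int n)" using a by blast
    then obtain n where n: "\<And>j. a j = f (2 * r * of_int (n j))" by metis
    define c where "c = \<bar>y\<bar> / 2"
    have "c > 0" using False by (simp add: c_def)
    have "\<forall>\<^sub>F j in sequentially. c < \<bar>a j\<bar>"
      using order_tendstoD(1)[OF tendsto_rabs[OF lim], of c] False by (simp add: c_def)
    then obtain N where N: "\<And>j. j \<ge> N \<Longrightarrow> c < \<bar>a j\<bar>" by (auto simp: eventually_sequentially)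
    define x where "x j = 2 * r * of_int (n (j + N))" for j
    have x: "c \<le> \<bar>f (x j)\<bar>" for j using N[of "j + N"] by (simp add: x_def n)
    obtain K B s w and \<phi> :: "nat \<Rightarrow> nat" where \<phi>: "strict_mono \<phi>" and s: "\<And>j. s j \<in> sparse_polys K B"
      and far: "\<And>M. \<forall>\<^sub>F j in sequentially. supp (s j) \<subseteq> {M..}"
      and w: "(\<lambda>j. x (\<phi> j) - ev (s j)) \<longlonglongrightarrow> w"
      and fw: "(\<lambda>j. f (x (\<phi> j)) - f (ev (s j)) * f w) \<longlonglongrightarrow> 0"
      using decomposition[of c x, OF \<open>c > 0\<close> x] by blast
    have "(\<lambda>j. f (x j)) \<longlonglongrightarrow> y"
      using LIMSEQ_ignore_initial_segment[OF lim, of N] by (simp add: x_def n)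
    from LIMSEQ_subseq_LIMSEQ[OF this \<phi>] have "(\<lambda>j. f (x (\<phi> j))) \<longlonglongrightarrow> y" by (simp add: o_def)
    from tendsto_diff[OF this fw] have prod: "(\<lambda>j. f (ev (s j)) * f w) \<longlonglongrightarrow> y" by simp
    have "f w \<noteq> 0"
    proof
      assume "f w = 0"
      with prod have "(\<lambda>_. 0) \<longlonglongrightarrow> y" by simp
      from LIMSEQ_unique[OF this tendsto_const] show False using False by simp
    qed
    have "(\<lambda>j. \<bar>f (ev (s j)) * f w\<bar> / \<bar>f w\<bar>) \<longlonglongrightarrow> \<bar>y\<bar> / \<bar>f w\<bar>"
      using \<open>f w \<noteq> 0\<close> by (intro tendsto_intros prod) auto
    then have "(\<lambda>j. \<bar>f (ev (s j))\<bar>) \<longlonglongrightarrow> \<bar>y\<bar> / \<bar>f w\<bar>" using \<open>f w \<noteq> 0\<close> by (simp add: abs_mult)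
    then have inQ: "\<bar>y\<bar> / \<bar>f w\<bar> \<in> Q K B" by (intro limQ[OF s])
    define \<omega> where "\<omega> = poly (map_poly real_of_int h) (1 / \<theta>)"
    have \<omega>: "\<omega> = of_int D / (2 * r)" 
    proof -
      have "\<omega> = of_int D * inverse (2 * r)" unfolding \<omega>_def by (rule h[symmetric])
      then show ?thesis by (simp only: divide_inverse)
    qed
    have \<omega>_sum: "\<omega> * z = (\<Sum>i\<le>degree h. of_int (coeff h i) * (z / \<theta> ^ i))" for z
      unfolding \<omega>_def poly_altdef sum_distrib_right
      by (simp add: degree_map_poly coeff_map_poly power_one_over mult_ac)
    have "(\<lambda>j. sin (pi * (\<omega> * (x (\<phi> j) - ev (s j))))) \<longlonglongrightarrow> 0"
    proof (rule Lim_null_comparison)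
      show "(\<lambda>j. \<Sum>i\<le>degree h. of_int \<bar>coeff h i\<bar> * \<bar>sin (pi * ev (s j) / \<theta> ^ i)\<bar>) \<longlonglongrightarrow> 0"
        by (intro tendsto_null_sum tendsto_mult_right_zero tendsto_rabs_zero sin_ev_tendsto_0[OF s far])
      have "\<bar>sin (pi * (\<omega> * (x (\<phi> j) - ev (s j))))\<bar>
          \<le> (\<Sum>i\<le>degree h. of_int \<bar>coeff h i\<bar> * \<bar>sin (pi * ev (s j) / \<theta> ^ i)\<bar>)" for j
      proof -
        define k where "k = D * n (\<phi> j + N)"
        have "\<omega> * x (\<phi> j) = of_int k" using r by (simp add: \<omega> x_def k_def)
        then have "\<omega> * (x (\<phi> j) - ev (s j)) = of_int k - \<omega> * ev (s j)" by (simp add: right_diff_distrib)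
        moreover have "\<bar>sin (pi * (of_int k - z))\<bar> \<le> \<bar>sin (pi * z)\<bar>" for z
          by (simp add: right_diff_distrib sin_diff sin_pi_of_int abs_mult mult_left_le_one_le)
        ultimately have "\<bar>sin (pi * (\<omega> * (x (\<phi> j) - ev (s j))))\<bar> \<le> \<bar>sin (pi * (\<omega> * ev (s j)))\<bar>" by simp
        also have "pi * (\<omega> * ev (s j)) = (\<Sum>i\<le>degree h. of_int (coeff h i) * (pi * ev (s j) / \<theta> ^ i))"
          unfolding \<omega>_sum by (simp add: sum_distrib_left mult_ac)
        also have "\<bar>sin \<dots>\<bar> \<le> (\<Sum>i\<le>degree h. \<bar>sin (of_int (coeff h i) * (pi * ev (s j) / \<theta> ^ i))\<bar>)"
          by (rule abs_sin_sum_le)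
        also have "\<dots> \<le> (\<Sum>i\<le>degree h. of_int \<bar>coeff h i\<bar> * \<bar>sin (pi * ev (s j) / \<theta> ^ i)\<bar>)"
          by (intro sum_mono abs_sin_of_int_mult_le)
        finally show ?thesis .
      qed
      then show "\<forall>\<^sub>F j in sequentially. norm (sin (pi * (\<omega> * (x (\<phi> j) - ev (s j)))))
          \<le> (\<Sum>i\<le>degree h. of_int \<bar>coeff h i\<bar> * \<bar>sin (pi * ev (s j) / \<theta> ^ i)\<bar>)" by simp
    qed
    moreover have "(\<lambda>j. sin (pi * (\<omega> * (x (\<phi> j) - ev (s j))))) \<longlonglongrightarrow> sin (pi * (\<omega> * w))"
      by (intro tendsto_intros w)
    ultimately have "sin (pi * (\<omega> * w)) = 0" by (rule LIMSEQ_unique[symmetric])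
    then have "\<omega> * w \<in> \<int>" using sin_times_pi_eq_0[of "\<omega> * w"] by (simp add: mult.commute)
    then obtain k :: int where k: "\<omega> * w = of_int k" by (auto elim: Ints_cases)
    have w_eq: "w = of_int k * (2 * r / of_int D)" using k r D by (simp add: \<omega> field_simps)
    have "\<bar>y\<bar> = \<bar>y\<bar> / \<bar>f w\<bar> * \<bar>f (of_int k * (2 * r / of_int D))\<bar>"
      using \<open>f w \<noteq> 0\<close> unfolding w_eq[symmetric] by simp
    then have "\<bar>y\<bar> \<in> C" unfolding C_def using inQ by blast
    then show ?thesis by (cases "y \<ge> 0") (auto intro!: rev_image_eqI[of "- y"])
  qed simp
  ultimately show ?thesis by - (rule countable_subset[of _ "insert 0 (C \<union> uminus ` C)"], blast, simp)
qed

text \<open>Sample points x_j close to ev(S_j) satisfy |f(x_j + t)| -> V |f(t)|. Taking t among the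
  sample points transports limit points by the factor V. If neither V nor V |f(t)| were a limit
  point for a suitable t, the values at x_j and x_j + t, x_j - t would eventually equal their
  limits, and \<open>f\<close> would be exactly multiplicative there, against
  \<open>f_add_mult_diff_less\<close>.\<close>

lemma infinite_limit_points:
  fixes r :: real and h :: "int poly"
  assumes alg: "algebraic_int \<theta>" and ne2: "\<theta> \<noteq> 2"
    and r: "r > 0" and D: "D > 0" and h: "of_int D * (2 * r) = poly (map_poly of_int h) \<theta>"
  shows "infinite {y. y islimpt (range (\<lambda>n :: int. f (2 * r * of_int n)))}" (is "infinite {y. y islimpt ?E}")
proof -
  define A' where "A' = abs ` ?E"
  obtain g :: nat where g: "g > 0" and nz: "\<And>i k. cos (pi * (of_nat g * ev h * \<theta> ^ i / \<theta> ^ k)) \<noteq> 0"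
    using nonvanishing[OF alg ne2, of "ev h"] by blast
  define s where "s = [:int g:] * h"
  have ev_s: "ev s = of_nat g * ev h"
    unfolding ev_def s_def by (subst map_poly_hom_mult) (simp_all add: map_poly_pCons)
  have ev_h: "ev h = \<gamma> * (of_int D * (2 * r))" by (simp add: ev_def h)
  have "ev s \<noteq> 0" using ev_s ev_h g \<gamma>_nonzero r D by simp
  obtain V where V: "V > 0" "(\<lambda>n. \<bar>f (\<theta> ^ n * ev s)\<bar>) \<longlonglongrightarrow> V"
    using f_ev_power_limit[of s] nz unfolding ev_s by blast
  have "V < 1"
  proof -
    have "V \<le> \<bar>f (\<theta> ^ 0 * ev s)\<bar>" by (rule decseq_ge[OF decseq_abs_f_power V(2)])
    also have "\<dots> < 1" using abs_f_less_one[OF \<open>ev s \<noteq> 0\<close>] by simp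
    finally show ?thesis .
  qed
  define S where "S j = monom 1 j * s" for j
  have ev_S: "ev (S j) = \<theta> ^ j * ev s" for j by (simp add: S_def ev_monom_mult)
  define K B where "K = card (supp s)" and "B = (\<Sum>i\<le>degree s. \<bar>coeff s i\<bar>)"
  have "\<bar>coeff s m\<bar> \<le> B" for m
    by (cases "m \<le> degree s") (auto intro: member_le_sum simp: coeff_eq_0 not_le sum_nonneg B_def)
  then have S: "S j \<in> sparse_polys K B" for j
    unfolding S_def by (intro sparse_polys_monom_mult) (simp add: sparse_polys_def K_def)
  have far: "\<forall>\<^sub>F j in sequentially. supp (S j) \<subseteq> {M..}" for M
    using eventually_ge_at_top[of M] by eventually_elim (auto simp: S_def supp_monom_mult)
  have "\<exists>b. \<forall>n. pi * \<bar>\<gamma> * \<theta> ^ n - of_int (b n)\<bar> \<le> A * \<rho> ^ (2 * n)"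
    using near_int[of _ 0] by (intro choice) (simp add: nat_dist_def)
  then obtain b :: "nat \<Rightarrow> int" where b: "\<And>n. pi * \<bar>\<gamma> * \<theta> ^ n - of_int (b n)\<bar> \<le> A * \<rho> ^ (2 * n)" by blast
  \<comment> \<open>Replacing \<gamma> \<theta>^j in \<open>ev (S j)\<close> by its integer
    approximation \<open>b j\<close> gives a multiple of 2r at exponentially small distance.\<close>
  define x where "x j = 2 * r * of_int (int g * D * b j)" for j
  have x_S: "(\<lambda>j. x j - ev (S j)) \<longlonglongrightarrow> 0"
  proof (rule Lim_null_comparison)
    define c where "c = 2 * r * of_nat g * of_int D"
    have "\<bar>x j - ev (S j)\<bar> \<le> c * (A / pi * (\<rho>\<^sup>2) ^ j)" for j
    proof -
      have "x j - ev (S j) = c * (of_int (b j) - \<gamma> * \<theta> ^ j)"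
        by (simp add: x_def ev_S ev_s ev_h c_def algebra_simps)
      then have "\<bar>x j - ev (S j)\<bar> = c * \<bar>\<gamma> * \<theta> ^ j - of_int (b j)\<bar>"
        using r D by (simp add: abs_mult c_def abs_minus_commute)
      also have "\<bar>\<gamma> * \<theta> ^ j - of_int (b j)\<bar> \<le> A / pi * (\<rho>\<^sup>2) ^ j"
        using b[of j] unfolding power_mult[symmetric] by (simp add: field_simps)
      finally show ?thesis using r D by (simp add: c_def mult_left_mono)
    qed
    then show "\<forall>\<^sub>F j in sequentially. norm (x j - ev (S j)) \<le> c * (A / pi * (\<rho>\<^sup>2) ^ j)" by simp
    show "(\<lambda>j. c * (A / pi * (\<rho>\<^sup>2) ^ j)) \<longlonglongrightarrow> 0"
      using \<rho>_pos \<rho>_less_1 by (intro tendsto_mult_right_zero LIMSEQ_power_zero) (simp add: power_less_one_iff)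
  qed
  have f_ev: "(\<lambda>j. \<bar>f (ev (S j))\<bar>) \<longlonglongrightarrow> V" using V(2) by (simp add: ev_S)
  have shift: "(\<lambda>j. \<bar>f (x j + t)\<bar>) \<longlonglongrightarrow> V * \<bar>f t\<bar>" for t
  proof -
    have "(\<lambda>j. f (x j + t) - f (ev (S j) + t)) \<longlonglongrightarrow> 0"
      using x_S by (intro f_diff_tendsto_0) (simp add: algebra_simps)
    from tendsto_add[OF this f_add_ev_tendsto_0[OF S far, of t]]
    have "(\<lambda>j. f (x j + t) - f (ev (S j)) * f t) \<longlonglongrightarrow> 0" by simp
    then have "(\<lambda>j. \<bar>f (x j + t)\<bar> - \<bar>f (ev (S j)) * f t\<bar>) \<longlonglongrightarrow> 0"
      by (rule Lim_null_comparison[OF _ tendsto_rabs_zero, rotated]) (simp add: abs_triangle_ineq3)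
    moreover have "(\<lambda>j. \<bar>f (ev (S j)) * f t\<bar>) \<longlonglongrightarrow> V * \<bar>f t\<bar>"
      unfolding abs_mult by (intro tendsto_intros f_ev)
    ultimately show ?thesis using tendsto_add by fastforce
  qed
  have memA: "\<bar>f (2 * r * of_int n)\<bar> \<in> A'" for n unfolding A'_def by blast
  have x_mem: "\<bar>f (x j + 2 * r * of_int n)\<bar> \<in> A'" for j n
    using memA[of "int g * D * b j + n"] by (simp add: x_def distrib_left)
  have x_mem': "\<bar>f (x j)\<bar> \<in> A'" for j using x_mem[of j 0] by simp
  have fx: "(\<lambda>j. \<bar>f (x j)\<bar>) \<longlonglongrightarrow> V" using shift[of 0] by simp
  have x_nz: "\<forall>\<^sub>F j in sequentially. x j \<noteq> 0"
  proof -
    have "\<forall>\<^sub>F j in sequentially. \<bar>x j - ev (S j)\<bar> < \<bar>ev s\<bar>"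
      using \<open>ev s \<noteq> 0\<close> by (intro order_tendstoD(2)[OF tendsto_rabs_zero[OF x_S]]) simp
    then show ?thesis
    proof eventually_elim
      case (elim j)
      have "\<theta> ^ j * \<bar>ev s\<bar> \<ge> 1 * \<bar>ev s\<bar>" using gt1 by (intro mult_right_mono one_le_power) auto
      then have "\<bar>ev (S j)\<bar> \<ge> \<bar>ev s\<bar>" using gt1 by (simp add: ev_S abs_mult)
      then show ?case using elim by auto
    qed
  qed
  have fx_pos: "\<forall>\<^sub>F j in sequentially. V / 2 < \<bar>f (x j)\<bar>"
    using V(1) by (intro order_tendstoD(1)[OF fx]) simp
  \<comment> \<open>The number t is one of the x_j, so that x_j + t and x_j - t remain integer
    multiples of 2r.\<close>
  obtain l where l: "x l \<noteq> 0" "V / 2 < \<bar>f (x l)\<bar>"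
    using eventually_conj[OF x_nz fx_pos] by (auto simp: eventually_sequentially)
  define t where "t = x l"
  have t: "t \<noteq> 0" "f t \<noteq> 0" using l V(1) by (auto simp: t_def)
  have limpt: "V islimpt A' \<or> V * \<bar>f t\<bar> islimpt A'"
  proof (rule ccontr)
    assume neg: "\<not> ?thesis"
    have tmem: "\<bar>f (x j + t)\<bar> \<in> A'" "\<bar>f (x j - t)\<bar> \<in> A'" for j
      using x_mem[of j "int g * D * b l"] x_mem[of j "- (int g * D * b l)"] by (simp_all add: t_def x_def)
    have e1: "\<forall>\<^sub>F j in sequentially. \<bar>f (x j)\<bar> = V"
      by (rule eventually_eq_if_not_islimpt[OF fx x_mem']) (use neg in blast)
    have e2: "\<forall>\<^sub>F j in sequentially. \<bar>f (x j + t)\<bar> = V * \<bar>f t\<bar>"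
      by (rule eventually_eq_if_not_islimpt[OF shift tmem(1)]) (use neg in blast)
    have e3: "\<forall>\<^sub>F j in sequentially. \<bar>f (x j - t)\<bar> = V * \<bar>f t\<bar>"
    proof (rule eventually_eq_if_not_islimpt[OF _ tmem(2)])
      show "(\<lambda>j. \<bar>f (x j - t)\<bar>) \<longlonglongrightarrow> V * \<bar>f t\<bar>" using shift[of "- t"] by simp
    qed (use neg in blast)
    define U where "U = of_int B * A * (pi * \<bar>t\<bar>) * real K * real 1"
    have "(\<lambda>j. sep_bound U j + pi * \<bar>x j - ev (S j)\<bar>) \<longlonglongrightarrow> 0 + 0"
      by (intro tendsto_add sep_bound_tendsto_0 tendsto_mult_right_zero tendsto_rabs_zero x_S)
    moreover have "V * \<bar>f t\<bar> > 0" using V(1) t by simp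
    ultimately have e4: "\<forall>\<^sub>F j in sequentially. sep_bound U j + pi * \<bar>x j - ev (S j)\<bar> < V * \<bar>f t\<bar>"
      by (intro order_tendstoD(2)) simp_all
    \<comment> \<open>This provides the smallness condition of \<open>f_add_mult_diff_less\<close>:
      the bound tends to 0, whereas |f(x_j)| |f(t)| tends to the positive number V |f(t)|. A single
      product of sines is estimated by the whole sum over k, with gap j between the support of
      \<open>S j\<close> and exponent 0.\<close>
    have small: "\<bar>sin (pi * x j / \<theta> ^ k)\<bar> * \<bar>sin (pi * t / \<theta> ^ k)\<bar> \<le> sep_bound U j + pi * \<bar>x j - ev (S j)\<bar>" for j k
    proof -
      have U0: "of_int B * A \<ge> 0" and concS: "conc (of_int B * A) (supp (S j)) (ev (S j))"
        using S[of j] conc_ev[of "S j" B] by (auto simp: sparse_polys_def conc_def)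
      have "\<bar>sin (pi * ev (S j) / \<theta> ^ k)\<bar> * \<bar>sin (pi * t / \<theta> ^ k)\<bar>
          \<le> (\<Sum>i<Suc k. \<bar>sin (pi * ev (S j) / \<theta> ^ i)\<bar> * \<bar>sin (pi * t / \<theta> ^ i)\<bar>)"
        by (rule member_le_sum) auto
      also have "\<dots> \<le> sep_bound (of_int B * A * (pi * \<bar>t\<bar>) * card (supp (S j)) * card {0::nat}) j"
        by (rule sum_sin_sin_le[OF concS conc_real]) (auto simp: S_def supp_monom_mult nat_dist_def)
      also have "\<dots> = sep_bound U j"
        by (simp add: U_def K_def S_def supp_monom_mult card_image)
      finally have 1: "\<bar>sin (pi * ev (S j) / \<theta> ^ k)\<bar> * \<bar>sin (pi * t / \<theta> ^ k)\<bar> \<le> sep_bound U j" .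
      have "pi * x j / \<theta> ^ k = pi * ev (S j) / \<theta> ^ k + pi * (x j - ev (S j)) / \<theta> ^ k"
        by (simp add: add_divide_distrib[symmetric] distrib_left[symmetric])
      then have "\<bar>sin (pi * x j / \<theta> ^ k)\<bar> \<le> \<bar>sin (pi * ev (S j) / \<theta> ^ k)\<bar> + \<bar>sin (pi * (x j - ev (S j)) / \<theta> ^ k)\<bar>"
        by (simp only: abs_sin_add_le)
      also have "\<bar>sin (pi * (x j - ev (S j)) / \<theta> ^ k)\<bar> \<le> \<bar>pi * (x j - ev (S j)) / \<theta> ^ k\<bar>"
        by (rule abs_sin_x_le_abs_x)
      also have "\<dots> \<le> pi * \<bar>x j - ev (S j)\<bar> / 1"
        unfolding abs_divide using gt1 by (intro frac_le) (auto simp: abs_mult intro: one_le_power)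
      finally have 2: "\<bar>sin (pi * x j / \<theta> ^ k)\<bar> \<le> \<bar>sin (pi * ev (S j) / \<theta> ^ k)\<bar> + pi * \<bar>x j - ev (S j)\<bar>" by simp
      have "\<bar>sin (pi * x j / \<theta> ^ k)\<bar> * \<bar>sin (pi * t / \<theta> ^ k)\<bar>
        \<le> (\<bar>sin (pi * ev (S j) / \<theta> ^ k)\<bar> + pi * \<bar>x j - ev (S j)\<bar>) * \<bar>sin (pi * t / \<theta> ^ k)\<bar>"
        using 2 by (rule mult_right_mono) simp
      also have "\<dots> \<le> sep_bound U j + pi * \<bar>x j - ev (S j)\<bar> * 1"
        unfolding distrib_right by (intro add_mono 1 mult_left_mono) auto
      finally show ?thesis by simp
    qed
    have "\<forall>\<^sub>F j in sequentially. False"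
      using e1 e2 e3 e4 x_nz
    proof eventually_elim
      case (elim j)
      have "f (x j) \<noteq> 0" using elim(1) V(1) by auto
      have "\<bar>f (x j + t)\<bar> * \<bar>f (x j - t)\<bar> < (f (x j))\<^sup>2 * (f t)\<^sup>2"
      proof (rule f_add_mult_diff_less)
        show "\<bar>sin (pi * x j / \<theta> ^ k)\<bar> * \<bar>sin (pi * t / \<theta> ^ k)\<bar> \<le> \<bar>f (x j)\<bar> * \<bar>f t\<bar>" for k
          unfolding elim(1) using small[of j k] elim(4) by linarith
      qed (use elim t \<open>f (x j) \<noteq> 0\<close> in auto)
      moreover have "(f (x j))\<^sup>2 = V\<^sup>2" using elim(1) by (metis power2_abs)
      ultimately show False using elim(2,3) by (simp add: power2_eq_square mult_ac)
    qed
    then show False by simp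
  qed
  then obtain y where y: "y islimpt A'" "y \<noteq> 0" using V(1) t by auto
  have step: "V * z islimpt A'" if z: "z islimpt A'" for z
    unfolding islimpt_approachable
  proof (intro allI impI)
    fix e :: real assume "e > 0"
    obtain n :: int where n: "\<bar>f (2 * r * of_int n)\<bar> \<noteq> z" "\<bar>\<bar>f (2 * r * of_int n)\<bar> - z\<bar> < e / 2"
    proof -
      obtain a where "a \<in> A'" "a \<noteq> z" "dist a z < e / 2"
        using z \<open>e > 0\<close> unfolding islimpt_approachable by (meson half_gt_zero)
      then show ?thesis using that by (auto simp: A'_def dist_real_def)
    qed
    define u where "u = \<bar>f (2 * r * of_int n)\<bar>"
    have "V * \<bar>u - z\<bar> > 0" using n(1) V(1) by (simp add: u_def)
    \<comment> \<open>The tolerance V |u - z| is the distance from V u to V z; it keeps the new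
      value different from V z, as a limit point requires.\<close>
    then have "\<forall>\<^sub>F j in sequentially. dist (\<bar>f (x j + 2 * r * of_int n)\<bar>) (V * u) < min (e / 2) (V * \<bar>u - z\<bar>)"
      using \<open>e > 0\<close> unfolding u_def by (intro tendstoD[OF shift]) simp
    then obtain j where j: "\<bar>\<bar>f (x j + 2 * r * of_int n)\<bar> - V * u\<bar> < min (e / 2) (V * \<bar>u - z\<bar>)"
      by (auto simp: eventually_sequentially dist_real_def)
    have Vuz: "\<bar>V * u - V * z\<bar> = V * \<bar>u - z\<bar>" using V(1) by (simp add: right_diff_distrib[symmetric] abs_mult)
    have "V * \<bar>u - z\<bar> \<le> \<bar>u - z\<bar>" using V(1) \<open>V < 1\<close> by (simp add: mult_left_le_one_le)
    define a where "a = \<bar>f (x j + 2 * r * of_int n)\<bar>"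
    have "\<bar>a - V * u\<bar> < e / 2" "\<bar>a - V * u\<bar> < V * \<bar>u - z\<bar>" using j by (simp_all add: a_def)
    then have "a \<noteq> V * z" "\<bar>a - V * z\<bar> < e"
      using Vuz n(2) \<open>V * \<bar>u - z\<bar> \<le> \<bar>u - z\<bar>\<close> unfolding u_def[symmetric] by linarith+
    then show "\<exists>a\<in>A'. a \<noteq> V * z \<and> dist a (V * z) < e"
      using x_mem[of j n] unfolding a_def[symmetric] dist_real_def by blast
  qed
  have "V ^ k * y islimpt A'" for k
    by (induction k) (use y(1) step in \<open>auto simp: mult.assoc\<close>)
  then have sub: "range (\<lambda>k. V ^ k * y) \<subseteq> {y. y islimpt A'}" by blast
  have "inj (\<lambda>k. V ^ k * y)"
    using y(2) V(1) \<open>V < 1\<close> by (intro injI) (simp add: power_inject_exp')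
  then have "infinite {y. y islimpt A'}"
    using sub range_inj_infinite infinite_super by blast
  moreover have "{y. y islimpt A'} \<subseteq> abs ` {y. y islimpt ?E}"
  proof
    fix z assume "z \<in> {y. y islimpt A'}"
    moreover have "bounded ?E" using abs_f_le_one by (auto simp: bounded_iff)
    ultimately show "z \<in> abs ` {y. y islimpt ?E}"
      unfolding A'_def mem_Collect_eq by (elim islimpt_abs_imageE) auto
  qed
  ultimately show ?thesis using finite_surj by blast
qed

end

section \<open>The generic case\<close>

text \<open>
  On a grid of mesh \<open>1 / y\<close> with \<open>y = \<bar>Y M\<bar>\<close> large, the exceptional set misses the proportion \<open>2 \<delta>\<close>
  of every grid interval, and the grid intervals that it meets fill hardly more than the set itself.
\<close>
lemma negligible_not_near_int:
  fixes Y :: "nat \<Rightarrow> real"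
  assumes Y: "filterlim (\<lambda>M. \<bar>Y M\<bar>) at_top sequentially" and \<delta>: "0 < \<delta>" "\<delta> \<le> 1/2"
  shows "negligible {v \<in> {a..b}. \<forall>M\<ge>N. \<forall>n::int. \<delta> \<le> \<bar>of_int n - Y M * v\<bar>}" (is "negligible ?Z")
proof -
  define Z where "Z = ?Z"
  have "Z = {a..b} \<inter> (\<Inter>M\<in>{N..}. \<Inter>n::int. {v. \<delta> \<le> \<bar>of_int n - Y M * v\<bar>})" by (auto simp: Z_def)
  also have "compact \<dots>"
    by (intro compact_Int_closed compact_Icc closed_INT ballI closed_Collect_le continuous_intros)
  finally have cpt: "compact Z" .
  then have Zm: "Z \<in> lmeasurable" by (rule lmeasurable_compact)
  have key: "measure lebesgue Z \<le> (1 - 2 * \<delta>) * (measure lebesgue Z + e)" if "e > 0" for e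
  proof -
    obtain U where U: "open U" "Z \<subseteq> U" "U - Z \<in> lmeasurable" "emeasure lebesgue (U - Z) < ennreal e"
      using sets_lebesgue_outer_open[OF fmeasurableD[OF Zm] \<open>e > 0\<close>] by blast
    have Um: "U \<in> lmeasurable"
      using fmeasurable.Un[OF U(3) Zm] U(2) by (simp add: Un_absorb2)
    have "measure lebesgue (U - Z) < e"
      using U(3,4) \<open>e > 0\<close> by (simp add: emeasure_eq_measure2 ennreal_less_iff)
    then have mU: "measure lebesgue U \<le> measure lebesgue Z + e"
      using measurable_measure_Diff[OF Um fmeasurableD[OF Zm] U(2)] by simp
    \<comment> \<open>Compactness of \<open>Z\<close> makes the width uniform, so grid intervals
      shorter than \<eta> that meet \<open>Z\<close> stay inside \<open>U\<close>.\<close>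
    obtain \<eta> where \<eta>: "\<eta> > 0" "(\<Union>z\<in>Z. ball z \<eta>) \<subseteq> U"
      using compact_subset_open_imp_ball_epsilon_subset[OF cpt U(1,2)] by blast
    have "\<forall>\<^sub>F M in sequentially. 1 / \<eta> < \<bar>Y M\<bar>" using Y unfolding filterlim_at_top_dense by blast
    from eventually_conj[OF this eventually_ge_at_top[of N]]
    obtain M where M: "M \<ge> N" "1 / \<eta> < \<bar>Y M\<bar>" by (auto simp: eventually_sequentially)
    define y where "y = \<bar>Y M\<bar>"
    have "0 < 1 / \<eta>" using \<eta>(1) by simp
    then have "y > 0" using M(2) unfolding y_def by (rule less_trans)
    then have y: "y > 0" "1 / y < \<eta>" using M(2) \<eta>(1) by (simp_all add: y_def[symmetric] field_simps)
    have near: "\<delta> \<le> \<bar>of_int n - y * v\<bar>" if "v \<in> Z" for v and n :: int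
    proof (cases "Y M \<ge> 0")
      case True
      then show ?thesis using that M(1) by (auto simp: Z_def y_def)
    next
      case False
      have "\<delta> \<le> \<bar>of_int (- n) - Y M * v\<bar>" using that M(1) unfolding Z_def by blast
      then show ?thesis using False by (simp add: y_def abs_if split: if_splits)
    qed
    define J where "J k = {of_int k / y..<(of_int k + 1) / y}" for k :: int
    \<comment> \<open>The part of the grid interval \<open>J k\<close> on which y v keeps distance
      \<delta> from the two integers at its ends.\<close>
    define I where "I k = {(of_int k + \<delta>) / y..(of_int k + 1 - \<delta>) / y}" for k :: int
    define \<K> where "\<K> = (\<lambda>v. \<lfloor>y * v\<rfloor>) ` Z"
    have fl: "v \<in> J \<lfloor>y * v\<rfloor>" for v
      using y(1) floor_correct[of "y * v"] by (auto simp: J_def field_simps)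
    have "bounded Z" using cpt by (rule compact_imp_bounded)
    then obtain R where R: "\<And>v. v \<in> Z \<Longrightarrow> \<bar>v\<bar> \<le> R" by (auto simp: bounded_iff)
    have "\<K> \<subseteq> {\<lfloor>y * - R\<rfloor>..\<lfloor>y * R\<rfloor>}"
    proof
      fix k assume "k \<in> \<K>"
      then obtain v where v: "v \<in> Z" "k = \<lfloor>y * v\<rfloor>" by (auto simp: \<K>_def)
      have "- R \<le> v" "v \<le> R" using R[OF v(1)] by auto
      then show "k \<in> {\<lfloor>y * - R\<rfloor>..\<lfloor>y * R\<rfloor>}"
        unfolding v(2) atLeastAtMost_iff using y(1) by (intro conjI floor_mono mult_left_mono) auto
    qed
    then have fin: "finite \<K>" by (rule finite_subset) simp
    have Z_sub: "Z \<subseteq> (\<Union>k\<in>\<K>. I k)"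
    proof
      fix v assume v: "v \<in> Z"
      define k where "k = \<lfloor>y * v\<rfloor>"
      have "of_int k \<le> y * v" "y * v < of_int k + 1" using floor_correct[of "y * v"] by (auto simp: k_def)
      then have "of_int k + \<delta> \<le> y * v" "y * v \<le> of_int k + 1 - \<delta>"
        using near[OF v, of k] near[OF v, of "k + 1"] by auto
      then have "v \<in> I k" using y(1) by (auto simp: I_def field_simps)
      then show "v \<in> (\<Union>k\<in>\<K>. I k)" using v by (auto simp: \<K>_def k_def)
    qed
    have J_sub: "(\<Union>k\<in>\<K>. J k) \<subseteq> U"
    proof (rule UN_least)
      fix k assume "k \<in> \<K>"
      then obtain v where v: "v \<in> Z" "k = \<lfloor>y * v\<rfloor>" by (auto simp: \<K>_def)
      show "J k \<subseteq> U"
      proof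
        fix w assume w: "w \<in> J k"
        have "v \<in> J k" using fl v(2) by simp
        moreover have "(of_int k + 1) / y - of_int k / y = 1 / y" by (simp add: diff_divide_distrib[symmetric])
        ultimately have "\<bar>v - w\<bar> < \<eta>" using w y(2) unfolding J_def atLeastLessThan_iff by linarith
        then have "w \<in> ball v \<eta>" by (simp add: dist_real_def)
        then show "w \<in> U" using \<eta>(2) v(1) by blast
      qed
    qed
    have mI: "measure lebesgue (I k) = (1 - 2 * \<delta>) / y" for k
    proof -
      have "(of_int k + \<delta>) / y \<le> (of_int k + 1 - \<delta>) / y" using \<delta> y(1) by (intro divide_right_mono) auto
      then show ?thesis by (simp add: I_def measure_completion diff_divide_distrib[symmetric])
    qed
    have mJ: "measure lebesgue (J k) = 1 / y" for k
    proof -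
      have "of_int k / y \<le> (of_int k + 1) / y" using y(1) by (intro divide_right_mono) auto
      then show ?thesis by (simp add: J_def measure_completion diff_divide_distrib[symmetric])
    qed
    have Jm: "J k \<in> lmeasurable" for k
      unfolding J_def by (rule bounded_set_imp_lmeasurable) auto
    have disj: "disjoint_family_on J \<K>"
      unfolding disjoint_family_on_def
    proof (intro ballI impI)
      fix k l :: int assume "k \<noteq> l"
      show "J k \<inter> J l = {}"
      proof (rule ccontr)
        assume "J k \<inter> J l \<noteq> {}"
        then obtain v where "v \<in> J k" "v \<in> J l" by blast
        then have "\<lfloor>y * v\<rfloor> = k" "\<lfloor>y * v\<rfloor> = l"
          using y(1) by (auto simp: J_def field_simps intro!: floor_unique)
        then show False using \<open>k \<noteq> l\<close> by simp
      qed
    qed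
    have "measure lebesgue Z \<le> measure lebesgue (\<Union>k\<in>\<K>. I k)"
      using fin by (intro measure_mono_fmeasurable[OF Z_sub] fmeasurableD Zm fmeasurable.finite_UN) (auto simp: I_def)
    also have "\<dots> \<le> (\<Sum>k\<in>\<K>. measure lebesgue (I k))"
      using fin by (intro measure_UNION_le) (auto simp: I_def)
    also have "\<dots> = (1 - 2 * \<delta>) * (\<Sum>k\<in>\<K>. measure lebesgue (J k))" by (simp add: mI mJ)
    also have "(\<Sum>k\<in>\<K>. measure lebesgue (J k)) = measure lebesgue (\<Union>k\<in>\<K>. J k)"
    proof (rule measure_finite_Union[symmetric, OF fin _ disj])
      show "J ` \<K> \<subseteq> sets lebesgue" using fmeasurableD[OF Jm] by blast
      show "emeasure lebesgue (J k) \<noteq> \<infinity>" for k using fmeasurableD2[OF Jm] by simp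
    qed
    also have "(1 - 2 * \<delta>) * measure lebesgue (\<Union>k\<in>\<K>. J k) \<le> (1 - 2 * \<delta>) * (measure lebesgue Z + e)"
    proof (rule mult_left_mono)
      have "measure lebesgue (\<Union>k\<in>\<K>. J k) \<le> measure lebesgue U"
        using fin by (intro measure_mono_fmeasurable[OF J_sub] fmeasurableD Um fmeasurable.finite_UN Jm) auto
      then show "measure lebesgue (\<Union>k\<in>\<K>. J k) \<le> measure lebesgue Z + e" using mU by simp
    qed (use \<delta> in simp)
    finally show ?thesis .
  qed
  have "2 * \<delta> * measure lebesgue Z \<le> e" if "e > 0" for e
  proof -
    have "(1 - 2 * \<delta>) * e \<le> e" using that \<delta> by (intro mult_left_le_one_le) auto
    then show ?thesis using key[OF that] by (simp add: algebra_simps)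
  qed
  then have "2 * \<delta> * measure lebesgue Z \<le> 0" by (rule field_le_epsilon[of _ 0, simplified])
  then have "measure lebesgue Z = 0" using \<delta>(1) measure_nonneg[of lebesgue Z] by (simp add: mult_le_0_iff)
  then have "negligible Z" using Zm by (simp add: negligible_iff_measure)
  then show ?thesis by (simp add: Z_def)
qed

text \<open>With v = 1 / r, the distance |r n - Y| is r |n - Y v|, which reduces the claim to
  \<open>negligible_not_near_int\<close>. Inversion is differentiable on each compact range of v
  away from 0 and so preserves null sets; countably many parameters suffice.\<close>

lemma AE_near_multiple:
  fixes Y :: "nat \<Rightarrow> real"
  assumes Y: "filterlim (\<lambda>M. \<bar>Y M\<bar>) at_top sequentially"
  shows "AE r in lebesgue. r > 0 \<longrightarrow> (\<forall>\<delta>>0. \<forall>N. \<exists>M\<ge>N. \<exists>n::int. \<bar>r * of_int n - Y M\<bar> < \<delta>)"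
proof -
  \<comment> \<open>The factor \<open>Suc p\<close> absorbs the bound on r, and the factor 2 keeps
    the threshold at most 1/2.\<close>
  define Z where "Z i N p = {v \<in> {1 / real (Suc p)..real (Suc p)}.
    \<forall>M\<ge>N. \<forall>n::int. 1 / (2 * real (Suc i) * real (Suc p)) \<le> \<bar>of_int n - Y M * v\<bar>}" for i N p
  define W where "W = (\<Union>i. \<Union>N. \<Union>p. inverse ` Z i N p)"
  have "negligible (inverse ` Z i N p)" for i N p
  proof (rule negligible_differentiable_image_negligible[OF order_refl])
    have "1 / (2 * real (Suc i) * real (Suc p)) \<le> 1 / 2"
    proof (rule frac_le)
      have "1 * 1 \<le> real (Suc i) * real (Suc p)" by (rule mult_mono) auto
      then show "2 \<le> 2 * real (Suc i) * real (Suc p)" by linarith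
    qed auto
    then show "negligible (Z i N p)" unfolding Z_def by (intro negligible_not_near_int[OF Y]) auto
    show "inverse differentiable_on Z i N p"
      unfolding Z_def by (intro derivative_intros) (auto simp: field_simps)
  qed
  then have "negligible W" unfolding negligible_iff_null_sets W_def by (intro null_sets_UN)
  then have "AE r in lebesgue. r \<notin> W" by (intro AE_not_in) (simp add: negligible_iff_null_sets)
  then show ?thesis
  proof eventually_elim
    case (elim r)
    show ?case
    proof (intro impI allI)
      fix \<delta> :: real and N :: nat assume r: "r > 0" and \<delta>: "\<delta> > 0"
      obtain i where i: "1 / real (Suc i) < \<delta>" using \<delta> reals_Archimedean by (auto simp: inverse_eq_divide)
      obtain p :: nat where p: "max r (1 / r) < real p" using reals_Archimedean2 by blast
      have p': "r \<le> real (Suc p)" "1 / r \<le> real (Suc p)" using p by auto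
      have "inverse (1 / r) \<notin> inverse ` Z i N p" using elim r by (auto simp: W_def)
      then have "1 / r \<notin> Z i N p" by blast
      moreover have "1 / real (Suc p) \<le> 1 / r" using p'(1) r by (intro divide_left_mono) auto
      ultimately obtain M and n :: int where M: "M \<ge> N"
        and n: "\<bar>of_int n - Y M * (1 / r)\<bar> < 1 / (2 * real (Suc i) * real (Suc p))"
        using p'(2) unfolding Z_def by (auto simp: not_le)
      have "\<bar>r * of_int n - Y M\<bar> = r * \<bar>of_int n - Y M * (1 / r)\<bar>"
        using r by (simp add: abs_mult[of r, symmetric, unfolded abs_of_pos[OF r]] right_diff_distrib)
      also have "\<dots> \<le> real (Suc p) * (1 / (2 * real (Suc i) * real (Suc p)))"
        using n p'(1) r by (intro mult_mono) auto
      also have "\<dots> = 1 / (2 * real (Suc i))" by (simp del: of_nat_Suc)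
      also have "\<dots> < \<delta>" using i by (intro le_less_trans[OF _ i] divide_left_mono) auto
      finally show "\<exists>M\<ge>N. \<exists>n::int. \<bar>r * of_int n - Y M\<bar> < \<delta>" using M by blast
    qed
  qed
qed

section \<open>Limits far out, and the points that almost every r inherits from them\<close>

context pisot_system
begin

text \<open>The sets do not mention r, so that one exceptional null set can serve all of them.
  Divergence of \<open>ev\<close> supplies the unbounded targets for
  \<open>AE_near_multiple\<close>.\<close>

definition far_limits :: "nat \<Rightarrow> int \<Rightarrow> real set" where
  "far_limits K B = {u. \<exists>s. (\<forall>j. s j \<in> sparse_polys K B) \<and>
     (\<forall>M. \<forall>\<^sub>F j in sequentially. supp (s j) \<subseteq> {M..}) \<and>
     filterlim (\<lambda>j. \<bar>ev (s j)\<bar>) at_top sequentially \<and> (\<lambda>j. f (ev (s j))) \<longlonglongrightarrow> u}"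

lemma AE_far_limit_mult:
  assumes "u \<in> far_limits K B"
  shows "AE r in lebesgue. r > 0 \<longrightarrow> u * f t \<in> closure (range (\<lambda>n :: int. f (2 * r * of_int n)))"
proof -
  obtain s where s: "\<And>j. s j \<in> sparse_polys K B"
    and far: "\<And>M. \<forall>\<^sub>F j in sequentially. supp (s j) \<subseteq> {M..}"
    and inf: "filterlim (\<lambda>j. \<bar>ev (s j)\<bar>) at_top sequentially" and u: "(\<lambda>j. f (ev (s j))) \<longlonglongrightarrow> u"
    using assms unfolding far_limits_def by blast
  \<comment> \<open>Halved, because \<open>f\<close> is sampled at 2rn.\<close>
  define Y where "Y j = (ev (s j) + t) / 2" for j
  have "filterlim (\<lambda>j. - \<bar>t\<bar> / 2 + 1 / 2 * \<bar>ev (s j)\<bar>) at_top sequentially"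
    by (rule filterlim_tendsto_add_at_top[OF tendsto_const])
      (rule filterlim_tendsto_pos_mult_at_top[OF tendsto_const _ inf], simp)
  then have "filterlim (\<lambda>j. \<bar>Y j\<bar>) at_top sequentially"
  proof (rule filterlim_at_top_mono, intro always_eventually allI)
    fix j
    have "\<bar>ev (s j)\<bar> \<le> \<bar>ev (s j) + t\<bar> + \<bar>t\<bar>" using abs_triangle_ineq[of "ev (s j) + t" "- t"] by simp
    then show "- \<bar>t\<bar> / 2 + 1 / 2 * \<bar>ev (s j)\<bar> \<le> \<bar>Y j\<bar>" by (simp add: Y_def)
  qed
  from AE_near_multiple[OF this] show ?thesis
  proof eventually_elim
    case (elim r)
    show ?case
    proof
      assume "r > 0"
      have lim: "(\<lambda>j. f (ev (s j) + t)) \<longlonglongrightarrow> u * f t"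
        using tendsto_add[OF f_add_ev_tendsto_0[OF s far, of t] tendsto_mult[OF u tendsto_const[of "f t"]]] by simp
      define L where "L = pi * \<theta> / (\<theta> - 1)"
      have "L > 0" using gt1 by (simp add: L_def)
      show "u * f t \<in> closure (range (\<lambda>n :: int. f (2 * r * of_int n)))"
        unfolding closure_approachable
      proof (intro allI impI)
        fix e :: real assume "e > 0"
        obtain N where N: "\<And>j. j \<ge> N \<Longrightarrow> dist (f (ev (s j) + t)) (u * f t) < e / 2"
          using tendstoD[OF lim, of "e / 2"] \<open>e > 0\<close> by (auto simp: eventually_sequentially)
        have "e / (4 * L) > 0" using \<open>e > 0\<close> \<open>L > 0\<close> by simp
        then obtain j and n :: int where j: "j \<ge> N" and n: "\<bar>r * of_int n - Y j\<bar> < e / (4 * L)"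
          using elim \<open>r > 0\<close> by blast
        have "\<bar>f (2 * r * of_int n) - f (ev (s j) + t)\<bar> \<le> L * \<bar>2 * r * of_int n - (ev (s j) + t)\<bar>"
          unfolding L_def by (rule f_lipschitz)
        also have "\<bar>2 * r * of_int n - (ev (s j) + t)\<bar> = 2 * \<bar>r * of_int n - Y j\<bar>"
          by (simp add: Y_def abs_if field_simps)
        also have "L * \<dots> < e / 2" using n \<open>L > 0\<close> by (simp add: field_simps)
        finally have "dist (f (2 * r * of_int n)) (u * f t) < e"
          using N[OF j] unfolding dist_real_def by linarith
        then show "\<exists>y\<in>range (\<lambda>n :: int. f (2 * r * of_int n)). dist y (u * f t) < e" by blast
      qed
    qed
  qed
qed

text \<open>The null set of \<open>AE_far_limit_mult\<close> depends on u and t. Countable dense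
  sets of both are treated first; continuity of the product in each variable and closedness of the
  target give the rest.\<close>

lemma AE_far_limits_mult:
  "AE r in lebesgue. r > 0 \<longrightarrow>
    (\<forall>K B. \<forall>u\<in>far_limits K B. \<forall>t. u * f t \<in> closure (range (\<lambda>n :: int. f (2 * r * of_int n))))"
proof -
  have "\<forall>K B. \<exists>T. countable T \<and> T \<subseteq> far_limits K B \<and> far_limits K B \<subseteq> closure T"
    using separable by metis
  then obtain T where T: "\<And>K B. countable (T K B)" "\<And>K B. T K B \<subseteq> far_limits K B"
    "\<And>K B. far_limits K B \<subseteq> closure (T K B)" by metis
  obtain R :: "real set" where R: "countable R" "UNIV \<subseteq> closure R" using separable by metis
  have "AE r in lebesgue. \<forall>K. \<forall>B. \<forall>u\<in>T K B. \<forall>t\<in>R.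
      r > 0 \<longrightarrow> u * f t \<in> closure (range (\<lambda>n :: int. f (2 * r * of_int n)))"
    unfolding AE_all_countable using T(1,2) R(1)
    by (intro allI AE_ball_countable[THEN iffD2] ballI AE_far_limit_mult[OF subsetD[OF T(2)]]) auto
  then show ?thesis
  proof eventually_elim
    case (elim r)
    define C where "C = closure (range (\<lambda>n :: int. f (2 * r * of_int n)))"
    have "closed C" by (simp add: C_def)
    show ?case
      unfolding C_def[symmetric]
    proof (intro impI allI ballI)
      fix K B u t assume r: "r > 0" and u: "u \<in> far_limits K B"
      have u': "u * f t' \<in> C" if "t' \<in> R" for t'
      proof -
        have "closed {v. v * f t' \<in> C}"
          using continuous_closed_preimage[of UNIV "\<lambda>v. v * f t'" C] \<open>closed C\<close>
          by (simp add: vimage_def continuous_intros)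
        moreover have "T K B \<subseteq> {v. v * f t' \<in> C}" using elim r that by (auto simp: C_def)
        ultimately have "closure (T K B) \<subseteq> {v. v * f t' \<in> C}" by (rule closure_minimal[rotated])
        then show ?thesis using T(3) u by blast
      qed
      have "closed {t'. u * f t' \<in> C}"
        using continuous_closed_preimage[of UNIV "\<lambda>t'. u * f t'" C] \<open>closed C\<close> continuous_f
        by (simp add: vimage_def continuous_intros)
      then have "closure R \<subseteq> {t'. u * f t' \<in> C}" using u' by (intro closure_minimal) auto
      then show "u * f t \<in> C" using R(2) by blast
    qed
  qed
qed

lemma limit_point_factors:
  assumes r: "r > 0" and y: "y islimpt (range (\<lambda>n :: int. f (2 * r * of_int n)))" and "y \<noteq> 0"
  shows "\<exists>K B. \<exists>u\<in>far_limits K B. \<exists>w. y = u * f w"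
proof -
  obtain a where a: "\<And>j. a j \<in> range (\<lambda>n :: int. f (2 * r * of_int n)) - {y}" and lim: "a \<longlonglongrightarrow> y"
    using y unfolding islimpt_sequential by blast
  have "\<forall>j. \<exists>n :: int. a j = f (2 * r * of_int n)" using a by blast
  then obtain n where n: "\<And>j. a j = f (2 * r * of_int (n j))" by metis
  have n_inf: "filterlim (\<lambda>j. \<bar>2 * r * of_int (n j)\<bar>) at_top sequentially"
    unfolding filterlim_at_top
  proof
    fix R :: real
    \<comment> \<open>The sample points of bounded size yield finitely many values, and a sequence
      that tends to y without attaining it eventually avoids them. Hence the sample points
      diverge.\<close>
    define F where "F = (\<lambda>k :: int. f (2 * r * of_int k)) ` {- \<lceil>R / (2 * r)\<rceil>..\<lceil>R / (2 * r)\<rceil>} - {y}"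
    have "finite F" by (simp add: F_def)
    then have "open (- F)" by (simp add: finite_imp_closed open_closed)
    moreover have "y \<in> - F" by (simp add: F_def)
    ultimately have "\<forall>\<^sub>F j in sequentially. a j \<in> - F" by (rule topological_tendstoD[OF lim])
    then show "\<forall>\<^sub>F j in sequentially. R \<le> \<bar>2 * r * of_int (n j)\<bar>"
    proof eventually_elim
      case (elim j)
      have "n j \<notin> {- \<lceil>R / (2 * r)\<rceil>..\<lceil>R / (2 * r)\<rceil>}"
        using elim a[of j] by (auto simp: F_def n)
      then have "\<lceil>R / (2 * r)\<rceil> \<le> \<bar>n j\<bar>" by auto
      then have "R / (2 * r) \<le> \<bar>real_of_int (n j)\<bar>" by (simp add: ceiling_le_iff)
      then show ?case using r by (simp add: abs_mult field_simps)
    qed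
  qed
  define c where "c = \<bar>y\<bar> / 2"
  have "c > 0" using \<open>y \<noteq> 0\<close> by (simp add: c_def)
  have "\<forall>\<^sub>F j in sequentially. c < \<bar>a j\<bar>"
    using order_tendstoD(1)[OF tendsto_rabs[OF lim], of c] \<open>y \<noteq> 0\<close> by (simp add: c_def)
  then obtain N where N: "\<And>j. j \<ge> N \<Longrightarrow> c < \<bar>a j\<bar>" by (auto simp: eventually_sequentially)
  define x where "x j = 2 * r * of_int (n (j + N))" for j
  have x: "c \<le> \<bar>f (x j)\<bar>" for j using N[of "j + N"] by (simp add: x_def n)
  obtain K B s w and \<phi> :: "nat \<Rightarrow> nat" where \<phi>: "strict_mono \<phi>" and s: "\<And>j. s j \<in> sparse_polys K B"
    and far: "\<And>M. \<forall>\<^sub>F j in sequentially. supp (s j) \<subseteq> {M..}"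
    and w: "(\<lambda>j. x (\<phi> j) - ev (s j)) \<longlonglongrightarrow> w"
    and fw: "(\<lambda>j. f (x (\<phi> j)) - f (ev (s j)) * f w) \<longlonglongrightarrow> 0"
    using decomposition[of c x, OF \<open>c > 0\<close> x] by blast
  have "(\<lambda>j. f (x j)) \<longlonglongrightarrow> y"
    using LIMSEQ_ignore_initial_segment[OF lim, of N] by (simp add: x_def n)
  from LIMSEQ_subseq_LIMSEQ[OF this \<phi>] have "(\<lambda>j. f (x (\<phi> j))) \<longlonglongrightarrow> y" by (simp add: o_def)
  from tendsto_diff[OF this fw] have prod: "(\<lambda>j. f (ev (s j)) * f w) \<longlonglongrightarrow> y" by simp
  have "f w \<noteq> 0"
  proof
    assume "f w = 0"
    with prod have "(\<lambda>_. 0) \<longlonglongrightarrow> y" by simp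
    from LIMSEQ_unique[OF this tendsto_const] show False using \<open>y \<noteq> 0\<close> by simp
  qed
  have "(\<lambda>j. f (ev (s j)) * f w / f w) \<longlonglongrightarrow> y / f w"
    using \<open>f w \<noteq> 0\<close> by (intro tendsto_divide prod tendsto_const)
  then have u: "(\<lambda>j. f (ev (s j))) \<longlonglongrightarrow> y / f w" using \<open>f w \<noteq> 0\<close> by simp
  have x_inf: "filterlim (\<lambda>j. \<bar>x (\<phi> j)\<bar>) at_top sequentially"
  proof -
    have "filterlim (\<lambda>j. \<phi> j + N) sequentially sequentially"
      using \<phi> by (intro filterlim_subseq) (auto simp: strict_mono_def)
    from filterlim_compose[OF n_inf this] show ?thesis by (simp add: x_def)
  qed
  have "filterlim (\<lambda>j. - \<bar>x (\<phi> j) - ev (s j)\<bar> + \<bar>x (\<phi> j)\<bar>) at_top sequentially"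
    by (rule filterlim_tendsto_add_at_top[OF tendsto_minus[OF tendsto_rabs[OF w]] x_inf])
  then have "filterlim (\<lambda>j. \<bar>ev (s j)\<bar>) at_top sequentially"
    by (rule filterlim_at_top_mono) (intro always_eventually allI, linarith)
  then have "y / f w \<in> far_limits K B" unfolding far_limits_def using s far u by blast
  moreover have "y = y / f w * f w" using \<open>f w \<noteq> 0\<close> by simp
  ultimately show ?thesis by blast
qed

lemma ex_far_limit_nonzero:
  assumes alg: "algebraic_int \<theta>" and ne2: "\<theta> \<noteq> 2"
  shows "\<exists>K B. \<exists>u\<in>far_limits K B. u \<noteq> 0"
proof -
  obtain g :: nat where g: "g > 0" and nz: "\<And>i k. cos (pi * (of_nat g * \<gamma> * \<theta> ^ i / \<theta> ^ k)) \<noteq> 0"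
    using nonvanishing[OF alg ne2, of \<gamma>] by blast
  define s where "s = [:int g:]"
  have ev_s: "ev s = of_nat g * \<gamma>" by (simp add: ev_def s_def map_poly_pCons)
  have coeff_s: "coeff s m = (if m = 0 then int g else 0)" for m by (cases m) (simp_all add: s_def)
  then have supp_s: "supp s \<subseteq> {0}" by (auto simp: supp_def)
  have s: "s \<in> sparse_polys 1 (int g)"
    using card_mono[OF _ supp_s] by (simp add: sparse_polys_def coeff_s)
  obtain V where V: "V > 0" "(\<lambda>n. \<bar>f (\<theta> ^ n * ev s)\<bar>) \<longlonglongrightarrow> V"
    using f_ev_power_limit[of s] nz unfolding ev_s by blast
  have "bounded (range (\<lambda>n. f (\<theta> ^ n * ev s)))" using abs_f_le_one by (auto simp: bounded_iff)
  \<comment> \<open>Only the absolute values are known to converge; a subsequence settles the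
    sign.\<close>
  then obtain u \<phi> where \<phi>: "strict_mono \<phi>" and u: "((\<lambda>n. f (\<theta> ^ n * ev s)) \<circ> \<phi>) \<longlonglongrightarrow> u"
    using bounded_imp_convergent_subsequence by blast
  define S where "S j = monom 1 (\<phi> j) * s" for j
  have ev_S: "ev (S j) = \<theta> ^ \<phi> j * ev s" for j by (simp add: S_def ev_monom_mult)
  have "\<bar>u\<bar> = V"
  proof (rule LIMSEQ_unique)
    show "(\<lambda>j. \<bar>f (\<theta> ^ \<phi> j * ev s)\<bar>) \<longlonglongrightarrow> \<bar>u\<bar>" using tendsto_rabs[OF u] by (simp add: o_def)
    show "(\<lambda>j. \<bar>f (\<theta> ^ \<phi> j * ev s)\<bar>) \<longlonglongrightarrow> V" using LIMSEQ_subseq_LIMSEQ[OF V(2) \<phi>] by (simp add: o_def)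
  qed
  then have "u \<noteq> 0" using V(1) by auto
  moreover have "u \<in> far_limits 1 (int g)"
    unfolding far_limits_def mem_Collect_eq
  proof (intro exI[of _ S] conjI allI)
    show "S j \<in> sparse_polys 1 (int g)" for j unfolding S_def by (rule sparse_polys_monom_mult[OF s])
    show "\<forall>\<^sub>F j in sequentially. supp (S j) \<subseteq> {M..}" for M
      using eventually_ge_at_top[of M]
    proof eventually_elim
      case (elim j)
      then show ?case using seq_suble[OF \<phi>, of j] by (auto simp: S_def supp_monom_mult)
    qed
    have "filterlim (\<lambda>n. \<theta> ^ n) at_top sequentially"
      using filterlim_at_infinity_imp_norm_at_top[OF filterlim_realpow_sequentially_gt1[of \<theta>]] gt1 by simp
    from filterlim_compose[OF this filterlim_subseq[OF \<phi>]]
    have "filterlim (\<lambda>j. of_nat g * \<bar>\<gamma>\<bar> * \<theta> ^ \<phi> j) at_top sequentially"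
      using g \<gamma>_nonzero by (intro filterlim_tendsto_pos_mult_at_top[OF tendsto_const]) auto
    moreover have "\<bar>ev (S j)\<bar> = of_nat g * \<bar>\<gamma>\<bar> * \<theta> ^ \<phi> j" for j
      using gt1 by (simp add: ev_S ev_s abs_mult)
    ultimately show "filterlim (\<lambda>j. \<bar>ev (S j)\<bar>) at_top sequentially" by simp
    show "(\<lambda>j. f (ev (S j))) \<longlonglongrightarrow> u" using u by (simp add: o_def ev_S)
  qed
  ultimately show ?thesis by blast
qed

lemma AE_limit_points_interval:
  assumes alg: "algebraic_int \<theta>" and ne2: "\<theta> \<noteq> 2"
  shows "AE r in lebesgue. r > 0 \<longrightarrow>
    (let D = {y. y islimpt (range (\<lambda>n :: int. f (2 * r * of_int n)))}
     in is_interval D \<and> (\<exists>a\<in>D. \<exists>b\<in>D. a < b))"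
  using AE_far_limits_mult
proof eventually_elim
  case (elim r)
  define E where "E = range (\<lambda>n :: int. f (2 * r * of_int n))"
  define D where "D = {y. y islimpt E}"
  show ?case
    unfolding E_def[symmetric] D_def[symmetric] Let_def
  proof
    assume r: "r > 0"
    have mult: "u * f t \<in> closure E" if "u \<in> far_limits K B" for u K B t
      using elim r that unfolding E_def by blast
    have segment: "closed_segment 0 y \<subseteq> D" if u: "u \<in> far_limits K B" and y: "y = u * f w" "y \<noteq> 0" for K B u w y
    proof
      fix z assume z: "z \<in> closed_segment 0 y"
      \<comment> \<open>By \<open>f_half\<close> the range contains 0, and with f(w) the segment
        between them. Scaling by u puts the segment from 0 to y into the closure of E.\<close>
      have "connected (range f)" by (rule connected_continuous_image[OF continuous_f connected_UNIV])
      then have "closed_segment 0 (f w) \<subseteq> range f"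
        using f_half by (intro closed_segment_subset) (auto simp: is_interval_connected_1[symmetric] is_interval_convex intro: rev_image_eqI[of "1/2"])
      moreover have "closed_segment 0 y = (*) u ` closed_segment 0 (f w)"
        unfolding y(1) using closed_segment_linear_image[of "(*) u" 0 "f w"] by (simp add: linear_times)
      ultimately have "closed_segment 0 y \<subseteq> closure E" using mult[OF u] by auto
      \<comment> \<open>A segment with distinct ends has no isolated points, so lying in the closure
        of E already makes its points limit points of E.\<close>
      moreover have "z islimpt closed_segment 0 y"
      proof (rule connected_imp_perfect[OF connected_segment z])
        fix a show "closed_segment 0 y \<noteq> {a}" 
        proof
          assume eq: "closed_segment 0 y = {a}"
          have "0 \<in> closed_segment 0 y" "y \<in> closed_segment 0 y" by simp_all
          then show False using y(2) unfolding eq by simp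
        qed
      qed
      ultimately have "z islimpt closure E" using islimpt_subset by blast
      then show "z \<in> D" by (simp add: D_def limpt_of_closure)
    qed
    obtain K B u where u: "u \<in> far_limits K B" "u \<noteq> 0" using ex_far_limit_nonzero[OF alg ne2] by blast
    have seg_u: "closed_segment 0 u \<subseteq> D" by (rule segment[OF u(1), of _ 0]) (use u in auto)
    then have uD: "u \<in> D" and zeroD: "0 \<in> D" by auto
    have star: "closed_segment 0 y \<subseteq> D" if y: "y \<in> D" for y
    proof (cases "y = 0")
      case False
      then obtain K B u w where "u \<in> far_limits K B" "y = u * f w"
        using limit_point_factors[OF r] y unfolding D_def E_def by blast
      then show ?thesis using segment False by blast
    qed (use zeroD in simp)
    show "is_interval D \<and> (\<exists>a\<in>D. \<exists>b\<in>D. a < b)"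
    proof
      show "is_interval D"
        unfolding is_interval_1
      proof (intro ballI allI impI)
        fix a b x assume "a \<in> D" "b \<in> D" "a \<le> x \<and> x \<le> b"
        then show "x \<in> D"
          using star[of a] star[of b] by (cases "x \<ge> 0") (auto simp: closed_segment_eq_real_ivl split: if_splits)
      qed
      have "u < 0 \<or> 0 < u" using u(2) by linarith
      then show "\<exists>a\<in>D. \<exists>b\<in>D. a < b" using uD zeroD by blast
    qed
  qed
qed

end

theorem theorem1p3:
  fixes \<theta> :: real
  assumes "pisot \<theta>" and "\<theta> \<noteq> 2"
  shows "(\<forall>r \<in> rat_adjoin \<theta>. r > 0 \<longrightarrow>
            (let D = euclidean derived_set_of (fourier_values (bernoulli_convolution \<theta>) r)
             in countable D \<and> infinite D)) \<and>
         (AE r in lebesgue. r > 0 \<longrightarrow>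
            (let D = euclidean derived_set_of (fourier_values (bernoulli_convolution \<theta>) r)
             in is_interval D \<and> (\<exists>a \<in> D. \<exists>b \<in> D. a < b)))"
proof -
  have gt1: "\<theta> > 1" and alg: "algebraic_int \<theta>" using assms(1) by (auto simp: pisot_def)
  obtain \<gamma> \<rho> A where "pisot_system \<theta> \<gamma> \<rho> A" using pisot_imp_pisot_system[OF assms(1)] by blast
  then interpret pisot_system \<theta> \<gamma> \<rho> A .
  \<comment> \<open>The factor 2 appears because \<open>fourier\<close> has the cosines of 2 pi t /
    \<theta>^k and \<open>bprod\<close> those of pi x / \<theta>^k.\<close>
  have E: "euclidean derived_set_of (fourier_values (bernoulli_convolution \<theta>) r) =
      {y. y islimpt (range (\<lambda>n :: int. bprod \<theta> (2 * r * of_int n)))}" for r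
    by (simp add: euclidean_derived_set_of fourier_values_bernoulli_convolution[OF gt1] bprod_def mult_ac)
  show ?thesis
    unfolding E
  proof (intro conjI ballI impI)
    fix r assume r: "r \<in> rat_adjoin \<theta>" "r > 0"
    have two: "2 \<in> rat_adjoin \<theta>" using rat_adjoin.rat[of 2 \<theta>] by simp
    have r2: "2 * r \<in> rat_adjoin \<theta>" by (rule rat_adjoin.mult[OF two r(1)])
    then have ir2: "inverse (2 * r) \<in> rat_adjoin \<theta>" using r(2) by (intro rat_adjoin.inverse) auto
    obtain D h where Dh: "D > 0" "of_int D * (2 * r) = poly (map_poly of_int h) \<theta>"
      using rat_adjoin_int_multiple(1)[OF alg _ r2] gt1 by auto
    obtain D' h' where Dh': "D' > 0" "of_int D' * inverse (2 * r) = poly (map_poly of_int h') (1 / \<theta>)"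
      using rat_adjoin_int_multiple(2)[OF alg _ ir2] gt1 by auto
    show "let D = {y. y islimpt (range (\<lambda>n :: int. bprod \<theta> (2 * r * of_int n)))} in countable D \<and> infinite D"
      using countable_limit_points[OF r(2) Dh'] infinite_limit_points[OF alg assms(2) r(2) Dh]
      by (simp only: Let_def) blast
  qed (rule AE_limit_points_interval[OF alg assms(2)])
qed

end
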